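(* Let $(M^n,g)$ be a closed $n$-dimensional Riemannian manifold with a smooth vector field $X$ such that $(M,g,X)$ has positive weighted sectional curvature. Then the following hold: \begin{itemize} \item If $n$ is even, then any Killing field on $(M,g)$ has a zero. Equivalently, any isometric torus action on $(M,g)$ has a fixed point. \item If $n$ is odd, then any torus acting isometrically on $(M,g)$ has a circle orbit. In particular, there exists a codimension one subtorus that has a fixed point. \end{itemize}
   Context: Closed means compact without boundary. Let $(M,g)$ be a Riemannian manifold and $X$ a smooth vector field on $M$; $L_Xg$ denotes the Lie derivative of $g$ along $X$. For an orthonormal pair $(U,V)$ in $T_pM$, let $\sec(U,V)$ be the sectional curvature of the plane spanned by $U,V$, and set $$\sec_X^V(U)=\sec(U,V)+\tfrac12 (L_Xg)(V,V).$$ If $X=\nabla f$ for a smooth function $f$, set $$\overline{\sec}_f^V(U)=\sec(U,V)+\mathrm{Hess}\, f(V,V)+df(V)^2.$$ Write $\sec_X>0$ (resp. $\overline{\sec}_f>0$) if $\sec_X^V(U)>0$ (resp. $\overline{\sec}_f^V(U)>0$) for every point $p\in M$ and every orthonormal pair $(U,V)$ in $T_pM$. The triple $(M,g,X)$ has positive weighted sectional curvature if either $\sec_X>0$, or $X=\nabla f$ and $\overline{\sec}_f>0$ for some smooth function $f$.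
   Formalization: For n odd, the circle-orbit claim is stated only for nontrivial actions of tori of positive rank, since under a trivial action (e.g. on the round 3-sphere) every orbit is a point; the codimension one subtorus claim needs no such nontriviality. *)

theory Defs
  imports "HOL-Analysis.Analysis" "HOL-Algebra.Group_Action"
begin

section \<open>Smooth maps between Euclidean spaces\<close>

text \<open>Used for open \<open>S\<close> only. Since all directional derivatives are required to be
  \<open>C\<^sup>k\<close>, this is the usual notion of being of class \<open>C\<^sup>k\<close>.\<close>

primrec Ck_on :: "nat \<Rightarrow> 'a::euclidean_space set \<Rightarrow> ('a \<Rightarrow> 'b::euclidean_space) \<Rightarrow> bool" where
  "Ck_on 0 S f \<longleftrightarrow> continuous_on S f"
| "Ck_on (Suc k) S f \<longleftrightarrow> f differentiable_on S \<and>
     (\<forall>v. Ck_on k S (\<lambda>x. frechet_derivative f (at x) v))"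

definition smooth_on :: "'a::euclidean_space set \<Rightarrow> ('a \<Rightarrow> 'b::euclidean_space) \<Rightarrow> bool" where
  "smooth_on S f \<longleftrightarrow> (\<forall>k. Ck_on k S f)"


section \<open>Smooth manifolds\<close>

text \<open>The underlying space of the manifold is a whole type \<open>'m\<close>; Hausdorff and second countable
  are imposed by type classes, and the dimension is \<open>CARD('n)\<close>. A chart is a domain together
  with a coordinate map; the values of the coordinate map outside the domain are irrelevant.\<close>

type_synonym ('m, 'n) chart = "'m set \<times> ('m \<Rightarrow> real ^ 'n)"

definition chart_image :: "('m, 'n::finite) chart \<Rightarrow> (real ^ 'n) set" where
  "chart_image c = snd c ` fst c"

definition chart_inv :: "('m, 'n::finite) chart \<Rightarrow> real ^ 'n \<Rightarrow> 'm" where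
  "chart_inv c = inv_into (fst c) (snd c)"

definition is_chart :: "('m::topological_space, 'n::finite) chart \<Rightarrow> bool" where
  "is_chart c \<longleftrightarrow> open (fst c) \<and> open (chart_image c) \<and>
     homeomorphism (fst c) (chart_image c) (snd c) (chart_inv c)"

definition smooth_atlas :: "('m::{t2_space,second_countable_topology}, 'n::finite) chart set \<Rightarrow> bool"
  where
  "smooth_atlas A \<longleftrightarrow> (\<forall>c\<in>A. is_chart c) \<and> (\<Union>c\<in>A. fst c) = UNIV \<and>
     (\<forall>c\<in>A. \<forall>d\<in>A. smooth_on (snd c ` (fst c \<inter> fst d)) (snd d \<circ> chart_inv c))"

definition smooth_function :: "('m, 'n::finite) chart set \<Rightarrow> ('m \<Rightarrow> real) \<Rightarrow> bool" where
  "smooth_function A f \<longleftrightarrow> (\<forall>c\<in>A. smooth_on (chart_image c) (f \<circ> chart_inv c))"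

text \<open>A tangent vector at \<open>p\<close> is represented by the family of its components with respect to all
  charts of the atlas around \<open>p\<close>, subject to the usual transformation law (and by \<open>0\<close> for the
  remaining pairs, so that the representation is unique).\<close>

type_synonym ('m, 'n) tangent = "('m, 'n) chart \<Rightarrow> real ^ 'n"

definition tangent_space :: "('m, 'n::finite) chart set \<Rightarrow> 'm \<Rightarrow> ('m, 'n) tangent set" where
  "tangent_space A p = {v.
     (\<forall>c\<in>A. \<forall>d\<in>A. p \<in> fst c \<inter> fst d \<longrightarrow>
        v d = frechet_derivative (snd d \<circ> chart_inv c) (at (snd c p)) (v c)) \<and>
     (\<forall>c. c \<notin> A \<or> p \<notin> fst c \<longrightarrow> v c = 0)}"

text \<open>The tangent vector at \<open>p\<close> whose components in the chart \<open>c\<close> are \<open>u\<close>.\<close>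

definition tangent_of ::
  "('m, 'n::finite) chart set \<Rightarrow> ('m, 'n) chart \<Rightarrow> 'm \<Rightarrow> real ^ 'n \<Rightarrow> ('m, 'n) tangent" where
  "tangent_of A c p u = (\<lambda>d. if d \<in> A \<and> p \<in> fst d
     then frechet_derivative (snd d \<circ> chart_inv c) (at (snd c p)) u else 0)"

text \<open>The differential of \<open>f\<close> at \<open>p\<close>, computed in the chart \<open>c\<close> around \<open>p\<close>.\<close>

definition differential ::
  "('m, 'n::finite) chart \<Rightarrow> ('m \<Rightarrow> real) \<Rightarrow> 'm \<Rightarrow> ('m, 'n) tangent \<Rightarrow> real" where
  "differential c f p V = frechet_derivative (f \<circ> chart_inv c) (at (snd c p)) (V c)"

definition field_in ::
  "('m, 'n::finite) chart \<Rightarrow> ('m \<Rightarrow> ('m, 'n) tangent) \<Rightarrow> real ^ 'n \<Rightarrow> real ^ 'n" where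
  "field_in c X x = X (chart_inv c x) c"

definition smooth_vector_field ::
  "('m, 'n::finite) chart set \<Rightarrow> ('m \<Rightarrow> ('m, 'n) tangent) \<Rightarrow> bool" where
  "smooth_vector_field A X \<longleftrightarrow>
     (\<forall>p. X p \<in> tangent_space A p) \<and> (\<forall>c\<in>A. smooth_on (chart_image c) (field_in c X))"


section \<open>Riemannian metrics\<close>

type_synonym ('m, 'n) metric = "'m \<Rightarrow> ('m, 'n) tangent \<Rightarrow> ('m, 'n) tangent \<Rightarrow> real"

text \<open>The coordinate expression \<open>g\<^sub>x(u, v) = \<Sum> g\<^sub>i\<^sub>j(x) u\<^sub>i v\<^sub>j\<close> of the metric in the chart \<open>c\<close>.\<close>

definition metric_in :: "('m, 'n::finite) chart set \<Rightarrow> ('m, 'n) metric \<Rightarrow> ('m, 'n) chart \<Rightarrow>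
    real ^ 'n \<Rightarrow> real ^ 'n \<Rightarrow> real ^ 'n \<Rightarrow> real" where
  "metric_in A g c x u v =
     (let p = chart_inv c x in g p (tangent_of A c p u) (tangent_of A c p v))"

definition riemannian_metric :: "('m, 'n::finite) chart set \<Rightarrow> ('m, 'n) metric \<Rightarrow> bool" where
  "riemannian_metric A g \<longleftrightarrow> (\<forall>c\<in>A.
     (\<forall>x\<in>chart_image c. bilinear (metric_in A g c x) \<and>
        (\<forall>u v. metric_in A g c x u v = metric_in A g c x v u) \<and>
        (\<forall>u. u \<noteq> 0 \<longrightarrow> metric_in A g c x u u > 0)) \<and>
     (\<forall>u v. smooth_on (chart_image c) (\<lambda>x. metric_in A g c x u v)))"

definition orthonormal_pair ::
  "('m, 'n::finite) chart set \<Rightarrow> ('m, 'n) metric \<Rightarrow> 'm \<Rightarrow>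
    ('m, 'n) tangent \<Rightarrow> ('m, 'n) tangent \<Rightarrow> bool" where
  "orthonormal_pair A g p U V \<longleftrightarrow> U \<in> tangent_space A p \<and> V \<in> tangent_space A p \<and>
     g p U U = 1 \<and> g p V V = 1 \<and> g p U V = 0"


section \<open>Local expressions of the tensors of Riemannian geometry\<close>

text \<open>Here \<open>G\<close> is the coordinate expression of a metric on an open set of \<open>\<real>\<^sup>n\<close>, and vectors
  \<open>u, v, w\<close> are identified with the corresponding constant vector fields. In particular
  \<open>christoffel G x u v = \<Sum> \<Gamma>\<^sub>i\<^sub>j\<^sup>k(x) u\<^sub>i v\<^sub>j e\<^sub>k\<close> is the Levi-Civita derivative of \<open>v\<close> in the
  direction \<open>u\<close>, given by the Koszul formula.\<close>

abbreviation dir_deriv :: "('a::real_normed_vector \<Rightarrow> 'b::real_normed_vector) \<Rightarrow> 'a \<Rightarrow> 'a \<Rightarrow> 'b"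
  where
  "dir_deriv F x u \<equiv> frechet_derivative F (at x) u"

definition christoffel :: "(real ^ 'n \<Rightarrow> real ^ 'n \<Rightarrow> real ^ 'n \<Rightarrow> real) \<Rightarrow>
    real ^ 'n \<Rightarrow> real ^ 'n \<Rightarrow> real ^ 'n \<Rightarrow> real ^ ('n::finite)" where
  "christoffel G x u v = (THE w. \<forall>z. 2 * G x w z =
     dir_deriv (\<lambda>y. G y v z) x u + dir_deriv (\<lambda>y. G y u z) x v - dir_deriv (\<lambda>y. G y u v) x z)"

text \<open>\<open>R(u, v) w = \<nabla>\<^sub>u \<nabla>\<^sub>v w - \<nabla>\<^sub>v \<nabla>\<^sub>u w - \<nabla>\<^sub>[\<^sub>u\<^sub>,\<^sub>v\<^sub>] w\<close>, where the bracket of constant fields vanishes.\<close>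

definition riemann :: "(real ^ 'n \<Rightarrow> real ^ 'n \<Rightarrow> real ^ 'n \<Rightarrow> real) \<Rightarrow>
    real ^ 'n \<Rightarrow> real ^ 'n \<Rightarrow> real ^ 'n \<Rightarrow> real ^ 'n \<Rightarrow> real ^ ('n::finite)" where
  "riemann G x u v w =
     dir_deriv (\<lambda>y. christoffel G y v w) x u + christoffel G x u (christoffel G x v w)
     - (dir_deriv (\<lambda>y. christoffel G y u w) x v + christoffel G x v (christoffel G x u w))"

definition sectional_local :: "(real ^ 'n \<Rightarrow> real ^ 'n \<Rightarrow> real ^ 'n \<Rightarrow> real) \<Rightarrow>
    real ^ 'n \<Rightarrow> real ^ 'n \<Rightarrow> real ^ ('n::finite) \<Rightarrow> real" where
  "sectional_local G x u v =
     G x (riemann G x u v v) u / (G x u u * G x v v - (G x u v)\<^sup>2)"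

text \<open>\<open>(L\<^sub>X g)(v, w) = X (g(v, w)) - g([X, v], w) - g(v, [X, w])\<close>, where \<open>[X, v] = - D\<^sub>v X\<close> for a
  constant field \<open>v\<close>.\<close>

definition lie_deriv_local :: "(real ^ 'n \<Rightarrow> real ^ 'n \<Rightarrow> real ^ 'n \<Rightarrow> real) \<Rightarrow>
    (real ^ 'n \<Rightarrow> real ^ 'n) \<Rightarrow> real ^ 'n \<Rightarrow> real ^ 'n \<Rightarrow> real ^ ('n::finite) \<Rightarrow> real" where
  "lie_deriv_local G X x v w =
     dir_deriv (\<lambda>y. G y v w) x (X x) + G x (dir_deriv X x v) w + G x v (dir_deriv X x w)"

text \<open>\<open>Hess f (v, w) = v (w f) - (\<nabla>\<^sub>v w) f\<close>.\<close>

definition hessian_local :: "(real ^ 'n \<Rightarrow> real ^ 'n \<Rightarrow> real ^ 'n \<Rightarrow> real) \<Rightarrow>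
    (real ^ 'n \<Rightarrow> real) \<Rightarrow> real ^ 'n \<Rightarrow> real ^ 'n \<Rightarrow> real ^ ('n::finite) \<Rightarrow> real" where
  "hessian_local G f x v w =
     dir_deriv (\<lambda>y. dir_deriv f y w) x v - dir_deriv f x (christoffel G x v w)"


section \<open>The tensors on the manifold\<close>

text \<open>Each of the following is computed in a chart \<open>c \<in> A\<close> around \<open>p\<close> and does not depend on it;
  the conditions below quantify over all charts of the atlas around \<open>p\<close>.\<close>

definition sec :: "('m, 'n::finite) chart set \<Rightarrow> ('m, 'n) metric \<Rightarrow> ('m, 'n) chart \<Rightarrow> 'm \<Rightarrow>
    ('m, 'n) tangent \<Rightarrow> ('m, 'n) tangent \<Rightarrow> real" where
  "sec A g c p U V = sectional_local (metric_in A g c) (snd c p) (U c) (V c)"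

definition lie_deriv :: "('m, 'n::finite) chart set \<Rightarrow> ('m, 'n) metric \<Rightarrow>
    ('m \<Rightarrow> ('m, 'n) tangent) \<Rightarrow> ('m, 'n) chart \<Rightarrow> 'm \<Rightarrow>
    ('m, 'n) tangent \<Rightarrow> ('m, 'n) tangent \<Rightarrow> real" where
  "lie_deriv A g X c p V W =
     lie_deriv_local (metric_in A g c) (field_in c X) (snd c p) (V c) (W c)"

definition hessian :: "('m, 'n::finite) chart set \<Rightarrow> ('m, 'n) metric \<Rightarrow> ('m \<Rightarrow> real) \<Rightarrow>
    ('m, 'n) chart \<Rightarrow> 'm \<Rightarrow> ('m, 'n) tangent \<Rightarrow> ('m, 'n) tangent \<Rightarrow> real" where
  "hessian A g f c p V W =
     hessian_local (metric_in A g c) (f \<circ> chart_inv c) (snd c p) (V c) (W c)"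

definition is_gradient :: "('m, 'n::finite) chart set \<Rightarrow> ('m, 'n) metric \<Rightarrow> ('m \<Rightarrow> real) \<Rightarrow>
    ('m \<Rightarrow> ('m, 'n) tangent) \<Rightarrow> bool" where
  "is_gradient A g f X \<longleftrightarrow>
     (\<forall>p. \<forall>V \<in> tangent_space A p. \<forall>c\<in>A. p \<in> fst c \<longrightarrow> g p (X p) V = differential c f p V)"

definition sec_X :: "('m, 'n::finite) chart set \<Rightarrow> ('m, 'n) metric \<Rightarrow> ('m \<Rightarrow> ('m, 'n) tangent) \<Rightarrow>
    ('m, 'n) chart \<Rightarrow> 'm \<Rightarrow> ('m, 'n) tangent \<Rightarrow> ('m, 'n) tangent \<Rightarrow> real" where
  "sec_X A g X c p V U = sec A g c p U V + 1 / 2 * lie_deriv A g X c p V V"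

definition sec_bar :: "('m, 'n::finite) chart set \<Rightarrow> ('m, 'n) metric \<Rightarrow> ('m \<Rightarrow> real) \<Rightarrow>
    ('m, 'n) chart \<Rightarrow> 'm \<Rightarrow> ('m, 'n) tangent \<Rightarrow> ('m, 'n) tangent \<Rightarrow> real" where
  "sec_bar A g f c p V U =
     sec A g c p U V + hessian A g f c p V V + (differential c f p V)\<^sup>2"

definition positive_weighted_sec :: "('m, 'n::finite) chart set \<Rightarrow> ('m, 'n) metric \<Rightarrow>
    ('m \<Rightarrow> ('m, 'n) tangent) \<Rightarrow> bool" where
  "positive_weighted_sec A g X \<longleftrightarrow>
     (\<forall>p U V. orthonormal_pair A g p U V \<longrightarrow>
        (\<forall>c\<in>A. p \<in> fst c \<longrightarrow> sec_X A g X c p V U > 0)) \<or>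
     (\<exists>f. smooth_function A f \<and> is_gradient A g f X \<and>
        (\<forall>p U V. orthonormal_pair A g p U V \<longrightarrow>
           (\<forall>c\<in>A. p \<in> fst c \<longrightarrow> sec_bar A g f c p V U > 0)))"

definition killing_field :: "('m, 'n::finite) chart set \<Rightarrow> ('m, 'n) metric \<Rightarrow>
    ('m \<Rightarrow> ('m, 'n) tangent) \<Rightarrow> bool" where
  "killing_field A g K \<longleftrightarrow> smooth_vector_field A K \<and>
     (\<forall>p. \<forall>V \<in> tangent_space A p. \<forall>W \<in> tangent_space A p. \<forall>c\<in>A.
        p \<in> fst c \<longrightarrow> lie_deriv A g K c p V W = 0)"

definition is_zero_of :: "('m \<Rightarrow> ('m, 'n::finite) tangent) \<Rightarrow> 'm \<Rightarrow> bool" where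
  "is_zero_of K p \<longleftrightarrow> K p = (\<lambda>_. 0)"


section \<open>Tori and isometric torus actions\<close>

text \<open>\<open>torus UNIV\<close> is the standard torus of rank \<open>CARD('k)\<close>, a product of circles; for a set \<open>I\<close>
  of indices, \<open>torus I\<close> is the product of the circle factors with index in \<open>I\<close>, a torus of rank
  \<open>card I\<close>. The multiplication is componentwise.\<close>

definition torus :: "'k set \<Rightarrow> (complex ^ 'k::finite) monoid" where
  "torus I = \<lparr>carrier = {z. \<forall>i. if i \<in> I then cmod (z $ i) = 1 else z $ i = 1},
              mult = (*), one = 1\<rparr>"

text \<open>A subtorus of rank \<open>r\<close> is a subgroup isomorphic, as a topological group, to a torus of
  rank \<open>r\<close>. The inverse of \<open>h\<close> on its image is automatically continuous by compactness.\<close>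

definition codim_one_subtorus :: "(complex ^ 'k::finite) set \<Rightarrow> bool" where
  "codim_one_subtorus H \<longleftrightarrow> subgroup H (torus UNIV) \<and>
     (\<exists>(I :: 'k set) h. card I + 1 = CARD('k) \<and> h \<in> hom (torus I) (torus UNIV) \<and>
        continuous_on (carrier (torus I)) h \<and> inj_on h (carrier (torus I)) \<and>
        h ` carrier (torus I) = H)"

text \<open>The universal covering of the torus by \<open>\<real>\<^sup>k\<close>; being a local diffeomorphism, it can be used to
  test smoothness on the torus.\<close>

definition torus_exp :: "real ^ 'k \<Rightarrow> complex ^ 'k::finite" where
  "torus_exp t = (\<chi> i. cis (2 * pi * t $ i))"

definition smooth_torus_map :: "('m::topological_space, 'n::finite) chart set \<Rightarrow>
    (complex ^ 'k::finite \<Rightarrow> 'm \<Rightarrow> 'm) \<Rightarrow> bool" where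
  "smooth_torus_map A \<rho> \<longleftrightarrow>
     continuous_on (carrier (torus UNIV) \<times> UNIV) (\<lambda>(z, p). \<rho> z p) \<and>
     (\<forall>c\<in>A. \<forall>d\<in>A. smooth_on
        {(t, x). x \<in> chart_image c \<and> \<rho> (torus_exp t) (chart_inv c x) \<in> fst d}
        (\<lambda>(t, x). snd d (\<rho> (torus_exp t) (chart_inv c x))))"

text \<open>Preservation of the metric by a smooth map \<open>F\<close>, expressed in charts: \<open>F\<^sup>* g = g\<close>.\<close>

definition preserves_metric :: "('m, 'n::finite) chart set \<Rightarrow> ('m, 'n) metric \<Rightarrow>
    ('m \<Rightarrow> 'm) \<Rightarrow> bool" where
  "preserves_metric A g F \<longleftrightarrow>
     (\<forall>c\<in>A. \<forall>d\<in>A. \<forall>p. p \<in> fst c \<and> F p \<in> fst d \<longrightarrow>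
        (let DF = frechet_derivative (snd d \<circ> F \<circ> chart_inv c) (at (snd c p)) in
          \<forall>u v. metric_in A g d (snd d (F p)) (DF u) (DF v) = metric_in A g c (snd c p) u v))"

definition isometric_torus_action :: "('m::topological_space, 'n::finite) chart set \<Rightarrow>
    ('m, 'n) metric \<Rightarrow> (complex ^ 'k::finite \<Rightarrow> 'm \<Rightarrow> 'm) \<Rightarrow> bool" where
  "isometric_torus_action A g \<rho> \<longleftrightarrow> group_action (torus UNIV) UNIV \<rho> \<and>
     smooth_torus_map A \<rho> \<and> (\<forall>z \<in> carrier (torus UNIV). preserves_metric A g (\<rho> z))"

definition nontrivial_action :: "(complex ^ 'k::finite \<Rightarrow> 'm \<Rightarrow> 'm) \<Rightarrow> bool" where
  "nontrivial_action \<rho> \<longleftrightarrow> (\<exists>z \<in> carrier (torus UNIV). \<exists>p. \<rho> z p \<noteq> p)"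

definition has_fixed_point :: "(complex ^ 'k::finite) set \<Rightarrow> (complex ^ 'k \<Rightarrow> 'm \<Rightarrow> 'm) \<Rightarrow> bool" where
  "has_fixed_point H \<rho> \<longleftrightarrow> (\<exists>p. \<forall>z\<in>H. \<rho> z p = p)"

definition has_circle_orbit ::
  "(complex ^ 'k::finite \<Rightarrow> 'm::topological_space \<Rightarrow> 'm) \<Rightarrow> bool" where
  "has_circle_orbit \<rho> \<longleftrightarrow>
     (\<exists>p. Group_Action.orbit (torus UNIV) \<rho> p homeomorphic sphere (0::complex) 1)"

end

theory Submission
  imports Defs
begin

text \<open>Berger's argument: let \<open>Y\<close>, \<open>K\<close> be commuting Killing fields, with \<open>K = 0\<close> in even dimensions
  and \<open>K\<close> nowhere zero in odd dimensions, and let \<open>p\<close> minimize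
  \<open>F = |Y|\<^sup>2 - g(Y, K)\<^sup>2 / |K|\<^sup>2\<close>, the squared length of the part of \<open>Y\<close> orthogonal to \<open>K\<close>. If the minimum
  is positive, replace \<open>Y\<close> by \<open>Z = Y - r K\<close> with the constant \<open>r\<close> for which \<open>Z \<bottom> K\<close> at \<open>p\<close>. As the
  skew form \<open>g(\<nabla>\<^sub>v Z, w)\<close> has a radical on the odd-dimensional space \<open>{Z, K}\<^sup>\<bottom>\<close>, there is \<open>v \<noteq> 0\<close> in it with
  \<open>\<nabla>\<^sub>v Z\<close> parallel to \<open>K\<close>, and the second variation of \<open>F\<close> along \<open>v\<close> gives \<open>sec(v, Z) \<le> 0\<close>. The weight
  does not spoil this: at critical points of \<open>|Z|\<^sup>2\<close>, the terms \<open>1/2 (L\<^sub>X g)(Z, Z)\<close> and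
  \<open>Hess f (Z, Z) + df(Z)\<^sup>2\<close> equal \<open>Z \<psi>\<close> and \<open>e\<^sup>-\<^sup>f Z \<psi>\<close>, where \<open>\<psi>\<close> is \<open>g(X, Z)\<close> or \<open>e\<^sup>f g(X, Z)\<close>. Instead of
  making \<open>X\<close> invariant by averaging, choose \<open>p\<close> as a limit of minima of \<open>F - \<epsilon> \<psi>\<close>; since \<open>F\<close> is constant
  along \<open>Y\<close> and \<open>K\<close>, the derivative \<open>Z \<psi>\<close> vanishes at these minima.

  For a torus action this is applied to the fields generated by \<open>(1, N, N\<^sup>2, \<dots>)\<close>, and a limit
  \<open>N \<rightarrow> \<infinity>\<close> yields a point that is fixed (\<open>n\<close> even) or has a one-dimensional orbit (\<open>n\<close> odd). If the
  fixed point set is nonempty but not open, a one-dimensional orbit is found near one of its boundary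
  points, where the action can be linearized.\<close>

section \<open>Calculus of smooth maps\<close>

text \<open>The manifold is not assumed to be connected, so the fixed point set of a torus may be
  open and closed and yet neither empty nor everything. This is why the Berger argument is stated
  over a compact open set. Odd dimensions call for the field K because there the orthogonal
  complement of one vector has even dimension, where a skew form can be nondegenerate; removing one
  more direction restores the parity. The price is that the derivative of Z along the null direction
  is controlled only up to a multiple of K. In the second variation of |Z|^2 this multiple enters
  with the wrong sign, and the subtracted projection to K outweighs it. The perturbed minima may
  belong to any \<epsilon> > 0: the equation they satisfy does not contain \<epsilon>, so it passes
  to the closure. Directions with integer coordinates are chosen in the limit arguments because the
  time along them matters only modulo 1, which makes compactness available.\<close>

lemma smooth_on_differentiable:
  assumes "smooth_on S f" "open S" "x \<in> S"
  shows "f differentiable at x"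
proof -
  have "Ck_on (Suc 0) S f" using assms(1) by (simp only: smooth_on_def)
  then show ?thesis using assms(2,3) by (auto simp: differentiable_on_eq_differentiable_at)
qed

lemma smooth_on_has_derivative:
  assumes "smooth_on S f" "open S" "x \<in> S"
  shows "(f has_derivative frechet_derivative f (at x)) (at x)"
  using smooth_on_differentiable[OF assms] by (simp add: frechet_derivative_works)

lemma smooth_on_dir_deriv:
  assumes "smooth_on S f"
  shows "smooth_on S (\<lambda>x. dir_deriv f x v)"
  unfolding smooth_on_def
proof
  fix k
  have "Ck_on (Suc k) S f" using assms by (simp only: smooth_on_def)
  then show "Ck_on k S (\<lambda>x. dir_deriv f x v)" by simp
qed

lemma smooth_on_continuous:
  assumes "smooth_on S f"
  shows "continuous_on S f"
proof -
  have "Ck_on 0 S f" using assms by (simp only: smooth_on_def)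
  then show ?thesis by simp
qed

text \<open>\<open>frechet_derivative\<close> selects among all derivatives at a point, and
  functions that agree near the point have the same derivatives, even if there are none.\<close>

lemma dir_deriv_cong:
  assumes "open S" "x \<in> S" "\<And>y. y \<in> S \<Longrightarrow> f y = h y"
  shows "frechet_derivative f (at x) = frechet_derivative h (at x)"
proof -
  have "\<forall>D. (f has_derivative D) (at x) \<longleftrightarrow> (h has_derivative D) (at x)"
  proof
    fix D
    show "(f has_derivative D) (at x) \<longleftrightarrow> (h has_derivative D) (at x)"
    proof
      assume "(f has_derivative D) (at x)"
      then show "(h has_derivative D) (at x)"
        by (rule has_derivative_transform_within_open[OF _ assms])
    next
      assume "(h has_derivative D) (at x)"
      then show "(f has_derivative D) (at x)"
        by (rule has_derivative_transform_within_open[OF _ assms(1,2)]) (simp add: assms(3))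
    qed
  qed
  then show ?thesis unfolding frechet_derivative_def by simp
qed

lemma Ck_on_cong:
  assumes "open S" "\<And>y. y \<in> S \<Longrightarrow> f y = h y" "Ck_on k S f"
  shows "Ck_on k S h"
  using assms(2,3)
proof (induction k arbitrary: f h)
  case 0
  then show ?case by (simp cong: continuous_on_cong)
next
  case (Suc k)
  have "h differentiable_on S"
    unfolding differentiable_on_def
  proof
    fix x assume x: "x \<in> S"
    then have "f differentiable at x within S"
      using Suc.prems(2) by (simp add: differentiable_on_def)
    then show "h differentiable at x within S"
      by (rule differentiable_transform_within[where d=1]) (use x Suc.prems(1) in auto)
  qed
  moreover have "Ck_on k S (\<lambda>x. dir_deriv h x v)" for v
  proof (rule Suc.IH)
    show "Ck_on k S (\<lambda>x. dir_deriv f x v)" using Suc.prems by simp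
  qed (use dir_deriv_cong[OF assms(1)] Suc.prems in metis)
  ultimately show ?case by simp
qed

text \<open>For an affine inner map the directional derivative along \<open>v\<close> is that of
  \<open>f\<close> along the fixed vector \<open>L v\<close>, composed with the same map, so the
  induction stays within functions of one form. It serves to freeze the time in the chart expression
  of the action.\<close>

lemma Ck_on_compose_affine:
  fixes L :: "'a::euclidean_space \<Rightarrow> 'b::euclidean_space" and f :: "'b \<Rightarrow> 'c::euclidean_space"
  assumes "open S" "open T" "bounded_linear L" "\<And>x. x \<in> T \<Longrightarrow> b + L x \<in> S" "Ck_on k S f"
  shows "Ck_on k T (\<lambda>x. f (b + L x))"
  using assms(5)
proof (induction k arbitrary: f)
  case 0
  have "continuous_on T (\<lambda>x. b + L x)"
    by (intro continuous_intros linear_continuous_on assms)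
  then show ?case using 0 assms(4)
    by (auto intro: continuous_on_compose2[of S f])
next
  case (Suc k)
  have D: "((\<lambda>x. f (b + L x)) has_derivative (\<lambda>v. dir_deriv f (b + L x) (L v))) (at x)" if "x \<in> T" for x
  proof -
    have "f differentiable at (b + L x)"
      using Suc.prems assms that by (simp add: differentiable_on_eq_differentiable_at)
    then have "(f has_derivative frechet_derivative f (at (b + L x))) (at (b + L x))"
      by (simp add: frechet_derivative_works)
    moreover have "((\<lambda>x. b + L x) has_derivative L) (at x)"
      using bounded_linear_imp_has_derivative[OF assms(3)] by (auto intro!: derivative_eq_intros)
    ultimately show ?thesis
      using has_derivative_compose by fastforce
  qed
  have "(\<lambda>x. f (b + L x)) differentiable_on T"
    using D by (meson differentiable_at_imp_differentiable_on differentiable_def)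
  moreover have "Ck_on k T (\<lambda>x. dir_deriv (\<lambda>x. f (b + L x)) x v)" for v
  proof (rule Ck_on_cong[OF assms(2)])
    show "Ck_on k T (\<lambda>x. dir_deriv f (b + L x) (L v))"
      using Suc.IH[of "\<lambda>y. dir_deriv f y (L v)"] Suc.prems by simp
  qed (use D frechet_derivative_at in metis)
  ultimately show ?case by simp
qed

lemma smooth_on_compose_affine:
  fixes L :: "'a::euclidean_space \<Rightarrow> 'b::euclidean_space" and f :: "'b \<Rightarrow> 'c::euclidean_space"
  assumes "smooth_on S f" "open S" "open T" "bounded_linear L" "\<And>x. x \<in> T \<Longrightarrow> b + L x \<in> S"
  shows "smooth_on T (\<lambda>x. f (b + L x))"
  using Ck_on_compose_affine assms unfolding smooth_on_def by blast

lemma smooth_on_cong: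
  assumes "open S" "\<And>y. y \<in> S \<Longrightarrow> f y = h y" "smooth_on S f"
  shows "smooth_on S h"
  using Ck_on_cong assms unfolding smooth_on_def by blast


section \<open>Symmetry of second derivatives\<close>

text \<open>The mean value theorem along \<open>u\<close>, applied to \<open>p\<close>, turns the
  second difference into \<open>t\<close> times a difference of values of the directional
  derivative, whose linear part is \<open>t * A v\<close>.\<close>

lemma second_difference_real:
  fixes f :: "'a::real_normed_vector \<Rightarrow> real"
  assumes "open S" "x \<in> S" and f: "\<And>y. y \<in> S \<Longrightarrow> f differentiable at y"
    and A: "((\<lambda>y. dir_deriv f y u) has_derivative A) (at x)" and "e > 0"
  shows "\<exists>d>0. \<forall>t. 0 < t \<and> t < d \<longrightarrow>
    \<bar>f (x + t *\<^sub>R u + t *\<^sub>R v) - f (x + t *\<^sub>R u) - f (x + t *\<^sub>R v) + f x - t\<^sup>2 * A v\<bar> \<le> e * t\<^sup>2"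
proof -
  interpret A: bounded_linear A using A by (rule has_derivative_bounded_linear)
  define a where "a y = dir_deriv f y u" for y
  \<comment> \<open>The offsets \<open>s *\<^sub>R u + t *\<^sub>R v\<close> and
    \<open>s *\<^sub>R u\<close> have total length at most \<open>t * c\<close>, so errors of
    relative size \<open>e / c\<close> add up to at most \<open>e * t\<close>. The summand 1 keeps
    \<open>c\<close> positive.\<close>
  define c where "c = 2 * norm u + norm v + 1"
  have c: "c > 0" by (simp add: c_def add_nonneg_pos)
  obtain r where r: "r > 0" "ball x r \<subseteq> S" using assms(1,2) open_contains_ball by blast
  obtain d where d: "d > 0" "\<And>y. norm (y - x) < d \<Longrightarrow> norm (a y - a x - A (y - x)) \<le> e / c * norm (y - x)"
    using A assms(5) c unfolding has_derivative_at_alt a_def by (metis divide_pos_pos)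
  define d' where "d' = min r d / c"
  have "d' > 0" using r d c by (simp add: d'_def)
  moreover have "\<bar>f (x + t *\<^sub>R u + t *\<^sub>R v) - f (x + t *\<^sub>R u) - f (x + t *\<^sub>R v) + f x - t\<^sup>2 * A v\<bar> \<le> e * t\<^sup>2"
    if t: "0 < t" "t < d'" for t
  proof -
    have tc: "t * c < r" "t * c < d" using t c by (auto simp: d'_def field_simps)
    have small1: "norm (s *\<^sub>R u + t *\<^sub>R v) < t * c" if "0 \<le> s" "s \<le> t" for s
    proof -
      have "norm (s *\<^sub>R u + t *\<^sub>R v) \<le> t * norm u + t * norm v"
        using that t by (intro norm_triangle_le add_mono) (auto intro: mult_right_mono)
      also have "\<dots> < t * c" using t by (simp add: c_def algebra_simps add_pos_nonneg)
      finally show ?thesis .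
    qed
    have small2: "norm (s *\<^sub>R u) < t * c" if "0 \<le> s" "s \<le> t" for s
    proof -
      have "norm (s *\<^sub>R u) \<le> t * norm u"
        using that t by (auto intro: mult_right_mono)
      also have "\<dots> < t * c" using t by (simp add: c_def algebra_simps add_pos_nonneg)
      finally show ?thesis .
    qed
    define p where "p s = f (x + s *\<^sub>R u + t *\<^sub>R v) - f (x + s *\<^sub>R u)" for s
    have fd: "((\<lambda>s. f (w + s *\<^sub>R u)) has_field_derivative a (w + s *\<^sub>R u)) (at s)"
      if "w + s *\<^sub>R u \<in> S" for s w
    proof -
      have "(f has_derivative dir_deriv f (w + s *\<^sub>R u)) (at (w + s *\<^sub>R u))"
        using f[OF that] by (simp add: frechet_derivative_works)
      moreover have "((\<lambda>s. w + s *\<^sub>R u) has_derivative (\<lambda>h. h *\<^sub>R u)) (at s)"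
        by (auto intro!: derivative_eq_intros)
      ultimately have "((\<lambda>s. f (w + s *\<^sub>R u)) has_derivative (\<lambda>h. dir_deriv f (w + s *\<^sub>R u) (h *\<^sub>R u))) (at s)"
        using has_derivative_compose by fastforce
      moreover have "dir_deriv f (w + s *\<^sub>R u) (h *\<^sub>R u) = a (w + s *\<^sub>R u) * h" for h
        using linear_frechet_derivative[OF f[OF that]] by (simp add: a_def linear_cmul)
      ultimately show ?thesis by (simp add: has_field_derivative_def)
    qed
    have inS: "x + s *\<^sub>R u + t *\<^sub>R v \<in> S" "x + s *\<^sub>R u \<in> S" if "0 \<le> s" "s \<le> t" for s
      using small1[OF that] small2[OF that] tc r(2)
      by (auto simp: subset_iff dist_norm norm_minus_commute add.assoc)
    have "(p has_field_derivative a (x + s *\<^sub>R u + t *\<^sub>R v) - a (x + s *\<^sub>R u)) (at s)" if "0 \<le> s" "s \<le> t" for s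
      unfolding p_def using fd[of "x + t *\<^sub>R v" s] fd[of x s] inS[OF that]
      by (intro DERIV_diff) (auto simp: add_ac)
    from MVT2[OF t(1) this] obtain s where s: "0 < s" "s < t"
      "p t - p 0 = t * (a (x + s *\<^sub>R u + t *\<^sub>R v) - a (x + s *\<^sub>R u))" by auto
    have "\<bar>a (x + s *\<^sub>R u + t *\<^sub>R v) - a x - A (s *\<^sub>R u + t *\<^sub>R v)\<bar> \<le> e / c * norm (s *\<^sub>R u + t *\<^sub>R v)"
      using d(2)[of "x + s *\<^sub>R u + t *\<^sub>R v"] small1[of s] tc s by (simp add: algebra_simps)
    moreover have "\<bar>a (x + s *\<^sub>R u) - a x - A (s *\<^sub>R u)\<bar> \<le> e / c * norm (s *\<^sub>R u)"
      using d(2)[of "x + s *\<^sub>R u"] small2[of s] tc s by (simp add: algebra_simps)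
    ultimately have "\<bar>a (x + s *\<^sub>R u + t *\<^sub>R v) - a (x + s *\<^sub>R u) - t * A v\<bar>
      \<le> e / c * (norm (s *\<^sub>R u + t *\<^sub>R v) + norm (s *\<^sub>R u))"
      by (simp add: A.add A.scaleR algebra_simps)
    also have "\<dots> \<le> e / c * (t * c)"
    proof (rule mult_left_mono)
      have "norm (s *\<^sub>R u + t *\<^sub>R v) \<le> t * norm u + t * norm v" "norm (s *\<^sub>R u) \<le> t * norm u"
        using s t by (auto intro!: norm_triangle_le add_mono mult_right_mono)
      then show "norm (s *\<^sub>R u + t *\<^sub>R v) + norm (s *\<^sub>R u) \<le> t * c"
        using t by (simp add: c_def algebra_simps)
    qed (use assms(5) c in simp)
    also have "\<dots> = e * t" using c by simp
    finally have "t * \<bar>a (x + s *\<^sub>R u + t *\<^sub>R v) - a (x + s *\<^sub>R u) - t * A v\<bar> \<le> t * (e * t)"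
      using t by (intro mult_left_mono) auto
    moreover have "t * \<bar>a (x + s *\<^sub>R u + t *\<^sub>R v) - a (x + s *\<^sub>R u) - t * A v\<bar> = \<bar>p t - p 0 - t\<^sup>2 * A v\<bar>"
    proof -
      have "p t - p 0 - t\<^sup>2 * A v = t * (a (x + s *\<^sub>R u + t *\<^sub>R v) - a (x + s *\<^sub>R u) - t * A v)"
        unfolding s(3) by (simp add: power2_eq_square right_diff_distrib)
      then show ?thesis using t by (simp add: abs_mult)
    qed
    ultimately show ?thesis by (simp add: p_def power2_eq_square algebra_simps)
  qed
  ultimately show ?thesis by blast
qed

text \<open>The second difference is the same expression for \<open>u, v\<close> and for
  \<open>v, u\<close>. The quarter in \<open>e\<close> lets the two error terms account for only
  half of the supposed gap.\<close>

lemma second_derivative_symmetric_real: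
  fixes f :: "'a::real_normed_vector \<Rightarrow> real"
  assumes S: "open S" "x \<in> S" and f: "\<And>y. y \<in> S \<Longrightarrow> f differentiable at y"
    and A: "((\<lambda>y. dir_deriv f y u) has_derivative A) (at x)"
    and B: "((\<lambda>y. dir_deriv f y v) has_derivative B) (at x)"
  shows "A v = B u"
proof (rule ccontr)
  assume neq: "A v \<noteq> B u"
  define e where "e = \<bar>A v - B u\<bar> / 4"
  have e: "e > 0" using neq by (simp add: e_def)
  obtain d1 where d1: "d1 > 0" "\<And>t. 0 < t \<Longrightarrow> t < d1 \<Longrightarrow>
      \<bar>f (x + t *\<^sub>R u + t *\<^sub>R v) - f (x + t *\<^sub>R u) - f (x + t *\<^sub>R v) + f x - t\<^sup>2 * A v\<bar> \<le> e * t\<^sup>2"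
    using second_difference_real[OF S f A e, where v=v] by blast
  obtain d2 where d2: "d2 > 0" "\<And>t. 0 < t \<Longrightarrow> t < d2 \<Longrightarrow>
      \<bar>f (x + t *\<^sub>R v + t *\<^sub>R u) - f (x + t *\<^sub>R v) - f (x + t *\<^sub>R u) + f x - t\<^sup>2 * B u\<bar> \<le> e * t\<^sup>2"
    using second_difference_real[OF S f B e, where v=u] by blast
  define t where "t = min d1 d2 / 2"
  have t: "0 < t" "t < d1" "t < d2" using d1 d2 by (auto simp: t_def)
  have eq: "x + t *\<^sub>R v + t *\<^sub>R u = x + t *\<^sub>R u + t *\<^sub>R v" by simp
  have "\<bar>t\<^sup>2 * A v - t\<^sup>2 * B u\<bar> \<le> 2 * (e * t\<^sup>2)"
    using d1(2)[OF t(1,2)] d2(2)[OF t(1,3)] unfolding eq by linarith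
  moreover have "\<bar>t\<^sup>2 * A v - t\<^sup>2 * B u\<bar> = t\<^sup>2 * (4 * e)"
    by (simp add: e_def abs_mult flip: right_diff_distrib)
  ultimately show False using e t by (simp add: mult_ac)
qed

lemma second_derivative_symmetric:
  fixes f :: "'a::real_normed_vector \<Rightarrow> 'b::euclidean_space"
  assumes S: "open S" "x \<in> S" and f: "\<And>y. y \<in> S \<Longrightarrow> f differentiable at y"
    and A: "((\<lambda>y. dir_deriv f y u) has_derivative A) (at x)"
    and B: "((\<lambda>y. dir_deriv f y v) has_derivative B) (at x)"
  shows "A v = B u"
proof (rule euclidean_eqI)
  fix b :: 'b
  have D: "((\<lambda>y. f y \<bullet> b) has_derivative (\<lambda>h. dir_deriv f y h \<bullet> b)) (at y)" if "y \<in> S" for y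
    using f[OF that] frechet_derivative_works by (auto intro!: derivative_eq_intros)
  have eq: "dir_deriv (\<lambda>y. f y \<bullet> b) y h = dir_deriv f y h \<bullet> b" if "y \<in> S" for y h
    using frechet_derivative_at[OF D[OF that]] by metis
  have dd: "((\<lambda>y. dir_deriv (\<lambda>y. f y \<bullet> b) y w) has_derivative (\<lambda>h. C h \<bullet> b)) (at x)"
    if "((\<lambda>y. dir_deriv f y w) has_derivative C) (at x)" for w C
  proof (rule has_derivative_transform_within_open[OF _ S])
    show "((\<lambda>y. dir_deriv f y w \<bullet> b) has_derivative (\<lambda>h. C h \<bullet> b)) (at x)"
      using that by (auto intro!: derivative_eq_intros)
  qed (simp add: eq)
  show "A v \<bullet> b = B u \<bullet> b"
    by (rule second_derivative_symmetric_real[OF S _ dd[OF A] dd[OF B]])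
      (use D in \<open>auto simp: differentiable_def\<close>)
qed

lemma smooth_on_dir_deriv_symmetric:
  assumes "smooth_on S f" "open S" "x \<in> S"
  shows "dir_deriv (\<lambda>y. dir_deriv f y u) x v = dir_deriv (\<lambda>y. dir_deriv f y v) x u"
  by (rule second_derivative_symmetric[where f=f, OF assms(2,3)])
    (auto intro!: smooth_on_has_derivative[OF smooth_on_dir_deriv] smooth_on_differentiable assms)

section \<open>The Levi-Civita connection in a chart\<close>

text \<open>Expansion in the basis reduces the claim to the coefficient functions
  \<open>B y i j\<close>. Bilinearity holds on \<open>S\<close> only, hence the passage through
  agreement on an open set.\<close>

lemma bilinear_field_has_derivative:
  fixes B :: "'p::real_normed_vector \<Rightarrow> 'a::euclidean_space \<Rightarrow> 'b::euclidean_space \<Rightarrow> 'c::real_normed_vector"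
  assumes S: "open S" "x \<in> S" and B: "\<And>y. y \<in> S \<Longrightarrow> bilinear (B y)"
    and d: "\<And>u v. (\<lambda>y. B y u v) differentiable at x"
    and Y: "(Y has_derivative Y') (at x)" and Z: "(Z has_derivative Z') (at x)"
  shows "((\<lambda>y. B y (Y y) (Z y)) has_derivative
    (\<lambda>h. dir_deriv (\<lambda>y. B y (Y x) (Z x)) x h + B x (Y' h) (Z x) + B x (Y x) (Z' h))) (at x)"
proof -
  have ex: "B y u v = (\<Sum>i\<in>Basis. \<Sum>j\<in>Basis. ((u \<bullet> i) * (v \<bullet> j)) *\<^sub>R B y i j)" if "y \<in> S" for y u v
  proof -
    interpret b1: linear "\<lambda>a. B y a b" for b using B[OF that] by (simp add: bilinear_def)
    interpret b2: linear "\<lambda>b. B y a b" for a using B[OF that] by (simp add: bilinear_def)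
    have "B y u v = B y (\<Sum>i\<in>Basis. (u \<bullet> i) *\<^sub>R i) (\<Sum>j\<in>Basis. (v \<bullet> j) *\<^sub>R j)"
      by (simp add: euclidean_representation)
    also have "\<dots> = (\<Sum>i\<in>Basis. \<Sum>j\<in>Basis. ((u \<bullet> i) * (v \<bullet> j)) *\<^sub>R B y i j)"
      by (subst sum.swap) (simp only: b1.sum b1.scaleR b2.sum b2.scaleR scaleR_sum_right scaleR_scaleR mult.commute)
    finally show ?thesis .
  qed
  have ij: "((\<lambda>y. B y i j) has_derivative (\<lambda>h. dir_deriv (\<lambda>y. B y i j) x h)) (at x)" for i j
    using d[of i j] by (simp add: frechet_derivative_works)
  have gen: "((\<lambda>y. B y (U y) (V y)) has_derivative
      (\<lambda>h. (\<Sum>i\<in>Basis. \<Sum>j\<in>Basis. ((U x \<bullet> i) * (V x \<bullet> j)) *\<^sub>R dir_deriv (\<lambda>y. B y i j) x h)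
        + B x (U' h) (V x) + B x (U x) (V' h))) (at x)"
    if "(U has_derivative U') (at x)" "(V has_derivative V') (at x)" for U V U' V'
  proof (rule has_derivative_transform_within_open[OF _ S])
    have t: "((\<lambda>y. ((U y \<bullet> i) * (V y \<bullet> j)) *\<^sub>R B y i j) has_derivative
      (\<lambda>h. ((U x \<bullet> i) * (V x \<bullet> j)) *\<^sub>R dir_deriv (\<lambda>y. B y i j) x h
        + ((U' h \<bullet> i) * (V x \<bullet> j)) *\<^sub>R B x i j + ((U x \<bullet> i) * (V' h \<bullet> j)) *\<^sub>R B x i j)) (at x)" for i j
    proof -
      have "((\<lambda>y. (U y \<bullet> i) * (V y \<bullet> j)) has_derivative
        (\<lambda>h. (U x \<bullet> i) * (V' h \<bullet> j) + (U' h \<bullet> i) * (V x \<bullet> j))) (at x)"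
        by (intro has_derivative_mult has_derivative_inner_left that)
      from has_derivative_scaleR[OF this ij[of i j]] show ?thesis
        by (simp add: scaleR_add_left add_ac)
    qed
    have "((\<lambda>y. \<Sum>i\<in>Basis. \<Sum>j\<in>Basis. ((U y \<bullet> i) * (V y \<bullet> j)) *\<^sub>R B y i j) has_derivative
      (\<lambda>h. \<Sum>i\<in>Basis. \<Sum>j\<in>Basis. (((U x \<bullet> i) * (V x \<bullet> j)) *\<^sub>R dir_deriv (\<lambda>y. B y i j) x h
        + ((U' h \<bullet> i) * (V x \<bullet> j)) *\<^sub>R B x i j + ((U x \<bullet> i) * (V' h \<bullet> j)) *\<^sub>R B x i j))) (at x)"
      by (intro has_derivative_sum t)
    then show "((\<lambda>y. \<Sum>i\<in>Basis. \<Sum>j\<in>Basis. ((U y \<bullet> i) * (V y \<bullet> j)) *\<^sub>R B y i j) has_derivative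
      (\<lambda>h. (\<Sum>i\<in>Basis. \<Sum>j\<in>Basis. ((U x \<bullet> i) * (V x \<bullet> j)) *\<^sub>R dir_deriv (\<lambda>y. B y i j) x h)
        + B x (U' h) (V x) + B x (U x) (V' h))) (at x)"
      by (simp only: sum.distrib ex[OF S(2), symmetric])
  qed (use ex in simp)
  \<comment> \<open>The same rule for constant fields identifies the coefficient sum with the
    derivative of \<open>B\<close> at frozen arguments.\<close>
  have "((\<lambda>y. B y (Y x) (Z x)) has_derivative
      (\<lambda>h. (\<Sum>i\<in>Basis. \<Sum>j\<in>Basis. ((Y x \<bullet> i) * (Z x \<bullet> j)) *\<^sub>R dir_deriv (\<lambda>y. B y i j) x h)
        + B x 0 (Z x) + B x (Y x) 0)) (at x)"
    using gen[of "\<lambda>_. Y x" "\<lambda>_. 0" "\<lambda>_. Z x" "\<lambda>_. 0"] by simp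
  from frechet_derivative_at[OF this] B[OF S(2)]
  have "dir_deriv (\<lambda>y. B y (Y x) (Z x)) x h = (\<Sum>i\<in>Basis. \<Sum>j\<in>Basis. ((Y x \<bullet> i) * (Z x \<bullet> j)) *\<^sub>R dir_deriv (\<lambda>y. B y i j) x h)" for h
    by (simp add: bilinear_lzero bilinear_rzero fun_eq_iff)
  then show ?thesis using gen[OF Y Z] by simp
qed

lemma linear_field_has_derivative:
  fixes L :: "'p::real_normed_vector \<Rightarrow> 'a::euclidean_space \<Rightarrow> 'c::real_normed_vector"
  assumes S: "open S" "x \<in> S" and L: "\<And>y. y \<in> S \<Longrightarrow> linear (L y)"
    and d: "\<And>u. (\<lambda>y. L y u) differentiable at x"
    and Y: "(Y has_derivative Y') (at x)"
  shows "((\<lambda>y. L y (Y y)) has_derivative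
    (\<lambda>h. dir_deriv (\<lambda>y. L y (Y x)) x h + L x (Y' h))) (at x)"
proof -
  \<comment> \<open>A second, real argument makes the linear map bilinear; it is then filled with
    the constant field 1.\<close>
  have "bilinear (\<lambda>u (r::real). r *\<^sub>R L y u)" if "y \<in> S" for y
    using L[OF that] by (auto simp: bilinear_def linear_iff algebra_simps)
  from bilinear_field_has_derivative[where B="\<lambda>y u (r::real). r *\<^sub>R L y u", OF S this _ Y, of "\<lambda>_. 1" "\<lambda>_. 0"]
  show ?thesis using d by (simp add: differentiable_scaleR)
qed

lemma differentiable_det:
  fixes M :: "'a::real_normed_vector \<Rightarrow> real ^ 'n ^ 'n"
  assumes "\<And>i j. (\<lambda>x. M x $ i $ j) differentiable at x"
  shows "(\<lambda>x. det (M x)) differentiable at x"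
proof -
  have "(\<lambda>x. \<Prod>i\<in>I. M x $ i $ p i) differentiable at x" if "finite I" for p and I :: "'n set"
    using that by induction (auto intro!: differentiable_mult assms)
  then show ?thesis unfolding det_def
    by (intro differentiable_sum differentiable_mult differentiable_const finite_permutations) auto
qed

section \<open>Christoffel symbols from the Koszul formula\<close>

locale local_metric =
  fixes S :: "(real ^ 'n::finite) set" and G :: "real ^ 'n \<Rightarrow> real ^ 'n \<Rightarrow> real ^ 'n \<Rightarrow> real"
  assumes open_S: "open S"
    and bilin: "x \<in> S \<Longrightarrow> bilinear (G x)"
    and sym: "x \<in> S \<Longrightarrow> G x u v = G x v u"
    and pos: "x \<in> S \<Longrightarrow> u \<noteq> 0 \<Longrightarrow> G x u u > 0"
    and smooth: "smooth_on S (\<lambda>x. G x u v)"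
begin

definition dG where "dG x h u v = dir_deriv (\<lambda>y. G y u v) x h"
definition koszul where "koszul x u v z = dG x u v z + dG x v u z - dG x z u v"

abbreviation \<Gamma> where "\<Gamma> \<equiv> christoffel G"

lemma G_diff: "x \<in> S \<Longrightarrow> (\<lambda>y. G y u v) differentiable at x"
  using smooth_on_differentiable[OF smooth open_S] .

lemma G_der: "x \<in> S \<Longrightarrow> ((\<lambda>y. G y u v) has_derivative (\<lambda>h. dG x h u v)) (at x)"
  using smooth_on_has_derivative[OF smooth open_S] unfolding dG_def .

lemma dG_linear: "x \<in> S \<Longrightarrow> linear (\<lambda>h. dG x h u v)"
  using has_derivative_linear[OF G_der] .

lemmas G_simps = bilinear_ladd[OF bilin] bilinear_radd[OF bilin] bilinear_lmul[OF bilin]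
  bilinear_rmul[OF bilin] bilinear_lneg[OF bilin] bilinear_rneg[OF bilin]
  bilinear_lsub[OF bilin] bilinear_rsub[OF bilin] bilinear_lzero[OF bilin] bilinear_rzero[OF bilin]

lemma dG_eqI:
  assumes "x \<in> S" "\<And>y. y \<in> S \<Longrightarrow> G y u v = H y" "(H has_derivative H') (at x)"
  shows "dG x h u v = H' h"
proof -
  have "((\<lambda>y. G y u v) has_derivative H') (at x)"
    by (rule has_derivative_transform_within_open[OF assms(3) open_S assms(1)]) (simp add: assms(2))
  from frechet_derivative_at[OF this] show ?thesis by (simp add: dG_def)
qed

lemma dG_bilinear:
  assumes "x \<in> S"
  shows "bilinear (dG x h)"
proof -
  have "dG x h (u + u') v = dG x h u v + dG x h u' v" for u u' v
    by (rule dG_eqI[OF assms]) (auto simp: G_simps intro!: derivative_eq_intros G_der assms)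
  moreover have "dG x h u (v + v') = dG x h u v + dG x h u v'" for u v v'
    by (rule dG_eqI[OF assms]) (auto simp: G_simps intro!: derivative_eq_intros G_der assms)
  moreover have "dG x h (r *\<^sub>R u) v = r * dG x h u v" for u v r
    by (rule dG_eqI[OF assms]) (auto simp: G_simps intro!: derivative_eq_intros G_der assms)
  moreover have "dG x h u (r *\<^sub>R v) = r * dG x h u v" for u v r
    by (rule dG_eqI[OF assms]) (auto simp: G_simps intro!: derivative_eq_intros G_der assms)
  ultimately show ?thesis by (simp add: bilinear_def linear_iff)
qed

lemma dG_sym: "x \<in> S \<Longrightarrow> dG x h u v = dG x h v u"
  by (rule dG_eqI[OF _ sym G_der])

lemma dG_diff: "x \<in> S \<Longrightarrow> (\<lambda>y. dG y h u v) differentiable at x"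
  unfolding dG_def by (intro smooth_on_differentiable[OF smooth_on_dir_deriv[OF smooth] open_S])

lemma koszul_linear: "x \<in> S \<Longrightarrow> linear (koszul x u v)"
  using dG_bilinear[of x] dG_linear[of x]
  by (auto simp: koszul_def[abs_def] bilinear_def linear_iff algebra_simps)

lemma G_nondegenerate:
  assumes "x \<in> S" "\<And>z. G x u z = G x v z"
  shows "u = v"
proof (rule ccontr)
  assume "u \<noteq> v"
  then have "G x (u - v) (u - v) > 0" using pos assms by simp
  then show False using assms by (simp add: G_simps)
qed

definition gram where "gram x = (\<chi> i j. G x (axis j 1) (axis i 1))"

lemma gram_mult: "x \<in> S \<Longrightarrow> (gram x *v w) $ i = G x w (axis i 1)"
proof -
  assume x: "x \<in> S"
  interpret b1: linear "\<lambda>u. G x u v" for v using bilin[OF x] by (simp add: bilinear_def)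
  have "G x w (axis i 1) = G x (\<Sum>j\<in>UNIV. (w $ j) *\<^sub>R axis j 1) (axis i 1)"
    using basis_expansion[of w] by (simp add: scalar_mult_eq_scaleR)
  also have "\<dots> = (\<Sum>j\<in>UNIV. w $ j * G x (axis j 1) (axis i 1))"
    by (simp add: b1.sum b1.scaleR)
  finally show ?thesis by (simp add: matrix_vector_mult_def gram_def mult.commute)
qed

lemma det_gram: "x \<in> S \<Longrightarrow> det (gram x) \<noteq> 0"
proof -
  assume x: "x \<in> S"
  have "u = 0" if "gram x *v u = 0" for u
  proof (rule ccontr)
    assume "u \<noteq> 0"
    have "G x u (axis i 1) = 0" for i using gram_mult[OF x, of u i] that by simp
    moreover have "G x u u = (\<Sum>i\<in>UNIV. u $ i * G x u (axis i 1))"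
    proof -
      interpret b2: linear "\<lambda>v. G x u v" using bilin[OF x] by (simp add: bilinear_def)
      have "G x u u = G x u (\<Sum>j\<in>UNIV. (u $ j) *\<^sub>R axis j 1)"
        using basis_expansion[of u] by (simp add: scalar_mult_eq_scaleR)
      then show ?thesis by (simp add: b2.sum b2.scaleR)
    qed
    ultimately show False using pos[OF x \<open>u \<noteq> 0\<close>] by simp
  qed
  then show ?thesis
    by (metis inj_matrix_vector_mult invertible_det_nz matrix_left_invertible_injective
        invertible_left_inverse matrix_left_invertible_ker)
qed

text \<open>Cramer's rule writes the vector representing \<open>k\<close> as quotients of
  determinants in the metric coefficients. This explicit form is what makes the Christoffel symbols
  differentiable in the point.\<close>

lemma riesz_iff:
  assumes "x \<in> S" "linear k"
  shows "(\<forall>z. G x w z = k z) \<longleftrightarrow>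
    w = (\<chi> j. det (\<chi> i l. if l = j then k (axis i 1) else gram x $ i $ l) / det (gram x))"
proof -
  have "(\<forall>z. G x w z = k z) \<longleftrightarrow> gram x *v w = (\<chi> i. k (axis i 1))"
  proof
    assume "gram x *v w = (\<chi> i. k (axis i 1))"
    then have *: "G x w (axis i 1) = k (axis i 1)" for i
      using gram_mult[OF assms(1), of w i] by simp
    show "\<forall>z. G x w z = k z"
    proof
      fix z :: "real ^ 'n"
      interpret b2: linear "\<lambda>v. G x w v" using bilin[OF assms(1)] by (simp add: bilinear_def)
      interpret k: linear k by fact
      have z: "z = (\<Sum>j\<in>UNIV. (z $ j) *\<^sub>R axis j 1)"
        using basis_expansion[of z] by (simp add: scalar_mult_eq_scaleR)
      show "G x w z = k z"
        by (subst (1 2) z) (simp add: b2.sum b2.scaleR k.sum k.scaleR *)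
    qed
  qed (simp add: vec_eq_iff gram_mult assms)
  also have "\<dots> \<longleftrightarrow> w = (\<chi> j. det (\<chi> i l. if l = j then k (axis i 1) else gram x $ i $ l) / det (gram x))"
    by (subst cramer[OF det_gram[OF assms(1)]]) (simp cong: if_cong)
  finally show ?thesis .
qed

lemma christoffel_eq:
  assumes "x \<in> S"
  shows "\<Gamma> x u v = (\<chi> j. det (\<chi> i l. if l = j then koszul x u v (axis i 1) / 2 else gram x $ i $ l) / det (gram x))"
proof -
  have "linear (\<lambda>z. koszul x u v z / 2)"
    using koszul_linear[OF assms, of u v] by (auto simp: linear_iff field_simps)
  from riesz_iff[OF assms this]
  have "(\<forall>z. 2 * G x w z = koszul x u v z) \<longleftrightarrow>
    w = (\<chi> j. det (\<chi> i l. if l = j then koszul x u v (axis i 1) / 2 else gram x $ i $ l) / det (gram x))" for w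
    by (simp add: field_simps)
  then show ?thesis unfolding christoffel_def koszul_def dG_def by simp
qed

lemma christoffel_works:
  assumes "x \<in> S"
  shows "2 * G x (\<Gamma> x u v) z = koszul x u v z"
proof -
  have "linear (\<lambda>z. koszul x u v z / 2)"
    using koszul_linear[OF assms, of u v] by (auto simp: linear_iff field_simps)
  from riesz_iff[OF assms this, of "\<Gamma> x u v"] christoffel_eq[OF assms, of u v]
  have "\<forall>z. G x (\<Gamma> x u v) z = koszul x u v z / 2" by metis
  then show ?thesis by (simp add: mult.commute)
qed

lemma christoffel_diff:
  assumes "x \<in> S"
  shows "(\<lambda>y. \<Gamma> y u v) differentiable at x"
proof -
  have g: "(\<lambda>y. gram y $ i $ l) differentiable at x" for i l
    using G_diff[OF assms] by (simp add: gram_def)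
  have k: "(\<lambda>y. koszul y u v z / 2) differentiable at x" for z
    unfolding koszul_def using dG_diff[OF assms]
    by (intro differentiable_add differentiable_diff differentiable_divide differentiable_const) auto
  let ?f = "\<lambda>y. (\<chi> j. det (\<chi> i l. if l = j then koszul y u v (axis i 1) / 2 else gram y $ i $ l) / det (gram y))"
  have j: "(\<lambda>y. det (\<chi> i l. if l = j then koszul y u v (axis i 1) / 2 else gram y $ i $ l) / det (gram y))
    differentiable at x" for j
  proof (intro differentiable_divide differentiable_det)
    show "(\<lambda>xa. (\<chi> i l. if l = j then koszul xa u v (axis i 1) / 2 else gram xa $ i $ l) $ i $ ja) differentiable at x" for i ja
      using g k by (cases "ja = j") auto
  qed (use g det_gram assms in auto)
  have "?f differentiable at x"
    by (rule differentiable_componentwise_within[THEN iffD2]) (use j in \<open>auto simp: Basis_vec_def inner_axis\<close>)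
  then obtain D where "(?f has_derivative D) (at x)" by (auto simp: differentiable_def)
  then have "((\<lambda>y. \<Gamma> y u v) has_derivative D) (at x)"
    by (rule has_derivative_transform_within_open[OF _ open_S assms]) (simp add: christoffel_eq)
  then show ?thesis by (auto simp: differentiable_def)
qed

lemma christoffel_bilinear:
  assumes "x \<in> S"
  shows "bilinear (\<Gamma> x)"
proof -
  note [simp] = bilinear_ladd[OF dG_bilinear[OF assms]] bilinear_radd[OF dG_bilinear[OF assms]]
    bilinear_lmul[OF dG_bilinear[OF assms]] bilinear_rmul[OF dG_bilinear[OF assms]]
    linear_add[OF dG_linear[OF assms]] linear_cmul[OF dG_linear[OF assms]]
  \<comment> \<open>\<open>\<Gamma>\<close> is a definite description, so its bilinearity is read
    off the Koszul expression through uniqueness of the representing vector.\<close>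
  have I: "\<Gamma> x u v = w" if "\<And>z. 2 * G x w z = koszul x u v z" for u v w
    using that christoffel_works[OF assms, of u v] by (intro G_nondegenerate[OF assms]) (metis mult_cancel_left zero_neq_numeral)
  have "\<Gamma> x (u + u') v = \<Gamma> x u v + \<Gamma> x u' v" for u u' v
    by (rule I) (simp add: G_simps assms distrib_left christoffel_works koszul_def)
  moreover have "\<Gamma> x u (v + v') = \<Gamma> x u v + \<Gamma> x u v'" for u v v'
    by (rule I) (simp add: G_simps assms distrib_left christoffel_works koszul_def)
  moreover have "\<Gamma> x (r *\<^sub>R u) v = r *\<^sub>R \<Gamma> x u v" for u v r
    by (rule I) (simp add: G_simps assms christoffel_works mult.left_commute[of 2], simp add: koszul_def algebra_simps)
  moreover have "\<Gamma> x u (r *\<^sub>R v) = r *\<^sub>R \<Gamma> x u v" for u v r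
    by (rule I) (simp add: G_simps assms christoffel_works mult.left_commute[of 2], simp add: koszul_def algebra_simps)
  ultimately show ?thesis by (simp add: bilinear_def linear_iff)
qed

lemma christoffel_sym:
  assumes "x \<in> S"
  shows "\<Gamma> x u v = \<Gamma> x v u"
proof (rule G_nondegenerate[OF assms])
  fix z
  have "2 * G x (\<Gamma> x u v) z = 2 * G x (\<Gamma> x v u) z"
    using assms by (simp add: christoffel_works koszul_def dG_sym[OF assms, of z u v])
  then show "G x (\<Gamma> x u v) z = G x (\<Gamma> x v u) z" by simp
qed

text \<open>In the two Koszul expressions involved, the derivatives along \<open>u\<close> and along
  \<open>v\<close> occur with opposite signs and cancel.\<close>

lemma metric_compatible:
  assumes "x \<in> S"
  shows "dG x z u v = G x (\<Gamma> x z u) v + G x u (\<Gamma> x z v)"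
proof -
  have "2 * (G x (\<Gamma> x z u) v + G x u (\<Gamma> x z v)) = 2 * dG x z u v"
    using christoffel_works[OF assms, of z u v] christoffel_works[OF assms, of z v u] sym[OF assms, of u]
      dG_sym[OF assms]
    by (simp add: koszul_def distrib_left)
  then show ?thesis by simp
qed

end

section \<open>Killing fields in a chart\<close>

context local_metric
begin

definition cov where "cov Y x v = dir_deriv Y x v + \<Gamma> x v (Y x)"

definition killing where
  "killing Y \<longleftrightarrow> smooth_on S Y \<and> (\<forall>x\<in>S. \<forall>v w. lie_deriv_local G Y x v w = 0)"

lemma smooth_on_der: "smooth_on S Y \<Longrightarrow> x \<in> S \<Longrightarrow> (Y has_derivative dir_deriv Y x) (at x)"
  using smooth_on_has_derivative open_S by blast

lemmas \<Gamma>_simps = bilinear_ladd[OF christoffel_bilinear] bilinear_radd[OF christoffel_bilinear]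
  bilinear_lmul[OF christoffel_bilinear] bilinear_rmul[OF christoffel_bilinear]
  bilinear_lneg[OF christoffel_bilinear] bilinear_rneg[OF christoffel_bilinear]
  bilinear_lsub[OF christoffel_bilinear] bilinear_rsub[OF christoffel_bilinear]
  bilinear_lzero[OF christoffel_bilinear] bilinear_rzero[OF christoffel_bilinear]

lemma metric_has_derivative:
  assumes x: "x \<in> S" and "(Y has_derivative Y') (at x)" "(Z has_derivative Z') (at x)"
  shows "((\<lambda>y. G y (Y y) (Z y)) has_derivative
    (\<lambda>h. G x (Y' h + \<Gamma> x h (Y x)) (Z x) + G x (Y x) (Z' h + \<Gamma> x h (Z x)))) (at x)"
  using bilinear_field_has_derivative[OF open_S x bilin G_diff[OF x] assms(2,3)]
  unfolding dG_def[symmetric]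
  by (simp add: metric_compatible x G_simps add_ac)

lemma metric_has_derivative_cov:
  assumes x: "x \<in> S" and "smooth_on S Y" "smooth_on S Z"
  shows "((\<lambda>y. G y (Y y) (Z y)) has_derivative
    (\<lambda>h. G x (cov Y x h) (Z x) + G x (Y x) (cov Z x h))) (at x)"
  unfolding cov_def by (intro metric_has_derivative smooth_on_der assms)

lemma cov_linear: "smooth_on S Y \<Longrightarrow> x \<in> S \<Longrightarrow> linear (cov Y x)"
  using has_derivative_linear[OF smooth_on_der]
  by (auto simp: cov_def[abs_def] linear_iff \<Gamma>_simps algebra_simps)

text \<open>Metric compatibility turns the derivative of the metric along \<open>X\<close> into
  Christoffel terms with \<open>X\<close> as first argument. Symmetry moves \<open>X\<close> to the
  second one, which completes both derivatives of \<open>X\<close> to covariant derivatives.\<close>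

lemma lie_deriv_cov:
  assumes "smooth_on S X" "x \<in> S"
  shows "lie_deriv_local G X x v w = G x (cov X x v) w + G x v (cov X x w)"
  unfolding lie_deriv_local_def dG_def[symmetric] cov_def
  by (simp add: metric_compatible assms G_simps christoffel_sym[OF assms(2), of _ "X x"])

lemma killing_smooth: "killing Y \<Longrightarrow> smooth_on S Y"
  by (simp add: killing_def)

lemma killing_skew:
  assumes "killing Y" "x \<in> S"
  shows "G x (cov Y x v) w = - G x v (cov Y x w)"
proof -
  have "lie_deriv_local G Y x v w = 0" using assms by (simp add: killing_def)
  then show ?thesis using assms by (simp add: lie_deriv_cov killing_smooth)
qed

lemma killing_skew_self: "killing Y \<Longrightarrow> x \<in> S \<Longrightarrow> G x (cov Y x v) v = 0"
  using killing_skew[of Y x v v] sym[of x v "cov Y x v"] by linarith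

lemma commuting_cov:
  assumes "x \<in> S" "dir_deriv Y x (K x) = dir_deriv K x (Y x)"
  shows "cov Y x (K x) = cov K x (Y x)"
  using assms by (simp add: cov_def christoffel_sym[OF assms(1), of "K x"])

text \<open>The infinitesimal form of the fact that the flow of \<open>Z\<close> preserves the
  metric and the commuting fields \<open>P\<close>, \<open>Q\<close>: commutation replaces
  \<open>cov P x (Z x)\<close> by \<open>cov Z x (P x)\<close>, and skewness cancels the two
  terms.\<close>

lemma killing_invariant:
  assumes "killing Z" "smooth_on S P" "smooth_on S Q" "x \<in> S"
    and "dir_deriv P x (Z x) = dir_deriv Z x (P x)" "dir_deriv Q x (Z x) = dir_deriv Z x (Q x)"
  shows "dir_deriv (\<lambda>y. G y (P y) (Q y)) x (Z x) = 0"
proof -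
  have "dir_deriv (\<lambda>y. G y (P y) (Q y)) x (Z x) = G x (cov P x (Z x)) (Q x) + G x (P x) (cov Q x (Z x))"
    by (simp flip: frechet_derivative_at[OF metric_has_derivative_cov[OF assms(4,2,3)]])
  then show ?thesis
    using killing_skew[OF assms(1,4), of "P x" "Q x"]
    by (simp add: commuting_cov[OF assms(4,5)] commuting_cov[OF assms(4,6)])
qed

lemma killing_norm_derivative:
  assumes "killing Y" "x \<in> S"
  shows "((\<lambda>y. G y (Y y) (Y y)) has_derivative (\<lambda>h. 2 * G x (cov Y x h) (Y x))) (at x)"
  using metric_has_derivative_cov[OF assms(2) killing_smooth killing_smooth, OF assms(1) assms(1)]
  by (simp add: sym[OF assms(2), of "Y x"] mult_2[symmetric])

text \<open>Both terms of the product rule are equal: shifting \<open>cov K\<close> to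
  \<open>Y\<close> by skewness, exchanging \<open>Y\<close> and \<open>K\<close> by commutation and
  shifting back leads from one to the other.\<close>

lemma killing_inner_derivative:
  assumes "killing Y" "killing K" "x \<in> S" "dir_deriv Y x (K x) = dir_deriv K x (Y x)"
  shows "((\<lambda>y. G y (Y y) (K y)) has_derivative (\<lambda>h. 2 * G x (cov Y x h) (K x))) (at x)"
proof -
  have "G x (Y x) (cov K x h) = G x (cov Y x h) (K x)" for h
  proof -
    have "G x (Y x) (cov K x h) = - G x (cov K x (Y x)) h"
      using killing_skew[OF assms(2,3), of "Y x" h] by linarith
    also have "\<dots> = - G x (cov Y x (K x)) h" using commuting_cov[OF assms(3,4)] by simp
    also have "\<dots> = G x (cov Y x h) (K x)"
      using killing_skew[OF assms(1,3), of "K x" h] sym[OF assms(3), of "K x" "cov Y x h"] by linarith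
    finally show ?thesis .
  qed
  then show ?thesis
    using metric_has_derivative_cov[OF assms(3) killing_smooth killing_smooth, OF assms(1) assms(2)]
    by (simp add: mult_2[symmetric])
qed

lemma cov_has_derivative:
  assumes Y: "smooth_on S Y" and x: "x \<in> S" and Z: "(Z has_derivative Z') (at x)"
  shows "((\<lambda>y. cov Y y (Z y)) has_derivative
    (\<lambda>h. dir_deriv (\<lambda>y. dir_deriv Y y (Z x)) x h + dir_deriv Y x (Z' h)
      + (dir_deriv (\<lambda>y. \<Gamma> y (Z x) (Y x)) x h + \<Gamma> x (Z' h) (Y x) + \<Gamma> x (Z x) (dir_deriv Y x h)))) (at x)"
  unfolding cov_def
proof (rule has_derivative_add)
  show "((\<lambda>y. dir_deriv Y y (Z y)) has_derivative
    (\<lambda>h. dir_deriv (\<lambda>y. dir_deriv Y y (Z x)) x h + dir_deriv Y x (Z' h))) (at x)"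
    by (rule linear_field_has_derivative[OF open_S x _ _ Z])
      (auto intro: has_derivative_linear[OF smooth_on_der[OF Y]] smooth_on_differentiable[OF smooth_on_dir_deriv[OF Y] open_S x])
  show "((\<lambda>y. \<Gamma> y (Z y) (Y y)) has_derivative (\<lambda>h. dir_deriv (\<lambda>y. \<Gamma> y (Z x) (Y x)) x h
      + \<Gamma> x (Z' h) (Y x) + \<Gamma> x (Z x) (dir_deriv Y x h))) (at x)"
    by (rule bilinear_field_has_derivative[OF open_S x christoffel_bilinear christoffel_diff[OF x] Z smooth_on_der[OF Y x]])
qed

text \<open>Differentiating \<open>G(v, \<nabla>\<^sub>v Y) = 0\<close> along \<open>Y\<close> and \<open>G(\<nabla>\<^sub>v Y, Y) = - G(v, \<nabla>\<^sub>Y Y)\<close> along \<open>v\<close> and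
  comparing the mixed derivatives produces the curvature term.\<close>

lemma killing_norm_second_derivative:
  assumes Y: "killing Y" and x: "x \<in> S" and crit: "cov Y x (Y x) = 0"
  shows "\<exists>D. ((\<lambda>y. G y (cov Y y v) (Y y)) has_derivative D) (at x) \<and>
    D v = G x (cov Y x v) (cov Y x v) - G x (riemann G x v (Y x) (Y x)) v"
proof -
  note sY = killing_smooth[OF Y]
  define B where "B = dir_deriv Y x"
  define y where "y = Y x"
  define C where "C = cov Y x"
  interpret C: linear C unfolding C_def by (rule cov_linear[OF sY x])
  interpret B: linear B unfolding B_def by (rule has_derivative_linear[OF smooth_on_der[OF sY x]])
  note lin = \<Gamma>_simps[OF x] G_simps[OF x]
  have Ceq: "C h = B h + \<Gamma> x h y" for h by (simp add: C_def cov_def B_def y_def)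
  define N' where "N' h = dir_deriv (\<lambda>z. dir_deriv Y z y) x h + B (B h)
      + (dir_deriv (\<lambda>z. \<Gamma> z y y) x h + \<Gamma> x (B h) y + \<Gamma> x y (B h))" for h
  have N': "((\<lambda>z. cov Y z (Y z)) has_derivative N') (at x)"
    unfolding N'_def B_def y_def by (rule cov_has_derivative[OF sY x smooth_on_der[OF sY x]])
  define M' where "M' h = dir_deriv (\<lambda>z. dir_deriv Y z v) x h + B 0
      + (dir_deriv (\<lambda>z. \<Gamma> z v y) x h + \<Gamma> x 0 y + \<Gamma> x v (B h))" for h
  have M': "((\<lambda>z. cov Y z v) has_derivative M') (at x)"
    unfolding M'_def B_def y_def by (rule cov_has_derivative[OF sY x has_derivative_const])
  have comm: "dir_deriv (\<lambda>z. dir_deriv Y z y) x v = dir_deriv (\<lambda>z. dir_deriv Y z v) x y"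
    using smooth_on_dir_deriv_symmetric[OF sY open_S x, of y v] .
  have "((\<lambda>z. G z v (cov Y z v)) has_derivative
     (\<lambda>h. G x (0 + \<Gamma> x h v) (C v) + G x v (M' h + \<Gamma> x h (C v)))) (at x)"
    unfolding C_def by (rule metric_has_derivative[OF x has_derivative_const M'])
  moreover have "((\<lambda>z. G z v (cov Y z v)) has_derivative (\<lambda>h. 0)) (at x)"
  proof (rule has_derivative_transform_within_open[OF has_derivative_const open_S x])
    show "0 = G z v (cov Y z v)" if "z \<in> S" for z
      using killing_skew_self[OF Y that, of v] sym[OF that, of v "cov Y z v"] by linarith
  qed
  ultimately have "(\<lambda>h. G x (0 + \<Gamma> x h v) (C v) + G x v (M' h + \<Gamma> x h (C v))) = (\<lambda>h. 0)"
    by (rule has_derivative_unique)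
  from fun_cong[OF this, of y] have e1: "G x v (M' y + \<Gamma> x y (C v)) = - G x (\<Gamma> x y v) (C v)" by simp
  have "((\<lambda>z. G z v (cov Y z (Y z))) has_derivative
     (\<lambda>h. G x (0 + \<Gamma> x h v) (cov Y x (Y x)) + G x v (N' h + \<Gamma> x h (cov Y x (Y x))))) (at x)"
    by (rule metric_has_derivative[OF x has_derivative_const N'])
  then have "((\<lambda>z. G z v (cov Y z (Y z))) has_derivative (\<lambda>h. G x v (N' h))) (at x)"
    by (simp only: crit G_simps[OF x] \<Gamma>_simps[OF x] add_0_left add_0_right)
  then have d: "((\<lambda>z. - G z v (cov Y z (Y z))) has_derivative (\<lambda>h. - G x v (N' h))) (at x)"
    by (rule has_derivative_minus)
  have D: "((\<lambda>z. G z (cov Y z v) (Y z)) has_derivative (\<lambda>h. - G x v (N' h))) (at x)"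
    by (rule has_derivative_transform_within_open[OF d open_S x]) (simp add: killing_skew[OF Y])
  \<comment> \<open>The second derivatives of \<open>Y\<close> in \<open>N' v\<close> and
    \<open>M' y\<close> agree by \<open>comm\<close>, and the derivatives of the Christoffel symbols
    differ as in \<open>riemann\<close>. The remaining first-order terms combine to \<open>C\<close>
    once \<open>B y\<close> is eliminated by criticality.\<close>
  have Neq: "N' v = (M' y + \<Gamma> x y (C v)) + riemann G x v y y + C (C v) - C (\<Gamma> x v y)"
  proof -
    have By: "B y = - \<Gamma> x y y" using crit Ceq[of y] by (simp add: C_def y_def add_eq_0_iff)
    show ?thesis
      unfolding N'_def M'_def riemann_def comm Ceq B.add
      by (simp add: lin B.zero B.add By)
  qed
  have "- G x v (N' v) = G x (C v) (C v) - G x (riemann G x v y y) v"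
  proof -
    have sk: "G x v (C h) = - G x (C v) h" for h
      using killing_skew[OF Y x, of v h] unfolding C_def by linarith
    define P where "P = M' y + \<Gamma> x y (C v)"
    have "G x v (N' v) = G x v P + G x v (riemann G x v y y) + G x v (C (C v)) - G x v (C (\<Gamma> x v y))"
      unfolding Neq P_def[symmetric] by (simp only: G_simps(2,8)[OF x])
    then have "G x v (N' v) = - G x (\<Gamma> x y v) (C v) + G x v (riemann G x v y y) - G x (C v) (C v) + G x (C v) (\<Gamma> x v y)"
      by (simp only: e1[folded P_def] sk)
    then show ?thesis by (simp add: christoffel_sym[OF x, of y v] sym[OF x, of "C v" "\<Gamma> x v y"] sym[OF x, of v "riemann G x v y y"])
  qed
  with D show ?thesis unfolding C_def y_def by blast
qed

text \<open>The product rule for the pairing of \<open>X\<close> and \<open>Y\<close> along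
  \<open>Y\<close> loses the term with \<open>cov Y x (Y x)\<close>. What remains is half of the Lie
  derivative, whose two terms coincide.\<close>

lemma lie_deriv_critical:
  assumes "smooth_on S X" "smooth_on S Y" "x \<in> S" "cov Y x (Y x) = 0"
  shows "1 / 2 * lie_deriv_local G X x (Y x) (Y x) = dir_deriv (\<lambda>z. G z (X z) (Y z)) x (Y x)"
  using frechet_derivative_at[OF metric_has_derivative_cov[OF assms(3,1,2)], symmetric] assms
  by (simp add: lie_deriv_cov G_simps sym[OF assms(3), of "Y x"])

text \<open>Criticality makes the derivative of \<open>Y\<close> along itself the negative of the
  Christoffel term in the Hessian, so that the Hessian becomes an iterated derivative along
  \<open>Y\<close>.\<close>

lemma hessian_critical:
  assumes f: "smooth_on S f" and Y: "smooth_on S Y" and x: "x \<in> S" and "cov Y x (Y x) = 0"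
  shows "((\<lambda>z. dir_deriv f z (Y z)) has_derivative
      (\<lambda>h. dir_deriv (\<lambda>z. dir_deriv f z (Y x)) x h + dir_deriv f x (dir_deriv Y x h))) (at x)"
    and "hessian_local G f x (Y x) (Y x) = dir_deriv (\<lambda>z. dir_deriv f z (Y z)) x (Y x)"
proof -
  show D: "((\<lambda>z. dir_deriv f z (Y z)) has_derivative
      (\<lambda>h. dir_deriv (\<lambda>z. dir_deriv f z (Y x)) x h + dir_deriv f x (dir_deriv Y x h))) (at x)"
    by (rule linear_field_has_derivative[OF open_S x _ _ smooth_on_der[OF Y x]])
      (auto intro: has_derivative_linear[OF smooth_on_der[OF f]]
        smooth_on_differentiable[OF smooth_on_dir_deriv[OF f] open_S x])
  have "dir_deriv Y x (Y x) = - \<Gamma> x (Y x) (Y x)" using assms(4) by (simp add: cov_def add_eq_0_iff)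
  then show "hessian_local G f x (Y x) (Y x) = dir_deriv (\<lambda>z. dir_deriv f z (Y z)) x (Y x)"
    using frechet_derivative_at[OF D, symmetric] linear_neg[OF has_derivative_linear[OF smooth_on_der[OF f x]]]
    by (simp add: hessian_local_def)
qed

end

section \<open>Linear algebra and calculus of the second variation\<close>

text \<open>A nonzero alternating form has a hyperbolic pair \<open>e\<close>, \<open>f\<close>.
  Splitting off its plane lowers the dimension by 2 and keeps it odd, and a radical vector of the
  complement is one of \<open>W\<close>.\<close>

lemma alternating_form_radical:
  fixes W :: "'a::euclidean_space set" and \<omega> :: "'a \<Rightarrow> 'a \<Rightarrow> real"
  assumes "subspace W" "odd (dim W)" "bilinear \<omega>" "\<And>v. v \<in> W \<Longrightarrow> \<omega> v v = 0"
  shows "\<exists>v\<in>W. v \<noteq> 0 \<and> (\<forall>w\<in>W. \<omega> v w = 0)"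
  using assms(1,2,4)
proof (induction "dim W" arbitrary: W rule: less_induct)
  case less
  note lin = bilinear_ladd[OF assms(3)] bilinear_radd[OF assms(3)]
    bilinear_lmul[OF assms(3)] bilinear_rmul[OF assms(3)] bilinear_lzero[OF assms(3)] bilinear_rzero[OF assms(3)]
    bilinear_lsub[OF assms(3)] bilinear_rsub[OF assms(3)]
  have skew: "\<omega> u v = - \<omega> v u" if "u \<in> W" "v \<in> W" for u v
  proof -
    have "\<omega> (u + v) (u + v) = 0" using less.prems that by (simp add: subspace_add)
    then show ?thesis using less.prems(3) that by (simp add: lin)
  qed
  show ?case
  proof (cases "\<forall>u\<in>W. \<forall>v\<in>W. \<omega> u v = 0")
    case True
    have "W \<noteq> {0}" using less.prems(2) by auto
    then show ?thesis using True less.prems(1) subspace_0 by blast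
  next
    case False
    then obtain e f0 where ef0: "e \<in> W" "f0 \<in> W" "\<omega> e f0 \<noteq> 0" by blast
    define f where "f = (1 / \<omega> e f0) *\<^sub>R f0"
    have f: "f \<in> W" "\<omega> e f = 1" using ef0 less.prems(1) by (simp_all add: f_def subspace_scale lin)
    have fe: "\<omega> f e = -1" "\<omega> e e = 0" "\<omega> f f = 0"
      using skew[OF f(1) ef0(1)] f(2) less.prems(3)[OF f(1)] less.prems(3)[OF ef0(1)] by linarith+
    define W' where "W' = {w \<in> W. \<omega> w e = 0 \<and> \<omega> w f = 0}"
    have sub: "subspace W'"
      using less.prems(1) unfolding W'_def subspace_def by (auto simp: lin)
    have spW': "span W' = W'" using sub by (simp add: span_eq_iff)
    have span: "span (insert e (insert f W')) = W"
    proof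
      show "span (insert e (insert f W')) \<subseteq> W"
        using less.prems(1) ef0 f by (intro span_minimal) (auto simp: W'_def)
      show "W \<subseteq> span (insert e (insert f W'))"
      proof
        fix w assume w: "w \<in> W"
        \<comment> \<open>The projection of \<open>w\<close> to the complement of the plane spanned
          by \<open>e\<close> and \<open>f\<close>; the signs come from
          \<open>\<omega> f e = -1\<close>.\<close>
        have "w - \<omega> w f *\<^sub>R e + \<omega> w e *\<^sub>R f \<in> W'"
          using w less.prems(1) f ef0(1) fe unfolding W'_def
          by (auto simp: lin intro!: subspace_add subspace_diff subspace_scale)
        then have "w - \<omega> w f *\<^sub>R e + \<omega> w e *\<^sub>R f \<in> span (insert e (insert f W'))"
          by (intro span_base) simp
        then have *: "(w - \<omega> w f *\<^sub>R e + \<omega> w e *\<^sub>R f) + \<omega> w f *\<^sub>R e - \<omega> w e *\<^sub>R f \<in> span (insert e (insert f W'))"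
          by (rule span_diff[OF span_add]) (intro span_scale span_base, simp)+
        have "(w - \<omega> w f *\<^sub>R e + \<omega> w e *\<^sub>R f) + \<omega> w f *\<^sub>R e - \<omega> w e *\<^sub>R f = w" by simp
        with * show "w \<in> span (insert e (insert f W'))" by metis
      qed
    qed
    have fn: "f \<notin> span W'" unfolding spW' using fe by (simp add: W'_def)
    have en: "e \<notin> span (insert f W')"
    proof
      assume "e \<in> span (insert f W')"
      then obtain k where "e - k *\<^sub>R f \<in> W'" using spW' by (auto simp: span_breakdown_eq)
      then have "\<omega> (e - k *\<^sub>R f) f = 0" by (simp add: W'_def)
      then show False using f fe by (simp add: lin)
    qed
    have "dim W = dim (insert e (insert f W'))" by (metis span dim_span)
    also have "\<dots> = dim W' + 2" using fn en by (simp add: dim_insert)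
    finally have d: "dim W = dim W' + 2" .
    have "\<exists>v\<in>W'. v \<noteq> 0 \<and> (\<forall>w\<in>W'. \<omega> v w = 0)"
      by (rule less.hyps) (use d less.prems sub in \<open>auto simp: W'_def\<close>)
    then obtain v where v: "v \<in> W'" "v \<noteq> 0" "\<And>w. w \<in> W' \<Longrightarrow> \<omega> v w = 0" by blast
    have "\<omega> v w = 0" if "w \<in> W" for w
    proof -
      have "w - \<omega> w f *\<^sub>R e + \<omega> w e *\<^sub>R f \<in> W'"
        using that less.prems(1) f ef0(1) fe unfolding W'_def
        by (auto simp: lin intro!: subspace_add subspace_diff subspace_scale)
      from v(3)[OF this] v(1) show ?thesis by (simp add: lin W'_def)
    qed
    then show ?thesis using v by (auto simp: W'_def)
  qed
qed

lemma dim_kernel_functional: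
  fixes W :: "'a::euclidean_space set" and l :: "'a \<Rightarrow> real"
  assumes "subspace W" "linear l" "y \<in> W" "l y \<noteq> 0"
  shows "subspace {w \<in> W. l w = 0}" "dim W = dim {w \<in> W. l w = 0} + 1"
proof -
  interpret l: linear l by fact
  show sub: "subspace {w \<in> W. l w = 0}"
    using assms(1) unfolding subspace_def by (auto simp: l.add l.scaleR l.zero)
  let ?W = "{w \<in> W. l w = 0}"
  have "span (insert y ?W) = W"
  proof
    show "span (insert y ?W) \<subseteq> W" using assms by (intro span_minimal) auto
    show "W \<subseteq> span (insert y ?W)"
    proof
      fix w assume w: "w \<in> W"
      have "w - (l w / l y) *\<^sub>R y \<in> ?W"
        using w assms by (auto simp: l.diff l.scaleR intro!: subspace_diff subspace_scale)
      then have "(w - (l w / l y) *\<^sub>R y) + (l w / l y) *\<^sub>R y \<in> span (insert y ?W)"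
        by (intro span_add span_scale) (blast intro: span_base)+
      then show "w \<in> span (insert y ?W)" by simp
    qed
  qed
  moreover have "y \<notin> span ?W" using assms sub by (metis (mono_tags, lifting) mem_Collect_eq span_eq_iff)
  ultimately show "dim W = dim ?W + 1" by (metis dim_insert dim_span)
qed

text \<open>A second-order Taylor formula when \<open>m\<close> is known to be differentiable at 0
  alone: one application of l'Hopital's rule leaves half the difference quotient of \<open>m\<close>
  at 0.\<close>

lemma second_order_quotient_tendsto:
  fixes a m :: "real \<Rightarrow> real"
  assumes "\<forall>\<^sub>F s in nhds 0. (a has_real_derivative m s) (at s)"
    and "m 0 = 0" "(m has_real_derivative c) (at 0)"
  shows "((\<lambda>s. (a s - a 0) / s\<^sup>2) \<longlongrightarrow> c / 2) (at_right 0)"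
proof (rule lhopital_right_0)
  have a0: "(a has_real_derivative m 0) (at 0)"
    using assms(1) by (rule eventually_nhds_x_imp_x)
  have "isCont a 0" using a0 DERIV_isCont by blast
  then have "((\<lambda>s. a s - a 0) \<longlongrightarrow> a 0 - a 0) (at 0)"
    by (intro tendsto_intros) (simp add: isCont_def)
  then show "((\<lambda>s. a s - a 0) \<longlongrightarrow> 0) (at_right 0)"
    using filterlim_at_split by auto
  have "((\<lambda>s::real. s\<^sup>2) \<longlongrightarrow> 0\<^sup>2) (at_right 0)" by (intro tendsto_intros)
  then show "((\<lambda>s::real. s\<^sup>2) \<longlongrightarrow> 0) (at_right 0)" by simp
  show "\<forall>\<^sub>F x in at_right 0. x\<^sup>2 \<noteq> (0::real)"
    by (auto simp: eventually_at_filter)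
  show "\<forall>\<^sub>F x in at_right 0. 2 * x \<noteq> (0::real)"
    by (auto simp: eventually_at_filter)
  have "\<forall>\<^sub>F s in at_right 0. (a has_real_derivative m s) (at s)"
    using assms(1) by (simp add: eventually_at_filter eventually_mono)
  then show "\<forall>\<^sub>F x in at_right 0. ((\<lambda>s. a s - a 0) has_real_derivative m x) (at x)"
    by eventually_elim (auto intro!: derivative_eq_intros)
  show "\<forall>\<^sub>F x in at_right 0. ((\<lambda>s. s\<^sup>2) has_real_derivative 2 * x) (at x)"
    by (auto intro!: derivative_eq_intros always_eventually)
  have "((\<lambda>s. m s / s) \<longlongrightarrow> c) (at 0)"
    using assms(2,3) by (simp add: has_field_derivative_iff)
  then have "((\<lambda>s. m s / s) \<longlongrightarrow> c) (at_right 0)"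
    using filterlim_at_split by auto
  then have "((\<lambda>s. (m s / s) / 2) \<longlongrightarrow> c / 2) (at_right 0)" by (intro tendsto_intros) auto
  then show "((\<lambda>x. m x / (2 * x)) \<longlongrightarrow> c / 2) (at_right 0)" by (simp add: field_simps)
qed

context local_metric
begin

lemma has_derivative_line:
  assumes "(f has_derivative D) (at (x + s *\<^sub>R v))"
  shows "((\<lambda>s. f (x + s *\<^sub>R v)) has_real_derivative D v) (at s)"
proof -
  have "((\<lambda>s. x + s *\<^sub>R v) has_derivative (\<lambda>h. h *\<^sub>R v)) (at s)"
    by (auto intro!: derivative_eq_intros)
  from has_derivative_compose[OF this assms]
  have "((\<lambda>s. f (x + s *\<^sub>R v)) has_derivative (\<lambda>h. D (h *\<^sub>R v))) (at s)" .
  then show ?thesis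
    using linear_cmul[OF has_derivative_linear[OF assms], of _ v]
    by (simp add: has_field_derivative_def mult.commute[of _ "D v"])
qed

text \<open>The quotient vanishes if \<open>K = 0\<close>, by the convention \<open>0 / 0 = 0\<close>.\<close>

lemma berger_local:
  assumes Y: "killing Y" and K: "killing K" and x: "x \<in> S"
    and comm: "dir_deriv Y x (K x) = dir_deriv K x (Y x)"
    and K0: "K x \<noteq> 0 \<or> (\<forall>z\<in>S. K z = 0)"
    and w0: "G x (Y x) (K x) = 0"
    and min: "\<forall>\<^sub>F z in nhds x. G x (Y x) (Y x) \<le> G z (Y z) (Y z) - (G z (Y z) (K z))\<^sup>2 / G z (K z) (K z)"
    and V: "cov Y x V = \<mu> *\<^sub>R K x"
  shows "cov Y x (Y x) = 0" "G x (riemann G x V (Y x) (Y x)) V \<le> 0"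
proof -
  define q where "q z = G z (Y z) (Y z)" for z
  define w where "w z = G z (Y z) (K z)" for z
  define k where "k z = G z (K z) (K z)" for z
  have Sev: "\<forall>\<^sub>F z in nhds x. z \<in> S" using open_S x by (auto simp: eventually_nhds)
  have kpos: "k z \<ge> 0" if "z \<in> S" for z
    using pos[OF that, of "K z"] by (cases "K z = 0") (auto simp: k_def G_simps[OF that] less_imp_le)
  \<comment> \<open>The subtracted quotient is nonnegative, so \<open>x\<close> is also a local
    minimum of the squared length of \<open>Y\<close>, from which criticality follows.\<close>
  have qmin: "\<forall>\<^sub>F z in nhds x. q x \<le> q z"
    using min Sev
  proof eventually_elim
    case (elim z)
    then show ?case using kpos[of z] unfolding q_def k_def
      by (smt (verit) divide_nonneg_nonneg zero_le_power2)
  qed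
  have qd: "(q has_derivative (\<lambda>h. 2 * G x (cov Y x h) (Y x))) (at x)"
    using killing_norm_derivative[OF Y x] by (simp add: q_def[abs_def])
  obtain U where "open U" "x \<in> U" "\<forall>z\<in>U. q x \<le> q z" using qmin by (auto simp: eventually_nhds)
  then have "(\<lambda>h. 2 * G x (cov Y x h) (Y x)) = (\<lambda>h. 0)"
    using differential_zero_maxmin[of x U q] qd by blast
  then have crit0: "G x (cov Y x h) (Y x) = 0" for h by (simp add: fun_eq_iff)
  have "G x (cov Y x (Y x)) h = 0" for h
    using crit0[of h] killing_skew[OF Y x, of "Y x" h] sym[OF x, of "Y x" "cov Y x h"] by linarith
  then show crit: "cov Y x (Y x) = 0"
    using G_nondegenerate[OF x, of "cov Y x (Y x)" 0] by (simp add: G_simps[OF x])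
  obtain D where D: "((\<lambda>y. G y (cov Y y V) (Y y)) has_derivative D) (at x)"
    "D V = G x (cov Y x V) (cov Y x V) - G x (riemann G x V (Y x) (Y x)) V"
    using killing_norm_second_derivative[OF Y x crit] by blast
  have lim0: "((\<lambda>s. x + s *\<^sub>R V) \<longlongrightarrow> x) (nhds 0)"
  proof -
    have "((\<lambda>s. x + s *\<^sub>R V) \<longlongrightarrow> x + 0 *\<^sub>R V) (nhds 0)"
      by (intro tendsto_intros filterlim_ident)
    then show ?thesis by simp
  qed
  have evl: "\<forall>\<^sub>F s in nhds 0. P (x + s *\<^sub>R V)" if "\<forall>\<^sub>F z in nhds x. P z" for P
    using lim0 that unfolding filterlim_iff by blast
  have evr: "\<forall>\<^sub>F s in at_right 0. P (x + s *\<^sub>R V)" if "\<forall>\<^sub>F z in nhds x. P z" for P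
    using evl[OF that] unfolding eventually_at_filter by (rule eventually_mono) simp
  have "((\<lambda>s. (q (x + s *\<^sub>R V) - q (x + 0 *\<^sub>R V)) / s\<^sup>2) \<longlongrightarrow> (2 * D V) / 2) (at_right 0)"
  proof (rule second_order_quotient_tendsto[where m="\<lambda>s. 2 * G (x + s *\<^sub>R V) (cov Y (x + s *\<^sub>R V) V) (Y (x + s *\<^sub>R V))"])
    have "\<forall>\<^sub>F s in nhds 0. x + s *\<^sub>R V \<in> S"
      by (rule evl[OF Sev])
    then show "\<forall>\<^sub>F s in nhds 0. ((\<lambda>s. q (x + s *\<^sub>R V)) has_real_derivative
         2 * G (x + s *\<^sub>R V) (cov Y (x + s *\<^sub>R V) V) (Y (x + s *\<^sub>R V))) (at s)"
    proof eventually_elim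
      case (elim s)
      have "(q has_derivative (\<lambda>h. 2 * G (x + s *\<^sub>R V) (cov Y (x + s *\<^sub>R V) h) (Y (x + s *\<^sub>R V)))) (at (x + s *\<^sub>R V))"
        using killing_norm_derivative[OF Y elim] by (simp add: q_def[abs_def])
      from has_derivative_line[OF this] show ?case .
    qed
    show "2 * G (x + 0 *\<^sub>R V) (cov Y (x + 0 *\<^sub>R V) V) (Y (x + 0 *\<^sub>R V)) = 0" using crit0 by simp
    have "((\<lambda>s. G (x + s *\<^sub>R V) (cov Y (x + s *\<^sub>R V) V) (Y (x + s *\<^sub>R V))) has_real_derivative D V) (at 0)"
      using has_derivative_line[of "\<lambda>y. G y (cov Y y V) (Y y)" D x 0 V] D(1) by simp
    then show "((\<lambda>s. 2 * G (x + s *\<^sub>R V) (cov Y (x + s *\<^sub>R V) V) (Y (x + s *\<^sub>R V))) has_real_derivative 2 * D V) (at 0)"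
      by (rule DERIV_cmult)
  qed
  then have T1: "((\<lambda>s. (q (x + s *\<^sub>R V) - q x) / s\<^sup>2) \<longlongrightarrow> D V) (at_right 0)" by simp
  \<comment> \<open>The pairing of \<open>Y\<close> and \<open>K\<close> vanishes at
    \<open>x\<close> and has derivative 2 \<mu> |K|^2 along \<open>V\<close>, so the quotient is 4
    \<mu>^2 |K|^2 s^2 to leading order.\<close>
  have T2: "((\<lambda>s. (w (x + s *\<^sub>R V))\<^sup>2 / k (x + s *\<^sub>R V) / s\<^sup>2) \<longlongrightarrow> 4 * \<mu>\<^sup>2 * k x) (at_right 0)"
  proof (cases "K x = 0")
    case True
    then have Kz: "K z = 0" if "z \<in> S" for z using K0 that by blast
    have "\<forall>\<^sub>F s in at_right 0. x + s *\<^sub>R V \<in> S"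
      by (rule evr[OF Sev])
    then have "\<forall>\<^sub>F s in at_right 0. (w (x + s *\<^sub>R V))\<^sup>2 / k (x + s *\<^sub>R V) / s\<^sup>2 = 0"
      by eventually_elim (simp add: w_def Kz G_simps)
    moreover have "k x = 0" by (simp add: k_def Kz[OF x] G_simps[OF x])
    ultimately show ?thesis by (simp add: tendsto_eventually)
  next
    case False
    then have kx: "k x > 0" using pos[OF x] by (simp add: k_def)
    have wd: "(w has_derivative (\<lambda>h. 2 * G x (cov Y x h) (K x))) (at (x + 0 *\<^sub>R V))"
      using killing_inner_derivative[OF Y K x comm] by (simp add: w_def[abs_def])
    have "((\<lambda>s. w (x + s *\<^sub>R V)) has_real_derivative 2 * (\<mu> * k x)) (at 0)"
      using has_derivative_line[OF wd] by (simp add: V G_simps[OF x] k_def)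
    then have "((\<lambda>s. w (x + s *\<^sub>R V) / s) \<longlongrightarrow> 2 * (\<mu> * k x)) (at 0)"
      using w0 by (simp add: has_field_derivative_iff w_def)
    then have l1: "((\<lambda>s. w (x + s *\<^sub>R V) / s) \<longlongrightarrow> 2 * (\<mu> * k x)) (at_right 0)"
      using filterlim_at_split by auto
    have "continuous (at x) k"
      using killing_norm_derivative[OF K x] has_derivative_continuous unfolding k_def[abs_def] by blast
    then have "(k \<longlongrightarrow> k x) (nhds x)" by (simp add: continuous_at tendsto_at_iff_tendsto_nhds)
    then have "((\<lambda>s. k (x + s *\<^sub>R V)) \<longlongrightarrow> k x) (nhds 0)" using lim0 by (rule filterlim_compose)
    then have l2: "((\<lambda>s. k (x + s *\<^sub>R V)) \<longlongrightarrow> k x) (at_right 0)"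
      by (rule filterlim_mono) (auto simp: at_within_def)
    have "((\<lambda>s. (w (x + s *\<^sub>R V) / s)\<^sup>2 / k (x + s *\<^sub>R V)) \<longlongrightarrow> (2 * (\<mu> * k x))\<^sup>2 / k x) (at_right 0)"
      using kx by (intro tendsto_intros l1 l2) auto
    then show ?thesis using kx by (simp add: power_divide power_mult_distrib power2_eq_square mult_ac)
  qed
  \<comment> \<open>With \<open>R\<close> for the curvature term, comparing coefficients of s^2
    yields 4 \<mu>^2 |K|^2 \<le> \<mu>^2 |K|^2 - R, and so R \<le> - 3 \<mu>^2 |K|^2.\<close>
  have "4 * \<mu>\<^sup>2 * k x \<le> D V"
  proof (rule tendsto_le[OF _ T1 T2])
    have "\<forall>\<^sub>F s in at_right 0. q x \<le> q (x + s *\<^sub>R V) - (w (x + s *\<^sub>R V))\<^sup>2 / k (x + s *\<^sub>R V)"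
      using evr[OF min] unfolding q_def w_def k_def .
    moreover have "\<forall>\<^sub>F s::real in at_right 0. s > 0" by (simp add: eventually_at_filter)
    ultimately show "\<forall>\<^sub>F s in at_right 0. (w (x + s *\<^sub>R V))\<^sup>2 / k (x + s *\<^sub>R V) / s\<^sup>2 \<le> (q (x + s *\<^sub>R V) - q x) / s\<^sup>2"
      by eventually_elim (intro divide_right_mono, auto)
  qed simp
  moreover have "D V = \<mu>\<^sup>2 * k x - G x (riemann G x V (Y x) (Y x)) V"
    unfolding D(2) V by (simp add: G_simps[OF x] k_def power2_eq_square)
  moreover have "\<mu>\<^sup>2 * k x \<ge> 0" using kpos[OF x] by simp
  ultimately show "G x (riemann G x V (Y x) (Y x)) V \<le> 0" by linarith
qed

end

section \<open>Combinations of Killing fields, and homogeneity of the curvature terms\<close>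

lemma differentiable_transform_open:
  assumes "f differentiable at x" "open S" "x \<in> S" "\<And>y. y \<in> S \<Longrightarrow> f y = h y"
  shows "h differentiable at x"
proof -
  obtain D where "(f has_derivative D) (at x)" using assms(1) by (auto simp: differentiable_def)
  then have "(h has_derivative D) (at x)"
    by (rule has_derivative_transform_within_open) (rule assms)+
  then show ?thesis by (auto simp: differentiable_def)
qed

lemma Ck_on_const: "Ck_on k S (\<lambda>_. a)"
proof (induction k arbitrary: a)
  case (Suc k)
  have "frechet_derivative (\<lambda>_. a) (at x) = (\<lambda>_. 0)" for x :: 'a
    using frechet_derivative_at[OF has_derivative_const] by metis
  then show ?case using Suc by simp
qed simp

lemma smooth_on_const: "smooth_on S (\<lambda>_. a)"
  by (simp add: smooth_on_def Ck_on_const)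

lemma Ck_on_diff_scaleR:
  assumes S: "open S" and "Ck_on k S f" "Ck_on k S h"
  shows "Ck_on k S (\<lambda>x. f x - r *\<^sub>R h x)"
  using assms(2,3)
proof (induction k arbitrary: f h)
  case 0
  then show ?case by (auto intro!: continuous_intros)
next
  case (Suc k)
  have D: "((\<lambda>x. f x - r *\<^sub>R h x) has_derivative (\<lambda>v. dir_deriv f x v - r *\<^sub>R dir_deriv h x v)) (at x)"
    if "x \<in> S" for x
    using Suc.prems that S
    by (intro has_derivative_diff has_derivative_scaleR_right)
      (simp_all add: differentiable_on_eq_differentiable_at flip: frechet_derivative_works)
  have "(\<lambda>x. f x - r *\<^sub>R h x) differentiable_on S"
    using Suc.prems by (auto intro!: derivative_intros)
  moreover have "Ck_on k S (\<lambda>x. dir_deriv (\<lambda>x. f x - r *\<^sub>R h x) x v)" for v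
  proof (rule Ck_on_cong[OF S])
    show "Ck_on k S (\<lambda>x. dir_deriv f x v - r *\<^sub>R dir_deriv h x v)"
      using Suc by simp
    show "dir_deriv f y v - r *\<^sub>R dir_deriv h y v = dir_deriv (\<lambda>x. f x - r *\<^sub>R h x) y v" if "y \<in> S" for y
      by (simp flip: frechet_derivative_at[OF D[OF that]])
  qed
  ultimately show ?case by simp
qed

lemma smooth_on_diff_scaleR:
  assumes "open S" "smooth_on S f" "smooth_on S h"
  shows "smooth_on S (\<lambda>x. f x - r *\<^sub>R h x)"
  using Ck_on_diff_scaleR assms unfolding smooth_on_def by blast

context local_metric
begin

lemma dir_deriv_diff_scaleR:
  assumes "smooth_on S Y" "smooth_on S K" "x \<in> S"
  shows "dir_deriv (\<lambda>x. Y x - r *\<^sub>R K x) x v = dir_deriv Y x v - r *\<^sub>R dir_deriv K x v"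
proof -
  have "((\<lambda>x. Y x - r *\<^sub>R K x) has_derivative (\<lambda>v. dir_deriv Y x v - r *\<^sub>R dir_deriv K x v)) (at x)"
    by (intro has_derivative_diff has_derivative_scaleR_right smooth_on_der assms)
  from frechet_derivative_at[OF this] show ?thesis by metis
qed

lemma cov_diff_scaleR:
  assumes "smooth_on S Y" "smooth_on S K" "x \<in> S"
  shows "cov (\<lambda>x. Y x - r *\<^sub>R K x) x v = cov Y x v - r *\<^sub>R cov K x v"
  by (simp add: cov_def dir_deriv_diff_scaleR assms \<Gamma>_simps scaleR_add_right)

lemma killing_diff_scaleR:
  assumes "killing Y" "killing K"
  shows "killing (\<lambda>x. Y x - r *\<^sub>R K x)"
  unfolding killing_def
proof (intro conjI ballI allI)
  show sm: "smooth_on S (\<lambda>x. Y x - r *\<^sub>R K x)"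
    using assms by (intro smooth_on_diff_scaleR open_S killing_smooth)
  fix x v w assume x: "x \<in> S"
  have "G x (cov (\<lambda>x. Y x - r *\<^sub>R K x) x v) w + G x v (cov (\<lambda>x. Y x - r *\<^sub>R K x) x w)
    = (G x (cov Y x v) w + G x v (cov Y x w)) - r * (G x (cov K x v) w + G x v (cov K x w))"
    using assms x by (simp add: cov_diff_scaleR killing_smooth G_simps right_diff_distrib distrib_left)
  also have "\<dots> = 0" using killing_skew[OF assms(1) x, of v w] killing_skew[OF assms(2) x, of v w] by simp
  finally show "lie_deriv_local G (\<lambda>x. Y x - r *\<^sub>R K x) x v w = 0"
    using lie_deriv_cov[OF sm x] by simp
qed

lemma G_diff_field:
  assumes "x \<in> S" "Y differentiable at x" "Z differentiable at x"
  shows "(\<lambda>y. G y (Y y) (Z y)) differentiable at x"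
proof -
  obtain Y' Z' where "(Y has_derivative Y') (at x)" "(Z has_derivative Z') (at x)"
    using assms(2,3) by (auto simp: differentiable_def)
  from metric_has_derivative[OF assms(1) this] show ?thesis unfolding differentiable_def by blast
qed

lemma cov_diff_field:
  assumes "smooth_on S Y" "x \<in> S" "Z differentiable at x"
  shows "(\<lambda>y. cov Y y (Z y)) differentiable at x"
  using cov_has_derivative[OF assms(1,2)] assms(3) unfolding differentiable_def by blast

lemma dir_deriv_diff_field:
  assumes "smooth_on S f" "x \<in> S" "Z differentiable at x"
  shows "(\<lambda>y. dir_deriv f y (Z y)) differentiable at x"
proof -
  obtain Z' where "(Z has_derivative Z') (at x)"
    using assms(3) by (auto simp: differentiable_def)
  from linear_field_has_derivative[OF open_S assms(2) has_derivative_linear[OF smooth_on_der[OF assms(1)]]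
      smooth_on_differentiable[OF smooth_on_dir_deriv[OF assms(1)] open_S assms(2)] this]
  show ?thesis unfolding differentiable_def by blast
qed

lemma weighted_pairing_has_derivative:
  assumes "smooth_on S f" "smooth_on S X" "smooth_on S Y" "x \<in> S"
  shows "((\<lambda>z. exp (f z) * G z (X z) (Y z)) has_derivative
    (\<lambda>h. exp (f x) * (dir_deriv f x h * G x (X x) (Y x) + (G x (cov X x h) (Y x) + G x (X x) (cov Y x h))))) (at x)"
proof -
  have "((\<lambda>z. exp (f z)) has_derivative (\<lambda>h. exp (f x) * dir_deriv f x h)) (at x)"
    using smooth_on_der[OF assms(1,4)] by (auto intro!: derivative_eq_intros)
  from has_derivative_mult[OF this metric_has_derivative_cov[OF assms(4,2,3)]]
  show ?thesis by (simp add: algebra_simps)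
qed

text \<open>Here \<open>Z\<close> is going to be \<open>Y - l K\<close> with a coefficient
  \<open>l\<close> known only to be differentiable. The result gives continuity of the derivative of
  the pairing along this field.\<close>

lemma weighted_pairing_derivative_differentiable:
  assumes "smooth_on S f" "smooth_on S X" "smooth_on S Y" "x \<in> S" "Z differentiable at x"
  shows "(\<lambda>y. dir_deriv (\<lambda>z. exp (f z) * G z (X z) (Y z)) y (Z y)) differentiable at x"
proof -
  let ?h = "\<lambda>y. exp (f y) * (dir_deriv f y (Z y) * G y (X y) (Y y) + (G y (cov X y (Z y)) (Y y) + G y (X y) (cov Y y (Z y))))"
  have sd: "f differentiable at x" "X differentiable at x" "Y differentiable at x"
    using smooth_on_differentiable assms open_S by blast+
  have "(\<lambda>y. exp (f y)) differentiable at x"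
    using has_derivative_exp[OF smooth_on_der[OF assms(1,4)]] unfolding differentiable_def by blast
  note e = this
  note d = dir_deriv_diff_field[OF assms(1,4,5)] G_diff_field[OF assms(4) sd(2,3)]
    G_diff_field[OF assms(4) cov_diff_field[OF assms(2,4,5)] sd(3)]
    G_diff_field[OF assms(4) sd(2) cov_diff_field[OF assms(3,4,5)]]
  have "?h differentiable at x"
    by (rule differentiable_mult[OF e differentiable_add[OF differentiable_mult[OF d(1,2)] differentiable_add[OF d(3,4)]]])
  moreover have "?h y = dir_deriv (\<lambda>z. exp (f z) * G z (X z) (Y z)) y (Z y)" if "y \<in> S" for y
    by (simp flip: frechet_derivative_at[OF weighted_pairing_has_derivative[OF assms(1-3) that]])
  ultimately show ?thesis by (rule differentiable_transform_open[OF _ open_S assms(4)])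
qed

text \<open>Numerator and denominator are invariant under the flows of both fields by
  \<open>killing_invariant\<close>. For \<open>K = 0\<close> the coefficient is constantly 0 by the
  convention for division.\<close>

lemma projection_coefficient_derivative:
  assumes Y: "killing Y" and K: "killing K" and x: "x \<in> S"
    and comm: "dir_deriv Y x (K x) = dir_deriv K x (Y x)"
    and K0: "K x \<noteq> 0 \<or> (\<forall>z\<in>S. K z = 0)"
  shows "\<exists>L. ((\<lambda>z. G z (Y z) (K z) / G z (K z) (K z)) has_derivative L) (at x) \<and> L (Y x) = 0 \<and> L (K x) = 0"
proof (cases "K x = 0")
  case True
  then have Kz: "K z = 0" if "z \<in> S" for z using K0 that by blast
  have "((\<lambda>z. G z (Y z) (K z) / G z (K z) (K z)) has_derivative (\<lambda>h. 0)) (at x)"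
    by (rule has_derivative_transform_within_open[OF has_derivative_const open_S x, of 0]) (simp add: Kz G_simps)
  then show ?thesis by blast
next
  case False
  note s = killing_smooth[OF Y] killing_smooth[OF K]
  have k: "G x (K x) (K x) \<noteq> 0" using pos[OF x False] by simp
  define w where "w = (\<lambda>z. G z (Y z) (K z))"
  define q where "q = (\<lambda>z. G z (K z) (K z))"
  have w: "(w has_derivative dir_deriv w x) (at x)"
    using metric_has_derivative_cov[OF x s] frechet_derivative_works unfolding w_def differentiable_def by blast
  have q: "(q has_derivative dir_deriv q x) (at x)"
    using metric_has_derivative_cov[OF x s(2) s(2)] frechet_derivative_works unfolding q_def differentiable_def by blast
  have z: "dir_deriv w x (Y x) = 0" "dir_deriv w x (K x) = 0" "dir_deriv q x (Y x) = 0" "dir_deriv q x (K x) = 0"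
    unfolding w_def q_def by (rule killing_invariant; use Y K s x comm in simp)+
  have "((\<lambda>z. w z / q z) has_derivative (\<lambda>h. - w x * (inverse (q x) * dir_deriv q x h * inverse (q x)) + dir_deriv w x h / q x)) (at x)"
    using k by (intro has_derivative_divide w q) (simp add: q_def)
  then show ?thesis unfolding w_def q_def using z[unfolded w_def q_def] by (auto intro!: exI)
qed

text \<open>Positivity is assumed for orthonormal pairs, whereas the argument produces merely
  orthogonal ones. Homogeneity of curvature, Lie derivative and Hessian bridges the gap.\<close>

lemma riemann_scale:
  assumes "x \<in> S"
  shows "riemann G x (a *\<^sub>R v) (b *\<^sub>R y) (b *\<^sub>R y) = (a * b\<^sup>2) *\<^sub>R riemann G x v y y"
proof -
  have d: "dir_deriv (\<lambda>z. \<Gamma> z (r *\<^sub>R u) (s *\<^sub>R w)) x (t *\<^sub>R h) = (r * s * t) *\<^sub>R dir_deriv (\<lambda>z. \<Gamma> z u w) x h" for r s t u w h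
  proof -
    have D: "((\<lambda>z. \<Gamma> z u w) has_derivative dir_deriv (\<lambda>z. \<Gamma> z u w) x) (at x)"
      using christoffel_diff[OF assms] by (simp add: frechet_derivative_works)
    have "((\<lambda>z. \<Gamma> z (r *\<^sub>R u) (s *\<^sub>R w)) has_derivative (\<lambda>h. (r * s) *\<^sub>R dir_deriv (\<lambda>z. \<Gamma> z u w) x h)) (at x)"
      by (rule has_derivative_transform_within_open[OF has_derivative_scaleR_right[OF D] open_S assms])
        (simp add: \<Gamma>_simps)
    from fun_cong[OF frechet_derivative_at[OF this], of "t *\<^sub>R h"]
    show ?thesis using linear_cmul[OF has_derivative_linear[OF D], of t h] by simp
  qed
  show ?thesis
    unfolding riemann_def d
    by (simp add: \<Gamma>_simps[OF assms] power2_eq_square scaleR_add_right scaleR_diff_right mult_ac)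
qed

lemma lie_deriv_scale:
  assumes "smooth_on S X" "x \<in> S"
  shows "lie_deriv_local G X x (b *\<^sub>R y) (b *\<^sub>R y) = b\<^sup>2 * lie_deriv_local G X x y y"
  using linear_cmul[OF cov_linear[OF assms]] assms
  by (simp add: lie_deriv_cov G_simps power2_eq_square distrib_left mult_ac)

lemma hessian_scale:
  assumes "smooth_on S f" "x \<in> S"
  shows "hessian_local G f x (b *\<^sub>R y) (b *\<^sub>R y) = b\<^sup>2 * hessian_local G f x y y"
proof -
  have D: "((\<lambda>z. dir_deriv f z y) has_derivative dir_deriv (\<lambda>z. dir_deriv f z y) x) (at x)"
    by (rule smooth_on_der[OF smooth_on_dir_deriv[OF assms(1)] assms(2)])
  have "((\<lambda>z. dir_deriv f z (b *\<^sub>R y)) has_derivative (\<lambda>h. b * dir_deriv (\<lambda>z. dir_deriv f z y) x h)) (at x)"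
    by (rule has_derivative_transform_within_open[OF has_derivative_mult_right[OF D] open_S assms(2)])
      (simp add: linear_cmul[OF has_derivative_linear[OF smooth_on_der[OF assms(1)]]])
  from fun_cong[OF frechet_derivative_at[OF this], of "b *\<^sub>R y"]
  have "dir_deriv (\<lambda>z. dir_deriv f z (b *\<^sub>R y)) x (b *\<^sub>R y) = b\<^sup>2 * dir_deriv (\<lambda>z. dir_deriv f z y) x y"
    using linear_cmul[OF has_derivative_linear[OF D], of b y] by (simp add: power2_eq_square)
  then show ?thesis unfolding hessian_local_def
    by (simp add: \<Gamma>_simps[OF assms(2)] linear_cmul[OF has_derivative_linear[OF smooth_on_der[OF assms]]] power2_eq_square right_diff_distrib)
qed

end

section \<open>Charts and tangent vectors\<close>

locale atlas =
  fixes A :: "('m::{t2_space,second_countable_topology}, 'n::finite) chart set"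
  assumes smooth_atlas: "smooth_atlas A"
begin

lemma is_chart: "c \<in> A \<Longrightarrow> is_chart c"
  using smooth_atlas by (auto simp: smooth_atlas_def)

lemma open_domain: "c \<in> A \<Longrightarrow> open (fst c)"
  and open_image: "c \<in> A \<Longrightarrow> open (chart_image c)"
  and chart_homeo: "c \<in> A \<Longrightarrow> homeomorphism (fst c) (chart_image c) (snd c) (chart_inv c)"
  using is_chart by (auto simp: is_chart_def)

lemma ex_chart: obtains c where "c \<in> A" "p \<in> fst c"
proof -
  have "p \<in> (\<Union>c\<in>A. fst c)" using smooth_atlas by (simp add: smooth_atlas_def)
  then show ?thesis using that by blast
qed

lemma chart_in_image: "p \<in> fst c \<Longrightarrow> snd c p \<in> chart_image c"
  by (simp add: chart_image_def)

lemma chart_inv_chart [simp]: "c \<in> A \<Longrightarrow> p \<in> fst c \<Longrightarrow> chart_inv c (snd c p) = p"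
  using chart_homeo by (auto simp: homeomorphism_def)

lemma chart_chart_inv [simp]: "c \<in> A \<Longrightarrow> x \<in> chart_image c \<Longrightarrow> snd c (chart_inv c x) = x"
  using chart_homeo by (auto simp: homeomorphism_def)

lemma chart_inv_in: "c \<in> A \<Longrightarrow> x \<in> chart_image c \<Longrightarrow> chart_inv c x \<in> fst c"
  using chart_homeo[of c] unfolding homeomorphism_def by blast

lemma continuous_chart: "c \<in> A \<Longrightarrow> continuous_on (fst c) (snd c)"
  and continuous_chart_inv: "c \<in> A \<Longrightarrow> continuous_on (chart_image c) (chart_inv c)"
  using chart_homeo by (auto simp: homeomorphism_def)

lemma open_chart_preimage:
  assumes "c \<in> A" "open U"
  shows "open {x \<in> chart_image c. chart_inv c x \<in> U}"
  using continuous_open_preimage[OF continuous_chart_inv open_image, OF assms(1,1,2)]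
  by (simp add: vimage_def Int_def conj_commute)

lemma open_chart_domain_preimage:
  assumes "c \<in> A" "open U"
  shows "open {p \<in> fst c. snd c p \<in> U}"
  using continuous_open_preimage[OF continuous_chart open_domain, OF assms(1,1,2)]
  by (simp add: vimage_def Int_def conj_commute)

lemma chart_overlap_eq:
  assumes "c \<in> A"
  shows "snd c ` (fst c \<inter> V) = {x \<in> chart_image c. chart_inv c x \<in> V}"
proof (intro subset_antisym subsetI)
  fix x assume "x \<in> {x \<in> chart_image c. chart_inv c x \<in> V}"
  then have "x = snd c (chart_inv c x)" "chart_inv c x \<in> fst c \<inter> V"
    using assms chart_inv_in by auto
  then show "x \<in> snd c ` (fst c \<inter> V)" by (rule image_eqI)
next
  fix x assume "x \<in> snd c ` (fst c \<inter> V)"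
  then obtain p where "x = snd c p" "p \<in> fst c" "p \<in> V" by blast
  then show "x \<in> {x \<in> chart_image c. chart_inv c x \<in> V}"
    using assms chart_in_image[of p c] by simp
qed

lemma open_overlap: "c \<in> A \<Longrightarrow> d \<in> A \<Longrightarrow> open (snd c ` (fst c \<inter> fst d))"
  by (simp add: chart_overlap_eq open_chart_preimage open_domain)

lemma transition_smooth:
  "c \<in> A \<Longrightarrow> d \<in> A \<Longrightarrow> smooth_on (snd c ` (fst c \<inter> fst d)) (snd d \<circ> chart_inv c)"
  using smooth_atlas by (auto simp: smooth_atlas_def)

lemma transition_has_derivative:
  assumes "c \<in> A" "d \<in> A" "p \<in> fst c" "p \<in> fst d"
  shows "((snd d \<circ> chart_inv c) has_derivative frechet_derivative (snd d \<circ> chart_inv c) (at (snd c p))) (at (snd c p))"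
  using assms by (intro smooth_on_has_derivative[OF transition_smooth open_overlap]) auto

lemma change_chart:
  assumes "c \<in> A" "d \<in> A" "p \<in> fst c" "p \<in> fst d"
    and F: "((F \<circ> chart_inv d) has_derivative D) (at (snd d p))"
  shows "((F \<circ> chart_inv c) has_derivative
    D \<circ> frechet_derivative (snd d \<circ> chart_inv c) (at (snd c p))) (at (snd c p))"
proof (rule has_derivative_transform_within_open)
  have eq: "(snd d \<circ> chart_inv c) (snd c p) = snd d p" using assms(1,3) by simp
  have "((F \<circ> chart_inv d) has_derivative D) (at ((snd d \<circ> chart_inv c) (snd c p)))"
    unfolding eq by (rule F)
  then show "((F \<circ> chart_inv d) \<circ> (snd d \<circ> chart_inv c) has_derivative
    D \<circ> frechet_derivative (snd d \<circ> chart_inv c) (at (snd c p))) (at (snd c p))"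
    by (rule diff_chain_at[OF transition_has_derivative[OF assms(1-4)]])
  show "open (snd c ` (fst c \<inter> fst d))" by (rule open_overlap[OF assms(1,2)])
  show "snd c p \<in> snd c ` (fst c \<inter> fst d)" using assms(3,4) by blast
  fix y assume "y \<in> snd c ` (fst c \<inter> fst d)"
  then obtain q where "y = snd c q" "q \<in> fst c" "q \<in> fst d" by blast
  then show "((F \<circ> chart_inv d) \<circ> (snd d \<circ> chart_inv c)) y = (F \<circ> chart_inv c) y"
    using assms(1,2) by simp
qed

lemma transition_cocycle:
  assumes "c \<in> A" "d \<in> A" "e \<in> A" "p \<in> fst c" "p \<in> fst d" "p \<in> fst e"
  shows "frechet_derivative (snd e \<circ> chart_inv c) (at (snd c p)) u =
    frechet_derivative (snd e \<circ> chart_inv d) (at (snd d p)) (frechet_derivative (snd d \<circ> chart_inv c) (at (snd c p)) u)"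
  using fun_cong[OF frechet_derivative_at[OF change_chart[OF assms(1,2,4,5) transition_has_derivative[OF assms(2,3,5,6)]]], of u]
  by simp

lemma transition_id:
  assumes "c \<in> A" "p \<in> fst c"
  shows "frechet_derivative (snd c \<circ> chart_inv c) (at (snd c p)) = (\<lambda>u. u)"
proof -
  have "((snd c \<circ> chart_inv c) has_derivative (\<lambda>u. u)) (at (snd c p))"
    by (rule has_derivative_transform_within_open[OF has_derivative_ident open_image[OF assms(1)] chart_in_image[OF assms(2)]])
      (use assms in simp)
  from frechet_derivative_at[OF this] show ?thesis by simp
qed

lemma tangent_of_in: 
  assumes "c \<in> A" "p \<in> fst c"
  shows "tangent_of A c p u \<in> tangent_space A p"
  unfolding tangent_space_def tangent_of_def
proof (intro CollectI conjI ballI impI allI)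
  fix d e assume "d \<in> A" "e \<in> A" "p \<in> fst d \<inter> fst e"
  then show "(if e \<in> A \<and> p \<in> fst e then frechet_derivative (snd e \<circ> chart_inv c) (at (snd c p)) u else 0) =
    frechet_derivative (snd e \<circ> chart_inv d) (at (snd d p))
     (if d \<in> A \<and> p \<in> fst d then frechet_derivative (snd d \<circ> chart_inv c) (at (snd c p)) u else 0)"
    using transition_cocycle[OF assms(1) _ _ assms(2), of d e u] by simp
qed auto

lemma tangent_of_self [simp]: "c \<in> A \<Longrightarrow> p \<in> fst c \<Longrightarrow> tangent_of A c p u c = u"
  by (simp add: tangent_of_def transition_id)

lemma tangent_of_component:
  assumes "c \<in> A" "p \<in> fst c" "V \<in> tangent_space A p"
  shows "tangent_of A c p (V c) = V"
proof
  fix d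
  show "tangent_of A c p (V c) d = V d"
  proof (cases "d \<in> A \<and> p \<in> fst d")
    case True
    then have "V d = frechet_derivative (snd d \<circ> chart_inv c) (at (snd c p)) (V c)"
      using assms unfolding tangent_space_def by blast
    then show ?thesis using True by (simp add: tangent_of_def)
  next
    case False
    then have "V d = 0" using assms(3) unfolding tangent_space_def by blast
    then show ?thesis using False by (auto simp: tangent_of_def)
  qed
qed

lemma tangent_eqI:
  assumes "c \<in> A" "p \<in> fst c" "V \<in> tangent_space A p" "W \<in> tangent_space A p" "V c = W c"
  shows "V = W"
proof -
  have "V = tangent_of A c p (V c)" by (rule tangent_of_component[OF assms(1,2,3), symmetric])
  also have "\<dots> = tangent_of A c p (W c)" by (simp only: assms(5))
  also have "\<dots> = W" by (rule tangent_of_component[OF assms(1,2,4)])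
  finally show ?thesis .
qed

lemma zero_in_tangent_space: "(\<lambda>_. 0) \<in> tangent_space A p"
  unfolding tangent_space_def
  by (simp add: linear_0[OF has_derivative_linear[OF transition_has_derivative]])

lemma scaleR_in_tangent_space:
  assumes "V \<in> tangent_space A p"
  shows "(\<lambda>d. r *\<^sub>R V d) \<in> tangent_space A p"
  unfolding tangent_space_def
proof (intro CollectI conjI ballI impI allI)
  fix c d assume cd: "c \<in> A" "d \<in> A" "p \<in> fst c \<inter> fst d"
  then have "V d = frechet_derivative (snd d \<circ> chart_inv c) (at (snd c p)) (V c)"
    using assms unfolding tangent_space_def by blast
  then show "r *\<^sub>R V d = frechet_derivative (snd d \<circ> chart_inv c) (at (snd c p)) (r *\<^sub>R V c)"
    using linear_cmul[OF has_derivative_linear[OF transition_has_derivative], of c d p r] cd by simp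
next
  fix c assume "c \<notin> A \<or> p \<notin> fst c"
  then have "V c = 0" using assms unfolding tangent_space_def by blast
  then show "r *\<^sub>R V c = 0" by simp
qed

lemma continuous_on_chartsI:
  fixes h :: "'m \<Rightarrow> 'b::topological_space"
  assumes "\<And>c. c \<in> A \<Longrightarrow> continuous_on {x \<in> chart_image c. chart_inv c x \<in> U} (h \<circ> chart_inv c)" "open U"
  shows "continuous_on U h"
proof -
  have "continuous_on (\<Union>c\<in>A. U \<inter> fst c) h"
  proof (rule continuous_on_open_UN)
    fix c assume c: "c \<in> A"
    show "open (U \<inter> fst c)" using c assms(2) open_domain by blast
    have "continuous_on (U \<inter> fst c) ((h \<circ> chart_inv c) \<circ> snd c)"
    proof (rule continuous_on_compose)
      show "continuous_on (U \<inter> fst c) (snd c)"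
        using continuous_chart[OF c] continuous_on_subset by blast
      show "continuous_on (snd c ` (U \<inter> fst c)) (h \<circ> chart_inv c)"
        using assms(1)[OF c] by (rule continuous_on_subset) (use c in \<open>auto simp: chart_image_def\<close>)
    qed
    then show "continuous_on (U \<inter> fst c) h"
      by (rule continuous_on_eq) (use c in auto)
  qed
  moreover have "(\<Union>c\<in>A. U \<inter> fst c) = U" using smooth_atlas by (auto simp: smooth_atlas_def)
  ultimately show ?thesis by simp
qed

end

section \<open>Metric, Killing fields and weighted positivity read in charts\<close>

locale riemannian_manifold = atlas A
  for A :: "('m::{t2_space,second_countable_topology}, 'n::finite) chart set" +
  fixes g :: "('m, 'n) metric"
  assumes riemannian_metric: "riemannian_metric A g"
begin

lemma chart_local_metric: "c \<in> A \<Longrightarrow> local_metric (chart_image c) (metric_in A g c)"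
  using riemannian_metric open_image unfolding riemannian_metric_def
  by unfold_locales auto

lemma metric_in_eq:
  assumes "c \<in> A" "p \<in> fst c" "V \<in> tangent_space A p" "W \<in> tangent_space A p"
  shows "metric_in A g c (snd c p) (V c) (W c) = g p V W"
  using assms by (simp add: metric_in_def tangent_of_component)

lemma field_in_chart [simp]: "c \<in> A \<Longrightarrow> p \<in> fst c \<Longrightarrow> field_in c X (snd c p) = X p c"
  by (simp add: field_in_def)

lemma killing_field_local:
  assumes "killing_field A g K" "c \<in> A"
  shows "local_metric.killing (chart_image c) (metric_in A g c) (field_in c K)"
  unfolding local_metric.killing_def[OF chart_local_metric[OF assms(2)]]
proof (intro conjI ballI allI)
  show "smooth_on (chart_image c) (field_in c K)"
    using assms by (simp add: killing_field_def smooth_vector_field_def)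
  fix x v w assume x: "x \<in> chart_image c"
  let ?p = "chart_inv c x"
  have p: "?p \<in> fst c" using chart_inv_in assms x by blast
  have "lie_deriv A g K c ?p (tangent_of A c ?p v) (tangent_of A c ?p w) = 0"
    using assms p tangent_of_in unfolding killing_field_def by blast
  then show "lie_deriv_local (metric_in A g c) (field_in c K) x v w = 0"
    using assms p x by (simp add: lie_deriv_def)
qed

text \<open>A common form for both kinds of positivity, so that the minimization treats them alike:
  \<open>f\<close> is 0 for the first kind and the potential of \<open>X\<close> for the
  second.\<close>

lemma weighted_positivity:
  assumes X: "smooth_vector_field A X" and pw: "positive_weighted_sec A g X"
  shows "\<exists>f. smooth_function A f \<and> (\<forall>c\<in>A. \<forall>x\<in>chart_image c. \<forall>Y v.
    smooth_on (chart_image c) Y \<longrightarrow> Y x \<noteq> 0 \<longrightarrow> v \<noteq> 0 \<longrightarrow> metric_in A g c x v (Y x) = 0 \<longrightarrow>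
    local_metric.cov (metric_in A g c) Y x (Y x) = 0 \<longrightarrow>
    dir_deriv (\<lambda>z. exp (f (chart_inv c z)) * metric_in A g c z (field_in c X z) (Y z)) x (Y x) = 0 \<longrightarrow>
    metric_in A g c x (riemann (metric_in A g c) x v (Y x) (Y x)) v > 0)"
proof -
  \<comment> \<open>\<open>W\<close> stands for the weight. Being quadratic and zero at
    \<open>y\<close>, it vanishes at the unit multiple of \<open>y\<close> too, and the sectional
    curvature that is left is a positive multiple of the curvature expression in \<open>v\<close>
    and \<open>y\<close>.\<close>
  have key: "metric_in A g c x (riemann (metric_in A g c) x v y y) v > 0"
    if c: "c \<in> A" and x: "x \<in> chart_image c" and y: "y \<noteq> 0" "v \<noteq> 0" "metric_in A g c x v y = 0"
      and W: "\<And>b. W (b *\<^sub>R y) = b\<^sup>2 * W y" "W y = 0"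
      and P: "\<And>p U V. orthonormal_pair A g p U V \<Longrightarrow> p \<in> fst c \<Longrightarrow> snd c p = x \<Longrightarrow> sec A g c p U V + W (V c) > 0"
    for c x y v and W :: "real ^ 'n \<Rightarrow> real"
  proof -
    interpret local_metric "chart_image c" "metric_in A g c" using chart_local_metric[OF c] .
    let ?G = "metric_in A g c"
    define p where "p = chart_inv c x"
    have p: "p \<in> fst c" "snd c p = x" using c x chart_inv_in by (auto simp: p_def)
    define a where "a = 1 / sqrt (?G x v v)"
    define b where "b = 1 / sqrt (?G x y y)"
    have vp: "?G x v v > 0" "?G x y y > 0" using pos[OF x] y by auto
    have ab: "a > 0" "b > 0" "a * a * ?G x v v = 1" "b * b * ?G x y y = 1"
      using vp by (auto simp: a_def b_def real_sqrt_mult[symmetric])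
    let ?U = "tangent_of A c p (a *\<^sub>R v)" and ?V = "tangent_of A c p (b *\<^sub>R y)"
    have T: "?U \<in> tangent_space A p" "?V \<in> tangent_space A p" using tangent_of_in c p by auto
    have "g p ?U ?U = 1" "g p ?V ?V = 1" "g p ?U ?V = 0"
      using metric_in_eq[OF c p(1) T(1) T(1)] metric_in_eq[OF c p(1) T(2) T(2)] metric_in_eq[OF c p(1) T]
        c p ab y(3) by (simp_all add: G_simps[OF x] mult.assoc)
    then have o: "orthonormal_pair A g p ?U ?V" using T by (simp add: orthonormal_pair_def)
    from P[OF o p] have "sectional_local ?G x (a *\<^sub>R v) (b *\<^sub>R y) + W (b *\<^sub>R y) > 0"
      using c p by (simp add: sec_def)
    moreover have "sectional_local ?G x (a *\<^sub>R v) (b *\<^sub>R y) = a\<^sup>2 * b\<^sup>2 * ?G x (riemann ?G x v y y) v"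
      using ab y(3) by (simp add: sectional_local_def riemann_scale[OF x] G_simps[OF x] power2_eq_square mult_ac)
    ultimately have "a\<^sup>2 * b\<^sup>2 * ?G x (riemann ?G x v y y) v > 0" using W by simp
    moreover have "a\<^sup>2 * b\<^sup>2 > 0" using ab by simp
    ultimately show ?thesis by (rule zero_less_mult_pos)
  qed
  from pw consider
    (1) "\<And>p U V c. orthonormal_pair A g p U V \<Longrightarrow> c \<in> A \<Longrightarrow> p \<in> fst c \<Longrightarrow> sec_X A g X c p V U > 0"
  | (2) f where "smooth_function A f" "is_gradient A g f X"
      "\<And>p U V c. orthonormal_pair A g p U V \<Longrightarrow> c \<in> A \<Longrightarrow> p \<in> fst c \<Longrightarrow> sec_bar A g f c p V U > 0"
    unfolding positive_weighted_sec_def by blast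
  then show ?thesis
  proof cases
    case 1
    have "smooth_function A (\<lambda>_. 0)" by (simp add: smooth_function_def comp_def smooth_on_const)
    moreover have "metric_in A g c x (riemann (metric_in A g c) x v (Y x) (Y x)) v > 0"
      if c: "c \<in> A" and x: "x \<in> chart_image c" and Y: "smooth_on (chart_image c) Y"
        "Y x \<noteq> 0" "v \<noteq> 0" "metric_in A g c x v (Y x) = 0" "local_metric.cov (metric_in A g c) Y x (Y x) = 0"
        and crit: "dir_deriv (\<lambda>z. metric_in A g c z (field_in c X z) (Y z)) x (Y x) = 0"
      for c x Y v
    proof -
      interpret local_metric "chart_image c" "metric_in A g c" using chart_local_metric[OF c] .
      have sX: "smooth_on (chart_image c) (field_in c X)" using X c by (simp add: smooth_vector_field_def)
      show ?thesis
      proof (rule key[OF c x Y(2-4), where W="\<lambda>y. 1 / 2 * lie_deriv_local (metric_in A g c) (field_in c X) x y y"])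
        show "1 / 2 * lie_deriv_local (metric_in A g c) (field_in c X) x (Y x) (Y x) = 0"
          using lie_deriv_critical[OF sX Y(1) x Y(5)] crit by simp
        fix p U V assume "orthonormal_pair A g p U V" "p \<in> fst c" "snd c p = x"
        with 1 c show "sec A g c p U V + 1 / 2 * lie_deriv_local (metric_in A g c) (field_in c X) x (V c) (V c) > 0"
          unfolding sec_X_def lie_deriv_def by blast
      qed (simp add: lie_deriv_scale[OF sX x])
    qed
    ultimately show ?thesis by (intro exI[of _ "\<lambda>_. 0"]) simp
  next
    case 2
    moreover have "metric_in A g c x (riemann (metric_in A g c) x v (Y x) (Y x)) v > 0"
      if c: "c \<in> A" and x: "x \<in> chart_image c" and Y: "smooth_on (chart_image c) Y"
        "Y x \<noteq> 0" "v \<noteq> 0" "metric_in A g c x v (Y x) = 0" "local_metric.cov (metric_in A g c) Y x (Y x) = 0"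
        and crit: "dir_deriv (\<lambda>z. exp (f (chart_inv c z)) * metric_in A g c z (field_in c X z) (Y z)) x (Y x) = 0"
      for c x Y v
    proof -
      interpret local_metric "chart_image c" "metric_in A g c" using chart_local_metric[OF c] .
      let ?f = "f \<circ> chart_inv c"
      have sf: "smooth_on (chart_image c) ?f" using 2 c by (simp add: smooth_function_def)
      \<comment> \<open>For a gradient the pairing with \<open>X\<close> is \<open>df\<close>;
        differentiating the factor \<open>exp f\<close> then produces the term \<open>df(Y)\<close>
        squared.\<close>
      have grad: "metric_in A g c z (field_in c X z) u = dir_deriv ?f z u" if "z \<in> chart_image c" for z u
      proof -
        let ?p = "chart_inv c z"
        have p: "?p \<in> fst c" using c that chart_inv_in by blast
        have T: "X ?p \<in> tangent_space A ?p" using X by (simp add: smooth_vector_field_def)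
        show ?thesis
          using 2(2) metric_in_eq[OF c p T tangent_of_in[OF c p, of u]] c p that tangent_of_in[OF c p, of u]
          by (simp add: is_gradient_def differential_def field_in_def)
      qed
      have D1: "((\<lambda>z. dir_deriv ?f z (Y z)) has_derivative
        dir_deriv (\<lambda>z. dir_deriv ?f z (Y z)) x) (at x)"
        using hessian_critical(1)[OF sf Y(1) x Y(5)] frechet_derivative_works
        unfolding differentiable_def by blast
      have D2: "((\<lambda>z. exp (?f z)) has_derivative (\<lambda>h. exp (?f x) * dir_deriv ?f x h)) (at x)"
        using has_derivative_exp[OF smooth_on_der[OF sf x]] by (simp only: mult.commute)
      have "((\<lambda>z. exp (f (chart_inv c z)) * metric_in A g c z (field_in c X z) (Y z)) has_derivative
        (\<lambda>h. exp (?f x) * dir_deriv (\<lambda>z. dir_deriv ?f z (Y z)) x h + exp (?f x) * dir_deriv ?f x h * dir_deriv ?f x (Y x))) (at x)"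
        by (rule has_derivative_transform_within_open[OF has_derivative_mult[OF D2 D1] open_S x]) (simp add: grad)
      from fun_cong[OF frechet_derivative_at[OF this], of "Y x"] crit
      have "exp (?f x) * (dir_deriv (\<lambda>z. dir_deriv ?f z (Y z)) x (Y x) + (dir_deriv ?f x (Y x))\<^sup>2) = 0"
        by (simp add: power2_eq_square distrib_left mult.assoc)
      then have W0: "hessian_local (metric_in A g c) ?f x (Y x) (Y x) + (dir_deriv ?f x (Y x))\<^sup>2 = 0"
        using hessian_critical(2)[OF sf Y(1) x Y(5)] by simp
      show ?thesis
      proof (rule key[OF c x Y(2-4), where W="\<lambda>y. hessian_local (metric_in A g c) ?f x y y + (dir_deriv ?f x y)\<^sup>2"])
        fix p U V assume "orthonormal_pair A g p U V" "p \<in> fst c" "snd c p = x"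
        with 2(3)[of p U V c] c show "sec A g c p U V + (hessian_local (metric_in A g c) ?f x (V c) (V c) + (dir_deriv ?f x (V c))\<^sup>2) > 0"
          by (auto simp: sec_bar_def hessian_def differential_def add.assoc)
      next
        fix b
        show "hessian_local (metric_in A g c) ?f x (b *\<^sub>R Y x) (b *\<^sub>R Y x) + (dir_deriv ?f x (b *\<^sub>R Y x))\<^sup>2
          = b\<^sup>2 * (hessian_local (metric_in A g c) ?f x (Y x) (Y x) + (dir_deriv ?f x (Y x))\<^sup>2)"
          by (simp add: hessian_scale[OF sf x] linear_cmul[OF has_derivative_linear[OF smooth_on_der[OF sf x]]]
              power_mult_distrib distrib_left)
      qed (fact W0)
    qed
    ultimately show ?thesis by blast
  qed
qed

end

section \<open>The weighted Berger argument\<close>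

text \<open>\<open>p\<close> minimizes \<open>f\<close> on the closure of the perturbed minima for
  all \<open>e\<close> together. Those for small \<open>e\<close> exceed no value of
  \<open>f\<close> by more than \<open>2 * B * e\<close>, so this minimum is the global one.\<close>

lemma minimum_limit_of_perturbed_minima:
  fixes f \<psi> :: "'a::t2_space \<Rightarrow> real"
  assumes C: "compact C" "C \<noteq> {}" and f: "continuous_on C f" and \<psi>: "continuous_on C \<psi>"
  shows "\<exists>p\<in>C. (\<forall>r\<in>C. f p \<le> f r) \<and>
    p \<in> closure {q \<in> C. \<exists>e>0. \<forall>r\<in>C. f q - e * \<psi> q \<le> f r - e * \<psi> r}"
proof -
  define Q where "Q = {q \<in> C. \<exists>e>0. \<forall>r\<in>C. f q - e * \<psi> q \<le> f r - e * \<psi> r}"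
  have ex: "\<exists>q\<in>C. \<forall>r\<in>C. f q - e * \<psi> q \<le> f r - e * \<psi> r" for e
    by (rule continuous_attains_inf[OF C]) (intro continuous_intros f \<psi>)
  have "Q \<noteq> {}" using ex[of 1] by (auto simp: Q_def intro!: exI[of _ 1])
  have clC: "closure Q \<subseteq> C"
    by (rule closure_minimal) (use compact_imp_closed C in \<open>auto simp: Q_def\<close>)
  have "compact (closure Q)"
    using compact_Int_closed[OF C(1) closed_closure, of Q] clC by (simp add: Int_absorb1)
  then obtain p where p: "p \<in> closure Q" "\<And>z. z \<in> closure Q \<Longrightarrow> f p \<le> f z"
    using continuous_attains_inf[of "closure Q" f] \<open>Q \<noteq> {}\<close> continuous_on_subset[OF f clC] by auto
  obtain b where b: "b \<in> C" "\<And>r. r \<in> C \<Longrightarrow> \<bar>\<psi> r\<bar> \<le> \<bar>\<psi> b\<bar>"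
    using continuous_attains_sup[OF C, of "\<lambda>r. \<bar>\<psi> r\<bar>"] \<psi> by (auto intro: continuous_intros)
  define B where "B = \<bar>\<psi> b\<bar>"
  have "f p \<le> f r" if r: "r \<in> C" for r
  proof (rule field_le_epsilon)
    fix d :: real assume d: "d > 0"
    \<comment> \<open>Chosen to give \<open>e * (2 * B) \<le> d\<close>; the summand 1 covers
      \<open>B = 0\<close>.\<close>
    define e where "e = d / (2 * B + 1)"
    have B: "B \<ge> 0" by (simp add: B_def)
    have e: "e > 0" "e * (2 * B) \<le> d" using d B by (auto simp: e_def field_simps)
    obtain q where q: "q \<in> C" "\<And>r. r \<in> C \<Longrightarrow> f q - e * \<psi> q \<le> f r - e * \<psi> r" using ex[of e] by blast
    then have "q \<in> Q" using e(1) unfolding Q_def by blast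
    then have "q \<in> closure Q" using closure_subset by blast
    then have "f p \<le> f q" by (rule p)
    moreover have "e * (\<psi> q - \<psi> r) \<le> e * (2 * B)"
      using b(2)[OF q(1)] b(2)[OF r] e(1) by (intro mult_left_mono) (auto simp: B_def)
    ultimately show "f p \<le> f r + d" using q(2)[OF r] e(2) by (simp add: algebra_simps)
  qed
  then show ?thesis using p(1) clC unfolding Q_def by blast
qed

context local_metric
begin

text \<open>The complement \<open>W\<close> of \<open>Y x\<close> and \<open>k\<close> has dimension
  \<open>n - 1\<close> for \<open>k = 0\<close> and \<open>n - 2\<close> otherwise, odd in both
  cases. A radical vector \<open>V\<close> of the skew form on \<open>W\<close> has a derivative
  orthogonal to \<open>W\<close>, and also to \<open>Y x\<close> by skewness and
  criticality.\<close>

lemma exists_null_direction: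
  assumes Y: "killing Y" and x: "x \<in> S" and crit: "cov Y x (Y x) = 0" and Y0: "Y x \<noteq> 0"
    and perp: "G x (Y x) k = 0" and par: "k = 0 \<and> even CARD('n) \<or> k \<noteq> 0 \<and> odd CARD('n)"
  shows "\<exists>V \<mu>. V \<noteq> 0 \<and> G x V (Y x) = 0 \<and> cov Y x V = \<mu> *\<^sub>R k"
proof -
  have lin: "linear (\<lambda>v. G x v w)" for w using bilin[OF x] by (simp add: bilinear_def)
  note kd1 = dim_kernel_functional[OF subspace_UNIV lin[of "Y x"] UNIV_I, of "Y x"]
  have yy: "G x (Y x) (Y x) \<noteq> 0" using pos[OF x Y0] by simp
  define W where "W = {v \<in> {v \<in> UNIV. G x v (Y x) = 0}. G x v k = 0}"
  have W: "subspace W \<and> odd (dim W)"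
  proof (cases "k = 0")
    case True
    then have "W = {v \<in> UNIV. G x v (Y x) = 0}" by (simp add: W_def G_simps[OF x])
    then show ?thesis using kd1[OF yy] True par by (simp add: dim_UNIV)
  next
    case False
    then have kk: "G x k k \<noteq> 0" using pos[OF x] by fastforce
    have "k \<in> {v \<in> UNIV. G x v (Y x) = 0}" using perp sym[OF x] by simp
    from dim_kernel_functional[OF kd1(1)[OF yy] lin[of k] this kk] kd1(2)[OF yy] False par
    show ?thesis unfolding W_def by (simp add: dim_UNIV)
  qed
  define \<omega> where "\<omega> v w = G x (cov Y x v) w" for v w
  note cl = cov_linear[OF killing_smooth[OF Y] x]
  have "bilinear \<omega>"
    using bilin[OF x] unfolding \<omega>_def bilinear_def linear_iff
    by (simp add: linear_add[OF cl] linear_cmul[OF cl] G_simps[OF x])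
  moreover have "\<omega> v v = 0" for v unfolding \<omega>_def by (rule killing_skew_self[OF Y x])
  ultimately obtain V where V: "V \<in> W" "V \<noteq> 0" "\<And>w. w \<in> W \<Longrightarrow> \<omega> V w = 0"
    using alternating_form_radical[of W \<omega>] W by blast
  define z where "z = cov Y x V"
  define \<mu> where "\<mu> = G x z k / G x k k"
  have zy: "G x z (Y x) = 0"
    using killing_skew[OF Y x, of V "Y x"] crit by (simp add: z_def G_simps[OF x])
  have mk: "\<mu> * G x k k = G x z k"
  proof (cases "k = 0")
    case False
    then show ?thesis using pos[OF x, of k] by (simp add: \<mu>_def)
  qed (simp add: G_simps[OF x])
  have ky: "G x k (Y x) = 0" using perp sym[OF x] by simp
  \<comment> \<open>After its component along \<open>k\<close> is removed, \<open>z\<close> lies in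
    \<open>W\<close> and is orthogonal to \<open>W\<close>.\<close>
  have "z - \<mu> *\<^sub>R k \<in> W" using zy mk ky by (simp add: W_def G_simps[OF x])
  moreover have "G x (z - \<mu> *\<^sub>R k) w = 0" if "w \<in> W" for w
  proof -
    have "G x k w = 0" using that sym[OF x, of k w] by (simp add: W_def)
    then show ?thesis using V(3)[OF that] by (simp add: \<omega>_def z_def G_simps[OF x])
  qed
  ultimately have "G x (z - \<mu> *\<^sub>R k) (z - \<mu> *\<^sub>R k) = 0" by blast
  then have "z = \<mu> *\<^sub>R k" using pos[OF x, of "z - \<mu> *\<^sub>R k"] by fastforce
  then show ?thesis using V(1,2) by (auto simp: W_def z_def)
qed

end

context riemannian_manifold
begin

text \<open>The Lie bracket of \<open>Y\<close> and \<open>K\<close> vanishes, in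
  coordinates.\<close>

definition commuting_fields where
  "commuting_fields Y K \<longleftrightarrow> (\<forall>c\<in>A. \<forall>x\<in>chart_image c.
     dir_deriv (field_in c Y) x (field_in c K x) = dir_deriv (field_in c K) x (field_in c Y x))"

lemma field_differentiable:
  "smooth_vector_field A X \<Longrightarrow> c \<in> A \<Longrightarrow> x \<in> chart_image c \<Longrightarrow> field_in c X differentiable at x"
  by (intro smooth_on_differentiable[OF _ open_image]) (simp_all add: smooth_vector_field_def)

lemma pairing_in_chart:
  assumes "smooth_vector_field A X" "smooth_vector_field A Y" "c \<in> A" "x \<in> chart_image c"
  shows "g (chart_inv c x) (X (chart_inv c x)) (Y (chart_inv c x)) =
    metric_in A g c x (field_in c X x) (field_in c Y x)"
  using metric_in_eq[OF assms(3) chart_inv_in[OF assms(3,4)], of "X (chart_inv c x)" "Y (chart_inv c x)"] assms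
  by (simp add: smooth_vector_field_def field_in_def)

text \<open>Compactness of \<open>C\<close> provides minima and openness makes derivatives vanish
  there. In odd dimensions \<open>K\<close> is required to be nonzero on \<open>C\<close> alone, so
  \<open>C\<close> may later be the set of points moved by the torus. The conclusion says that the
  squared length of the projected field reaches 0.\<close>

theorem berger:
  assumes X: "smooth_vector_field A X" and pw: "positive_weighted_sec A g X"
    and C: "compact C" "open C" "C \<noteq> {}"
    and Y: "killing_field A g Y" and K: "killing_field A g K" and comm: "commuting_fields Y K"
    and par: "(\<forall>p. is_zero_of K p) \<and> even CARD('n) \<or> (\<forall>p\<in>C. \<not> is_zero_of K p) \<and> odd CARD('n)"
  shows "\<exists>p\<in>C. \<exists>r. Y p = (\<lambda>d. r *\<^sub>R K p d)"
proof (rule ccontr)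
  assume neg: "\<not> ?thesis"
  from weighted_positivity[OF X pw] obtain \<phi> where \<phi>: "smooth_function A \<phi>"
    and "\<forall>c\<in>A. \<forall>x\<in>chart_image c. \<forall>Y v.
    smooth_on (chart_image c) Y \<longrightarrow> Y x \<noteq> 0 \<longrightarrow> v \<noteq> 0 \<longrightarrow> metric_in A g c x v (Y x) = 0 \<longrightarrow>
    local_metric.cov (metric_in A g c) Y x (Y x) = 0 \<longrightarrow>
    dir_deriv (\<lambda>z. exp (\<phi> (chart_inv c z)) * metric_in A g c z (field_in c X z) (Y z)) x (Y x) = 0 \<longrightarrow>
    metric_in A g c x (riemann (metric_in A g c) x v (Y x) (Y x)) v > 0"
    by (elim exE conjE)
  note posi = this(2)[rule_format]
  have sY: "smooth_vector_field A Y" and sK: "smooth_vector_field A K"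
    using Y K by (auto simp: killing_field_def)
  note Yt = sY[unfolded smooth_vector_field_def, THEN conjunct1, rule_format]
  note Kt = sK[unfolded smooth_vector_field_def, THEN conjunct1, rule_format]
  \<comment> \<open>\<open>l\<close> is the coefficient of the projection of \<open>Y\<close> to
    \<open>K\<close>, \<open>F\<close> the squared length of \<open>Y - l K\<close>, and \<psi> the
    weighted pairing of \<open>X\<close> with \<open>Y - l K\<close>, split into \<open>a\<close>
    and \<open>b\<close> because \<open>l\<close> varies.\<close>
  define w where "w p = g p (Y p) (K p)" for p
  define l where "l p = w p / g p (K p) (K p)" for p
  define F where "F p = g p (Y p) (Y p) - l p * w p" for p
  define a where "a p = exp (\<phi> p) * g p (X p) (Y p)" for p
  define b where "b p = exp (\<phi> p) * g p (X p) (K p)" for p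
  define \<psi> where "\<psi> p = a p - l p * b p" for p
  have K0: "field_in c K x \<noteq> 0 \<or> (\<forall>z\<in>chart_image c. field_in c K z = 0)"
    if c: "c \<in> A" and x: "x \<in> chart_image c" "chart_inv c x \<in> C" for c x
  proof (cases "\<forall>p. is_zero_of K p")
    case True
    then show ?thesis by (simp add: is_zero_of_def field_in_def)
  next
    case False
    then have "K (chart_inv c x) \<noteq> (\<lambda>_. 0)" using par x by (auto simp: is_zero_of_def)
    then have "K (chart_inv c x) c \<noteq> 0"
      using tangent_eqI[OF c chart_inv_in[OF c x(1)] Kt zero_in_tangent_space] by auto
    then show ?thesis by (simp add: field_in_def)
  qed
  have loc: "local_metric (chart_image c) (metric_in A g c)" if "c \<in> A" for c
    by (rule chart_local_metric[OF that])
  note kY = killing_field_local[OF Y] and kK = killing_field_local[OF K]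
  have cm: "dir_deriv (field_in c Y) x (field_in c K x) = dir_deriv (field_in c K) x (field_in c Y x)"
    if "c \<in> A" "x \<in> chart_image c" for c x using comm that by (simp add: commuting_fields_def)
  have wc: "w (chart_inv c z) = metric_in A g c z (field_in c Y z) (field_in c K z)"
    and lc: "l (chart_inv c z) = metric_in A g c z (field_in c Y z) (field_in c K z) / metric_in A g c z (field_in c K z) (field_in c K z)"
    and ac: "a (chart_inv c z) = exp ((\<phi> \<circ> chart_inv c) z) * metric_in A g c z (field_in c X z) (field_in c Y z)"
    and bc: "b (chart_inv c z) = exp ((\<phi> \<circ> chart_inv c) z) * metric_in A g c z (field_in c X z) (field_in c K z)"
    and nc: "g (chart_inv c z) (Y (chart_inv c z)) (Y (chart_inv c z)) = metric_in A g c z (field_in c Y z) (field_in c Y z)"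
    if "c \<in> A" "z \<in> chart_image c" for c z
    using pairing_in_chart[OF _ _ that] X sY sK by (simp_all add: w_def l_def a_def b_def)
  have ld: "\<exists>L. ((l \<circ> chart_inv c) has_derivative L) (at x) \<and> L (field_in c Y x) = 0 \<and> L (field_in c K x) = 0"
    if c: "c \<in> A" and x: "x \<in> chart_image c" "chart_inv c x \<in> C" for c x
  proof -
    interpret local_metric "chart_image c" "metric_in A g c" by (rule loc[OF c])
    obtain L where L: "((\<lambda>z. metric_in A g c z (field_in c Y z) (field_in c K z) / metric_in A g c z (field_in c K z) (field_in c K z)) has_derivative L) (at x)"
      "L (field_in c Y x) = 0" "L (field_in c K x) = 0"
      using projection_coefficient_derivative[OF kY[OF c] kK[OF c] x(1) cm[OF c x(1)] K0[OF c x]] by blast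
    have "((l \<circ> chart_inv c) has_derivative L) (at x)"
      by (rule has_derivative_transform_within_open[OF L(1) open_S x(1)]) (simp add: lc[OF c])
    then show ?thesis using L by blast
  qed
  have nd: "\<exists>N W. ((\<lambda>z. g (chart_inv c z) (Y (chart_inv c z)) (Y (chart_inv c z))) has_derivative N) (at x)
      \<and> ((w \<circ> chart_inv c) has_derivative W) (at x)
      \<and> N (field_in c Y x) = 0 \<and> N (field_in c K x) = 0 \<and> W (field_in c Y x) = 0 \<and> W (field_in c K x) = 0"
    if c: "c \<in> A" and x: "x \<in> chart_image c" for c x
  proof -
    interpret local_metric "chart_image c" "metric_in A g c" by (rule loc[OF c])
    note sm = killing_smooth[OF kY[OF c]] killing_smooth[OF kK[OF c]]
    let ?n = "\<lambda>z. metric_in A g c z (field_in c Y z) (field_in c Y z)"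
    let ?w = "\<lambda>z. metric_in A g c z (field_in c Y z) (field_in c K z)"
    have N: "(?n has_derivative dir_deriv ?n x) (at x)" and W: "(?w has_derivative dir_deriv ?w x) (at x)"
      by (simp_all only: flip: frechet_derivative_works)
        (rule G_diff_field[OF x]; rule smooth_on_differentiable[OF _ open_S x]; rule sm)+
    have z: "dir_deriv ?n x (field_in c Y x) = 0" "dir_deriv ?n x (field_in c K x) = 0"
      "dir_deriv ?w x (field_in c Y x) = 0" "dir_deriv ?w x (field_in c K x) = 0"
      using killing_invariant[OF kY[OF c] sm(1) sm(1) x] killing_invariant[OF kK[OF c] sm(1) sm(1) x]
        killing_invariant[OF kY[OF c] sm(1) sm(2) x] killing_invariant[OF kK[OF c] sm(1) sm(2) x] cm[OF c x]
      by simp_all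
    have N': "((\<lambda>z. g (chart_inv c z) (Y (chart_inv c z)) (Y (chart_inv c z))) has_derivative dir_deriv ?n x) (at x)"
      by (rule has_derivative_transform_within_open[OF N open_S x]) (simp add: nc[OF c])
    have W': "((w \<circ> chart_inv c) has_derivative dir_deriv ?w x) (at x)"
      by (rule has_derivative_transform_within_open[OF W open_S x]) (simp add: wc[OF c])
    show ?thesis using N' W' z by blast
  qed
  have Fd: "\<exists>D. ((F \<circ> chart_inv c) has_derivative D) (at x) \<and> D (field_in c Y x) = 0 \<and> D (field_in c K x) = 0"
    if c: "c \<in> A" and x: "x \<in> chart_image c" "chart_inv c x \<in> C" for c x
  proof -
    obtain L where L: "((l \<circ> chart_inv c) has_derivative L) (at x)" "L (field_in c Y x) = 0" "L (field_in c K x) = 0"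
      using ld[OF c x] by blast
    obtain N W where NW: "((\<lambda>z. g (chart_inv c z) (Y (chart_inv c z)) (Y (chart_inv c z))) has_derivative N) (at x)"
      "((w \<circ> chart_inv c) has_derivative W) (at x)"
      "N (field_in c Y x) = 0" "N (field_in c K x) = 0" "W (field_in c Y x) = 0" "W (field_in c K x) = 0"
      using nd[OF c x(1)] by blast
    have "((F \<circ> chart_inv c) has_derivative (\<lambda>h. N h - ((l \<circ> chart_inv c) x * W h + L h * (w \<circ> chart_inv c) x))) (at x)"
      using has_derivative_diff[OF NW(1) has_derivative_mult[OF L(1) NW(2)]] by (simp add: F_def comp_def)
    then show ?thesis using L NW by - (rule exI, intro conjI, assumption, simp_all)
  qed
  have abd: "((a \<circ> chart_inv c) has_derivative dir_deriv (a \<circ> chart_inv c) x) (at x)"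
       "((b \<circ> chart_inv c) has_derivative dir_deriv (b \<circ> chart_inv c) x) (at x)"
       "\<And>Z. Z differentiable at x \<Longrightarrow> (\<lambda>y. dir_deriv (a \<circ> chart_inv c) y (Z y)) differentiable at x"
       "\<And>Z. Z differentiable at x \<Longrightarrow> (\<lambda>y. dir_deriv (b \<circ> chart_inv c) y (Z y)) differentiable at x"
    if c: "c \<in> A" and x: "x \<in> chart_image c" for c x
  proof -
    interpret local_metric "chart_image c" "metric_in A g c" by (rule loc[OF c])
    have sm: "smooth_on (chart_image c) (\<phi> \<circ> chart_inv c)" "smooth_on (chart_image c) (field_in c X)"
      "smooth_on (chart_image c) (field_in c Y)" "smooth_on (chart_image c) (field_in c K)"
      using \<phi> X sY sK c by (auto simp: smooth_function_def smooth_vector_field_def)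
    let ?a = "\<lambda>z. exp ((\<phi> \<circ> chart_inv c) z) * metric_in A g c z (field_in c X z) (field_in c Y z)"
    let ?b = "\<lambda>z. exp ((\<phi> \<circ> chart_inv c) z) * metric_in A g c z (field_in c X z) (field_in c K z)"
    have e: "frechet_derivative (a \<circ> chart_inv c) (at y) = frechet_derivative ?a (at y)"
      "frechet_derivative (b \<circ> chart_inv c) (at y) = frechet_derivative ?b (at y)" if "y \<in> chart_image c" for y
      using ac[OF c] bc[OF c] by (auto intro!: dir_deriv_cong[OF open_S that])
    have "(a \<circ> chart_inv c) differentiable at x"
      by (rule differentiable_transform_open[OF _ open_S x])
        (use weighted_pairing_has_derivative[OF sm(1,2,3) x] ac[OF c] in \<open>auto simp: differentiable_def\<close>)
    then show "((a \<circ> chart_inv c) has_derivative dir_deriv (a \<circ> chart_inv c) x) (at x)"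
      by (simp flip: frechet_derivative_works)
    have "(b \<circ> chart_inv c) differentiable at x"
      by (rule differentiable_transform_open[OF _ open_S x])
        (use weighted_pairing_has_derivative[OF sm(1,2,4) x] bc[OF c] in \<open>auto simp: differentiable_def\<close>)
    then show "((b \<circ> chart_inv c) has_derivative dir_deriv (b \<circ> chart_inv c) x) (at x)"
      by (simp flip: frechet_derivative_works)
    fix Z :: "real ^ 'n \<Rightarrow> real ^ 'n" assume Z: "Z differentiable at x"
    show "(\<lambda>y. dir_deriv (a \<circ> chart_inv c) y (Z y)) differentiable at x"
      by (rule differentiable_transform_open[OF weighted_pairing_derivative_differentiable[OF sm(1,2,3) x Z] open_S x])
        (simp add: e)
    show "(\<lambda>y. dir_deriv (b \<circ> chart_inv c) y (Z y)) differentiable at x"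
      by (rule differentiable_transform_open[OF weighted_pairing_derivative_differentiable[OF sm(1,2,4) x Z] open_S x])
        (simp add: e)
  qed
  have \<psi>d: "\<exists>L. ((\<psi> \<circ> chart_inv c) has_derivative (\<lambda>h. dir_deriv (a \<circ> chart_inv c) x h -
      (l (chart_inv c x) * dir_deriv (b \<circ> chart_inv c) x h + L h * b (chart_inv c x)))) (at x)
      \<and> L (field_in c Y x) = 0 \<and> L (field_in c K x) = 0"
    if c: "c \<in> A" and x: "x \<in> chart_image c" "chart_inv c x \<in> C" for c x
  proof -
    obtain L where L: "((l \<circ> chart_inv c) has_derivative L) (at x)" "L (field_in c Y x) = 0" "L (field_in c K x) = 0"
      using ld[OF c x] by blast
    have "((\<psi> \<circ> chart_inv c) has_derivative (\<lambda>h. dir_deriv (a \<circ> chart_inv c) x h -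
      (l (chart_inv c x) * dir_deriv (b \<circ> chart_inv c) x h + L h * b (chart_inv c x)))) (at x)"
      using has_derivative_diff[OF abd(1)[OF c x(1)] has_derivative_mult[OF L(1) abd(2)[OF c x(1)]]]
      by (simp add: \<psi>_def comp_def)
    then show ?thesis using L by blast
  qed
  have contF: "continuous_on C F"
  proof (rule continuous_on_chartsI[OF _ C(2)])
    fix c assume c: "c \<in> A"
    show "continuous_on {x \<in> chart_image c. chart_inv c x \<in> C} (F \<circ> chart_inv c)"
      using Fd[OF c] has_derivative_continuous by (intro continuous_at_imp_continuous_on ballI) blast
  qed
  have cont\<psi>: "continuous_on C \<psi>"
  proof (rule continuous_on_chartsI[OF _ C(2)])
    fix c assume c: "c \<in> A"
    show "continuous_on {x \<in> chart_image c. chart_inv c x \<in> C} (\<psi> \<circ> chart_inv c)"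
      using \<psi>d[OF c] has_derivative_continuous by (intro continuous_at_imp_continuous_on ballI) blast
  qed
  obtain p where p: "p \<in> C" "\<And>r. r \<in> C \<Longrightarrow> F p \<le> F r"
    and pcl: "p \<in> closure {q \<in> C. \<exists>e>0. \<forall>r\<in>C. F q - e * \<psi> q \<le> F r - e * \<psi> r}"
    using minimum_limit_of_perturbed_minima[OF C(1,3) contF cont\<psi>] by blast
  obtain c where c: "c \<in> A" and pc: "p \<in> fst c" by (rule ex_chart)
  define x where "x = snd c p"
  have x: "x \<in> chart_image c" "chart_inv c x = p" using c pc by (auto simp: x_def chart_in_image)
  have xC: "chart_inv c x \<in> C" using x p by simp
  interpret local_metric "chart_image c" "metric_in A g c" by (rule loc[OF c])
  let ?Y = "field_in c Y" and ?K = "field_in c K"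
  define D where "D = {z \<in> chart_image c. chart_inv c z \<in> C}"
  have D: "open D" "x \<in> D" using open_chart_preimage[OF c C(2)] x xC by (auto simp: D_def)
  \<comment> \<open>The derivative of \<psi> along \<open>Y - l K\<close> with \<open>l\<close>
    treated as a constant. At \<open>x\<close> it is the derivative along \<open>Z\<close>, defined
    below, of the weighted pairing of \<open>X\<close> with \<open>Z\<close>.\<close>
  define \<eta> where "\<eta> z = dir_deriv (a \<circ> chart_inv c) z (?Y z - l (chart_inv c z) *\<^sub>R ?K z)
      - l (chart_inv c z) * dir_deriv (b \<circ> chart_inv c) z (?Y z - l (chart_inv c z) *\<^sub>R ?K z)" for z
  \<comment> \<open>The derivative of \<open>l\<close> vanishes along \<open>Y\<close> and
    \<open>K\<close>, so treating \<open>l\<close> as constant changes nothing. The factor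
    \<open>e\<close> cancels, so every positive \<open>e\<close> leads to the same equation.\<close>
  have zero: "\<eta> z = 0" if z: "z \<in> D" and e: "e > 0" and
    min: "\<And>r. r \<in> C \<Longrightarrow> F (chart_inv c z) - e * \<psi> (chart_inv c z) \<le> F r - e * \<psi> r" for z e
  proof -
    have z': "z \<in> chart_image c" "chart_inv c z \<in> C" using z by (auto simp: D_def)
    obtain DF where DF: "((F \<circ> chart_inv c) has_derivative DF) (at z)" "DF (?Y z) = 0" "DF (?K z) = 0"
      using Fd[OF c z'] by blast
    obtain L where L: "((\<psi> \<circ> chart_inv c) has_derivative (\<lambda>h. dir_deriv (a \<circ> chart_inv c) z h -
      (l (chart_inv c z) * dir_deriv (b \<circ> chart_inv c) z h + L h * b (chart_inv c z)))) (at z)"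
      "L (?Y z) = 0" "L (?K z) = 0" using \<psi>d[OF c z'] by blast
    define DP where "DP h = dir_deriv (a \<circ> chart_inv c) z h -
      (l (chart_inv c z) * dir_deriv (b \<circ> chart_inv c) z h + L h * b (chart_inv c z))" for h
    have DP: "((\<psi> \<circ> chart_inv c) has_derivative DP) (at z)" using L(1) by (simp add: DP_def[abs_def])
    have "((\<lambda>y. (F \<circ> chart_inv c) y - e * (\<psi> \<circ> chart_inv c) y) has_derivative (\<lambda>h. DF h - e * DP h)) (at z)"
      by (intro has_derivative_diff has_derivative_mult_right DF DP)
    from differential_zero_maxmin[OF z D(1) this] min
    have crit: "DF h = e * DP h" for h by (auto simp: D_def fun_eq_iff)
    have "DP (?Y z) = 0" "DP (?K z) = 0" using crit[of "?Y z"] crit[of "?K z"] DF e by auto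
    moreover have "\<eta> z = DP (?Y z) - l (chart_inv c z) * DP (?K z)"
      using linear_diff[OF has_derivative_linear[OF abd(1)[OF c z'(1)]]] linear_diff[OF has_derivative_linear[OF abd(2)[OF c z'(1)]]]
        linear_cmul[OF has_derivative_linear[OF abd(1)[OF c z'(1)]]] linear_cmul[OF has_derivative_linear[OF abd(2)[OF c z'(1)]]]
      by (simp add: \<eta>_def DP_def L right_diff_distrib)
    ultimately show ?thesis by simp
  qed
  have fd: "?Y differentiable at x" "?K differentiable at x" using field_differentiable sY sK c x by auto
  have l_diff: "(\<lambda>z. l (chart_inv c z)) differentiable at x"
    using ld[OF c x(1) xC] by (auto simp: differentiable_def comp_def)
  have y'd: "(\<lambda>z. ?Y z - l (chart_inv c z) *\<^sub>R ?K z) differentiable at x"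
    by (intro differentiable_diff differentiable_scaleR fd l_diff)
  have "\<eta> differentiable at x"
    unfolding \<eta>_def[abs_def]
    by (intro differentiable_diff differentiable_mult abd(3)[OF c x(1) y'd] abd(4)[OF c x(1) y'd] l_diff)
  then have \<eta>c: "isCont \<eta> x" by (rule differentiable_imp_continuous_within)
  have \<eta>0: "\<eta> x = 0"
  proof (rule ccontr)
    assume "\<eta> x \<noteq> 0"
    then have "\<forall>\<^sub>F z in nhds x. \<eta> z \<noteq> 0"
      using \<eta>c unfolding isCont_def tendsto_at_iff_tendsto_nhds
      by (metis tendsto_imp_eventually_ne)
    then obtain U where U: "open U" "x \<in> U" "\<And>z. z \<in> U \<Longrightarrow> \<eta> z \<noteq> 0" by (auto simp: eventually_nhds)
    have "open {q \<in> fst c. snd c q \<in> U \<inter> D}"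
      by (intro open_chart_domain_preimage[OF c] open_Int U D)
    moreover have "p \<in> {q \<in> fst c. snd c q \<in> U \<inter> D}" using U(2) D(2) pc by (simp add: x_def)
    ultimately have "{q \<in> fst c. snd c q \<in> U \<inter> D} \<inter> {q \<in> C. \<exists>e>0. \<forall>r\<in>C. F q - e * \<psi> q \<le> F r - e * \<psi> r} \<noteq> {}"
      using pcl open_Int_closure_eq_empty by blast
    then obtain q where q: "q \<in> fst c" "snd c q \<in> U" "snd c q \<in> D"
      "\<exists>e>0. \<forall>r\<in>C. F q - e * \<psi> q \<le> F r - e * \<psi> r"
      by blast
    then show False using zero[of "snd c q"] U(3)[of "snd c q"] c by auto
  qed
  \<comment> \<open>With the coefficient frozen at \<open>p\<close> the difference is again a
    Killing field, which need not be true of \<open>Y - l K\<close>.\<close>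
  define r where "r = l p"
  define Z where "Z z = ?Y z - r *\<^sub>R ?K z" for z
  have Zk: "killing Z" unfolding Z_def[abs_def] by (rule killing_diff_scaleR[OF kY[OF c] kK[OF c]])
  have Z0: "Z x \<noteq> 0"
  proof
    assume "Z x = 0"
    then have "Y p c = r *\<^sub>R K p c" using c pc by (simp add: Z_def x_def)
    then have "Y p = (\<lambda>d. r *\<^sub>R K p d)"
      by (intro tangent_eqI[OF c pc Yt scaleR_in_tangent_space[OF Kt]]) simp
    then show False using neg p(1) by blast
  qed
  have w0: "metric_in A g c x (Z x) (?K x) = 0"
  proof (cases "?K x = 0")
    case False
    then show ?thesis using pos[OF x(1) False] lc[OF c x(1)]
      by (simp add: Z_def r_def x(2) G_simps[OF x(1)])
  qed (simp add: G_simps[OF x(1)])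
  have Zcomm: "dir_deriv Z x (?K x) = dir_deriv ?K x (Z x)"
    using linear_diff[OF has_derivative_linear[OF smooth_on_der[OF killing_smooth[OF kK[OF c]] x(1)]]]
      linear_cmul[OF has_derivative_linear[OF smooth_on_der[OF killing_smooth[OF kK[OF c]] x(1)]]] cm[OF c x(1)]
    unfolding Z_def[abs_def]
    by (simp add: dir_deriv_diff_scaleR[OF killing_smooth[OF kY[OF c]] killing_smooth[OF kK[OF c]] x(1)])
  \<comment> \<open>Subtracting a multiple of \<open>K\<close> does not change the part orthogonal
    to \<open>K\<close>, so \<open>F\<close> can be computed from \<open>Z\<close>.\<close>
  have Feq: "F (chart_inv c z) = metric_in A g c z (Z z) (Z z) - (metric_in A g c z (Z z) (?K z))\<^sup>2 / metric_in A g c z (?K z) (?K z)"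
    if z: "z \<in> D" for z
  proof -
    have z': "z \<in> chart_image c" using z by (simp add: D_def)
    have s: "metric_in A g c z (?K z) (?Y z) = metric_in A g c z (?Y z) (?K z)" by (rule sym[OF z'])
    show ?thesis
    proof (cases "?K z = 0")
      case True
      then show ?thesis by (simp add: F_def nc[OF c z'] wc[OF c z'] lc[OF c z'] Z_def G_simps[OF z'])
    next
      case False
      then have "metric_in A g c z (?K z) (?K z) \<noteq> 0" using pos[OF z' False] by simp
      then show ?thesis
        by (simp add: F_def nc[OF c z'] wc[OF c z'] lc[OF c z'] Z_def G_simps[OF z'] s field_simps power2_eq_square)
    qed
  qed
  have min: "\<forall>\<^sub>F z in nhds x. metric_in A g c x (Z x) (Z x) \<le>
    metric_in A g c z (Z z) (Z z) - (metric_in A g c z (Z z) (?K z))\<^sup>2 / metric_in A g c z (?K z) (?K z)"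
    unfolding eventually_nhds
  proof (intro exI conjI ballI)
    fix z assume z: "z \<in> D"
    then have "F p \<le> F (chart_inv c z)" by (intro p(2)) (simp add: D_def)
    then show "metric_in A g c x (Z x) (Z x) \<le>
      metric_in A g c z (Z z) (Z z) - (metric_in A g c z (Z z) (?K z))\<^sup>2 / metric_in A g c z (?K z) (?K z)"
      using Feq[OF D(2)] Feq[OF z] w0 x(2) by simp
  qed (fact D)+
  note bl = berger_local[OF Zk kK[OF c] x(1) Zcomm K0[OF c x(1) xC] w0 min]
  \<comment> \<open>Criticality is needed before a null direction can be found, so
    \<open>berger_local\<close> is first used with the zero vector.\<close>
  have "cov Z x 0 = 0 *\<^sub>R ?K x" using linear_0[OF cov_linear[OF killing_smooth[OF Zk] x(1)]] by simp
  from bl(1)[OF this] have crit: "cov Z x (Z x) = 0" .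
  have par': "?K x = 0 \<and> even CARD('n) \<or> ?K x \<noteq> 0 \<and> odd CARD('n)"
    using par K0[OF c x(1) xC] tangent_eqI[OF c pc Kt zero_in_tangent_space] p(1) x(2)
    by (auto simp: is_zero_of_def field_in_def)
  obtain V \<mu> where V: "V \<noteq> 0" "metric_in A g c x V (Z x) = 0" "cov Z x V = \<mu> *\<^sub>R ?K x"
    using exists_null_direction[OF Zk x(1) crit Z0 w0 par'] by blast
  have d: "dir_deriv (\<lambda>z. exp (\<phi> (chart_inv c z)) * metric_in A g c z (field_in c X z) (Z z)) x h =
     dir_deriv (a \<circ> chart_inv c) x h - r * dir_deriv (b \<circ> chart_inv c) x h" for h
  proof -
    have "((\<lambda>z. (a \<circ> chart_inv c) z - r * (b \<circ> chart_inv c) z) has_derivative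
      (\<lambda>h. dir_deriv (a \<circ> chart_inv c) x h - r * dir_deriv (b \<circ> chart_inv c) x h)) (at x)"
      by (intro has_derivative_diff has_derivative_mult_right abd c x)
    then have "((\<lambda>z. exp (\<phi> (chart_inv c z)) * metric_in A g c z (field_in c X z) (Z z)) has_derivative
      (\<lambda>h. dir_deriv (a \<circ> chart_inv c) x h - r * dir_deriv (b \<circ> chart_inv c) x h)) (at x)"
      by (rule has_derivative_transform_within_open[OF _ open_S x(1)])
        (simp add: ac[OF c] bc[OF c] Z_def G_simps algebra_simps)
    from fun_cong[OF frechet_derivative_at[OF this], of h] show ?thesis by simp
  qed
  have "dir_deriv (\<lambda>z. exp (\<phi> (chart_inv c z)) * metric_in A g c z (field_in c X z) (Z z)) x (Z x) = 0"
    unfolding d using \<eta>0 by (simp add: \<eta>_def Z_def r_def x(2))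
  from posi[OF c x(1) killing_smooth[OF Zk] Z0 V(1,2) crit this] bl(2)[OF V(3)]
  show False by simp
qed

end

section \<open>Velocity fields of an isometric torus action\<close>

lemma torus_exp_in_carrier [simp]: "torus_exp t \<in> carrier (torus UNIV)"
  by (simp add: torus_def torus_exp_def)

lemma torus_exp_add: "torus_exp (s + t) = torus_exp s * torus_exp t"
  by (simp add: torus_exp_def vec_eq_iff cis_mult distrib_left)

lemma torus_exp_0 [simp]: "torus_exp 0 = 1"
  by (simp add: torus_exp_def vec_eq_iff one_vec_def)

lemma torus_exp_surj:
  assumes "z \<in> carrier (torus UNIV)"
  obtains t where "torus_exp t = z"
proof -
  have "\<exists>r. cis (2 * pi * r) = z $ i" for i
  proof -
    have "cmod (z $ i) = 1" using assms by (simp add: torus_def)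
    then have "cis (Arg (z $ i)) = z $ i" by (metis cis_Arg norm_zero scaleR_one sgn_div_norm inverse_1 zero_neq_one)
    then show ?thesis by (intro exI[of _ "Arg (z $ i) / (2 * pi)"]) simp
  qed
  then obtain r where "\<And>i. cis (2 * pi * r i) = z $ i" by metis
  then have "torus_exp (\<chi> i. r i) = z" by (simp add: torus_exp_def vec_eq_iff)
  then show ?thesis using that by blast
qed

lemma torus_exp_eq_1_iff: "torus_exp t = 1 \<longleftrightarrow> (\<forall>i. t $ i \<in> \<int>)"
proof -
  have "cis (2 * pi * r) = 1 \<longleftrightarrow> r \<in> \<int>" for r
  proof
    assume "cis (2 * pi * r) = 1"
    then have "cos (2 * pi * r) = 1" by (metis cis.sel(1) one_complex.sel(1))
    then obtain n where "2 * pi * r = of_int n * 2 * pi" by (auto simp: cos_one_2pi_int)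
    then have "r = of_int n" by simp
    then show "r \<in> \<int>" by simp
  next
    assume "r \<in> \<int>"
    then obtain n :: int where "r = of_int n" by (elim Ints_cases)
    then show "cis (2 * pi * r) = 1" by (simp add: cis_multiple_2pi)
  qed
  then show ?thesis by (simp add: torus_exp_def vec_eq_iff one_vec_def)
qed

lemma continuous_torus_exp: "continuous_on S torus_exp"
  unfolding torus_exp_def by (intro continuous_on_vec_lambda continuous_intros continuous_on_compose2[of UNIV cis])
    (auto intro!: continuous_intros simp: cis_conv_exp)

section \<open>The action of the universal cover and its fundamental fields\<close>

locale torus_action = riemannian_manifold A g
  for A :: "('m::{t2_space,second_countable_topology}, 'n::finite) chart set" and g +
  fixes \<rho> :: "complex ^ 'k::finite \<Rightarrow> 'm \<Rightarrow> 'm"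
  assumes action: "isometric_torus_action A g \<rho>"
begin

text \<open>Acting through the universal cover makes the parameters a vector space, where
  directions, derivatives and one-parameter groups are available; the integer lattice acts
  trivially.\<close>

definition act :: "real ^ 'k \<Rightarrow> 'm \<Rightarrow> 'm" where "act t = \<rho> (torus_exp t)"

sublocale group_action "torus UNIV :: (complex ^ 'k) monoid" UNIV \<rho>
  using action by (simp add: isometric_torus_action_def)

lemma act_add: "act (s + t) p = act s (act t p)"
proof -
  have m: "mult (torus UNIV) x y = x * y" for x y :: "complex ^ 'k" by (simp add: torus_def)
  show ?thesis
    unfolding act_def torus_exp_add m[symmetric]
    by (rule composition_rule[OF UNIV_I torus_exp_in_carrier torus_exp_in_carrier])
qed

lemma act_0 [simp]: "act 0 p = p"
  using fun_cong[OF id_eq_one, of p] by (simp add: act_def torus_def)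

lemma act_minus [simp]: "act (- t) (act t p) = p"
  using act_add[of "-t" t p] by simp

lemma act_integral: "(\<And>i. t $ i \<in> \<int>) \<Longrightarrow> act t p = p"
proof -
  assume "\<And>i. t $ i \<in> \<int>"
  then have "torus_exp t = torus_exp 0" by (simp add: torus_exp_eq_1_iff)
  then have "act t p = act 0 p" by (simp only: act_def)
  then show ?thesis by simp
qed

lemma fixed_iff: "(\<forall>z\<in>carrier (torus UNIV). \<rho> z p = p) \<longleftrightarrow> (\<forall>t. act t p = p)"
  by (metis act_def torus_exp_in_carrier torus_exp_surj)

lemma continuous_act: "continuous_on S (\<lambda>(t, p). act t p)"
proof -
  have "continuous_on UNIV ((\<lambda>(z, p). \<rho> z p) \<circ> (\<lambda>(t, p). (torus_exp t, p)))"
  proof (rule continuous_on_compose)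
    show "continuous_on UNIV (\<lambda>(t, p::'m). (torus_exp t :: complex ^ 'k, p))"
      by (auto simp: case_prod_unfold intro!: continuous_intros continuous_on_compose2[OF continuous_torus_exp])
    show "continuous_on ((\<lambda>(t, p::'m). (torus_exp t :: complex ^ 'k, p)) ` UNIV) (\<lambda>(z, p). \<rho> z p)"
      using action unfolding isometric_torus_action_def smooth_torus_map_def
      by (auto elim!: continuous_on_subset)
  qed
  then have "continuous_on UNIV (\<lambda>(t, p). act t p)" by (simp add: comp_def case_prod_unfold act_def)
  then show ?thesis by (rule continuous_on_subset) simp
qed

lemma continuous_act_compose:
  assumes "continuous_on S f" "continuous_on S h"
  shows "continuous_on S (\<lambda>x. act (f x) (h x))"
proof -
  have "continuous_on S ((\<lambda>(t, p). act t p) \<circ> (\<lambda>x. (f x, h x)))"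
    by (intro continuous_on_compose continuous_act continuous_on_Pair assms)
  then show ?thesis by (simp add: comp_def)
qed

definition dom :: "('m, 'n) chart \<Rightarrow> ('m, 'n) chart \<Rightarrow> ((real ^ 'k) \<times> (real ^ 'n)) set" where
  "dom c d = {(t, x). x \<in> chart_image c \<and> act t (chart_inv c x) \<in> fst d}"

definition fl :: "('m, 'n) chart \<Rightarrow> ('m, 'n) chart \<Rightarrow> (real ^ 'k) \<times> (real ^ 'n) \<Rightarrow> real ^ 'n" where
  "fl c d = (\<lambda>(t, x). snd d (act t (chart_inv c x)))"

lemma open_dom:
  assumes "c \<in> A" "d \<in> A"
  shows "open (dom c d)"
proof -
  have "continuous_on (UNIV \<times> chart_image c) (\<lambda>z. act (fst z) (chart_inv c (snd z)))"
    by (intro continuous_act_compose continuous_intros continuous_on_compose2[OF continuous_chart_inv[OF assms(1)]]) auto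
  then have "open ((UNIV \<times> chart_image c) \<inter> (\<lambda>z. act (fst z) (chart_inv c (snd z))) -` fst d)"
    using assms by (intro continuous_open_preimage open_Times open_image open_domain) auto
  moreover have "(UNIV \<times> chart_image c) \<inter> (\<lambda>z. act (fst z) (chart_inv c (snd z))) -` fst d = dom c d"
    by (auto simp: dom_def)
  ultimately show ?thesis by simp
qed

lemma fl_smooth: "c \<in> A \<Longrightarrow> d \<in> A \<Longrightarrow> smooth_on (dom c d) (fl c d)"
  using action unfolding isometric_torus_action_def smooth_torus_map_def dom_def fl_def act_def by blast

lemma fl_has_derivative:
  assumes "c \<in> A" "d \<in> A" "(t, x) \<in> dom c d"
  shows "(fl c d has_derivative dir_deriv (fl c d) (t, x)) (at (t, x))"
  by (rule smooth_on_has_derivative[OF fl_smooth open_dom assms(3)]) (rule assms)+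

lemma fl_time_derivative:
  assumes "c \<in> A" "d \<in> A" "(t, x) \<in> dom c d"
  shows "((\<lambda>t. snd d (act t (chart_inv c x))) has_derivative (\<lambda>a. dir_deriv (fl c d) (t, x) (a, 0))) (at t)"
proof -
  have "((\<lambda>t. (t, x)) has_derivative (\<lambda>a. (a, 0))) (at t)" by (auto intro!: derivative_eq_intros)
  from has_derivative_compose[OF this fl_has_derivative[OF assms]]
  show ?thesis by (simp add: fl_def)
qed

lemma fl_space_derivative:
  assumes "c \<in> A" "d \<in> A" "(t, x) \<in> dom c d"
  shows "((snd d \<circ> act t \<circ> chart_inv c) has_derivative (\<lambda>u. dir_deriv (fl c d) (t, x) (0, u))) (at x)"
proof -
  have "((\<lambda>x. (t, x)) has_derivative (\<lambda>a. (0, a))) (at x)" by (auto intro!: derivative_eq_intros)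
  from has_derivative_compose[OF this fl_has_derivative[OF assms]]
  show ?thesis by (simp add: fl_def comp_def)
qed

text \<open>The fundamental vector field of the Lie algebra element \<open>a\<close>, given by its
  components.\<close>

definition vel :: "real ^ 'k \<Rightarrow> 'm \<Rightarrow> ('m, 'n) tangent" where
  "vel a p = (\<lambda>d. if d \<in> A \<and> p \<in> fst d then dir_deriv (\<lambda>t. snd d (act t p)) 0 a else 0)"

lemma zero_in_dom: "c \<in> A \<Longrightarrow> x \<in> chart_image c \<Longrightarrow> (0, x) \<in> dom c c"
  using chart_inv_in by (simp add: dom_def)

lemma orbit_map_derivative:
  assumes "d \<in> A" "p \<in> fst d"
  shows "((\<lambda>t. snd d (act t p)) has_derivative (\<lambda>a. vel a p d)) (at 0)"
proof -
  have "(0, snd d p) \<in> dom d d" by (rule zero_in_dom[OF assms(1) chart_in_image[OF assms(2)]])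
  from fl_time_derivative[OF assms(1,1) this] assms
  have D: "((\<lambda>t. snd d (act t p)) has_derivative (\<lambda>a. dir_deriv (fl d d) (0, snd d p) (a, 0))) (at 0)" by simp
  then have "((\<lambda>t. snd d (act t p)) has_derivative dir_deriv (\<lambda>t. snd d (act t p)) 0) (at 0)"
    by (simp only: frechet_derivative_at[OF D, symmetric])
  then show ?thesis using assms by (simp add: vel_def)
qed

lemma field_in_vel:
  assumes "d \<in> A" "x \<in> chart_image d"
  shows "field_in d (vel a) x = dir_deriv (fl d d) (0, x) (a, 0)"
proof -
  have "(\<lambda>a. vel a (chart_inv d x) d) = (\<lambda>a. dir_deriv (fl d d) (0, x) (a, 0))"
    by (rule has_derivative_unique[OF orbit_map_derivative[OF assms(1) chart_inv_in[OF assms]]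
          fl_time_derivative[OF assms(1,1) zero_in_dom[OF assms]]])
  then show ?thesis by (simp add: field_in_def fun_eq_iff)
qed

lemma eventually_act_in:
  assumes "d \<in> A" "p \<in> fst d"
  shows "\<forall>\<^sub>F t in nhds 0. act t p \<in> fst d"
proof -
  have "continuous_on UNIV (\<lambda>t. act t p)" by (intro continuous_act_compose continuous_intros)
  then have "open ((\<lambda>t. act t p) -` fst d)" using open_domain[OF assms(1)] by (simp add: continuous_on_open_vimage)
  then show ?thesis unfolding eventually_nhds using assms by (intro exI[of _ "(\<lambda>t. act t p) -` fst d"]) auto
qed

lemma vel_in_tangent_space: "vel a p \<in> tangent_space A p"
  unfolding tangent_space_def
proof (intro CollectI conjI ballI impI allI)
  fix c d assume cd: "c \<in> A" "d \<in> A" "p \<in> fst c \<inter> fst d"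
  let ?T = "snd d \<circ> chart_inv c"
  have "(?T has_derivative frechet_derivative ?T (at (snd c p))) (at (snd c (act 0 p)))"
    using transition_has_derivative[of c d p] cd by simp
  from has_derivative_compose[OF orbit_map_derivative this] cd
  have D: "((\<lambda>t. ?T (snd c (act t p))) has_derivative (\<lambda>a. frechet_derivative ?T (at (snd c p)) (vel a p c))) (at 0)"
    by simp
  obtain U where U: "open U" "0 \<in> U" "\<And>t. t \<in> U \<Longrightarrow> act t p \<in> fst c"
    using eventually_act_in[of c p] cd by (auto simp: eventually_nhds)
  have "((\<lambda>t. snd d (act t p)) has_derivative (\<lambda>a. frechet_derivative ?T (at (snd c p)) (vel a p c))) (at 0)"
    by (rule has_derivative_transform_within_open[OF D U(1,2)]) (use cd U(3) in simp)
  from has_derivative_unique[OF orbit_map_derivative this] cd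
  show "vel a p d = frechet_derivative ?T (at (snd c p)) (vel a p c)" by (simp add: fun_eq_iff)
next
  fix c assume "c \<notin> A \<or> p \<notin> fst c"
  then have "\<not> (c \<in> A \<and> p \<in> fst c)" by blast
  then show "vel a p c = 0" by (simp only: vel_def if_False)
qed

lemma vel_smooth: "smooth_vector_field A (vel a)"
  unfolding smooth_vector_field_def
proof (intro conjI ballI allI vel_in_tangent_space)
  fix c assume c: "c \<in> A"
  have "smooth_on (chart_image c) (\<lambda>x. (\<lambda>z. dir_deriv (fl c c) z (a, 0)) ((0, 0) + (\<lambda>x. (0, x)) x))"
  proof (rule smooth_on_compose_affine[where S="dom c c" and L="\<lambda>x. (0, x)" and b="(0, 0)"
        and f="\<lambda>z. dir_deriv (fl c c) z (a, 0)"])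
    show "smooth_on (dom c c) (\<lambda>z. dir_deriv (fl c c) z (a, 0))"
      by (rule smooth_on_dir_deriv[OF fl_smooth[OF c c]])
    show "bounded_linear (\<lambda>x :: real ^ 'n. (0 :: real ^ 'k, x))"
      by (intro bounded_linear_Pair bounded_linear_zero bounded_linear_ident)
    show "(0, 0) + (0, x) \<in> dom c c" if "x \<in> chart_image c" for x
      using zero_in_dom[OF c that] by simp
  qed (use c open_dom open_image in blast)+
  then have sm: "smooth_on (chart_image c) (\<lambda>x. dir_deriv (fl c c) (0, x) (a, 0))" by simp
  show "smooth_on (chart_image c) (field_in c (vel a))"
    by (rule smooth_on_cong[OF open_image[OF c] _ sm]) (simp add: field_in_vel[OF c])
qed

text \<open>A move by \<open>s + t\<close> is a move by \<open>s\<close> after a move by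
  \<open>t\<close>, so a time derivative at any \<open>t\<close> is a velocity at the moved
  point.\<close>

lemma vel_along_orbit:
  assumes "d \<in> A" "(t, x) \<in> dom c d" "c \<in> A"
  shows "field_in d (vel a) (fl c d (t, x)) = dir_deriv (fl c d) (t, x) (a, 0)"
proof -
  let ?p = "chart_inv c x"
  have p: "act t ?p \<in> fst d" using assms by (simp add: dom_def)
  have "((\<lambda>s. s + t) has_derivative (\<lambda>h. h)) (at 0)" by (auto intro!: derivative_eq_intros)
  moreover have "((\<lambda>t. snd d (act t ?p)) has_derivative (\<lambda>a. dir_deriv (fl c d) (t, x) (a, 0))) (at (0 + t))"
    using fl_time_derivative[OF assms(3,1,2)] by simp
  ultimately have "((\<lambda>s. snd d (act (s + t) ?p)) has_derivative (\<lambda>a. dir_deriv (fl c d) (t, x) (a, 0))) (at 0)"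
    by (rule has_derivative_compose)
  then have "((\<lambda>s. snd d (act s (act t ?p))) has_derivative (\<lambda>a. dir_deriv (fl c d) (t, x) (a, 0))) (at 0)"
    by (simp add: act_add)
  from has_derivative_unique[OF orbit_map_derivative[OF assms(1) p] this]
  show ?thesis using assms p by (simp add: field_in_def fl_def fun_eq_iff)
qed

text \<open>Symmetry of the second derivatives of \<open>fl c c\<close>. A space direction
  \<open>w\<close> gives the derivative of the linearized action in time, a time direction that of
  the velocity along an orbit.\<close>

lemma fl_mixed_derivative:
  assumes c: "c \<in> A" and x: "x \<in> chart_image c"
  shows "((\<lambda>t. dir_deriv (fl c c) (t, x) w) has_derivative
    (\<lambda>a. dir_deriv (\<lambda>z. dir_deriv (fl c c) z (a, 0)) (0, x) w)) (at 0)"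
proof -
  have "((\<lambda>t. (t, x)) has_derivative (\<lambda>a. (a, 0))) (at 0)" by (auto intro!: derivative_eq_intros)
  moreover have "((\<lambda>z. dir_deriv (fl c c) z w) has_derivative dir_deriv (\<lambda>z. dir_deriv (fl c c) z w) (0, x)) (at (0, x))"
    by (rule smooth_on_has_derivative[OF smooth_on_dir_deriv[OF fl_smooth] open_dom zero_in_dom]) (rule c x)+
  ultimately have "((\<lambda>t. dir_deriv (fl c c) (t, x) w) has_derivative
    (\<lambda>a. dir_deriv (\<lambda>z. dir_deriv (fl c c) z w) (0, x) (a, 0))) (at 0)"
    by (rule has_derivative_compose)
  then show ?thesis
    by (simp only: smooth_on_dir_deriv_symmetric[OF fl_smooth[OF c c] open_dom[OF c c] zero_in_dom[OF c x], of w])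
qed

lemma fl_zero_space_derivative:
  assumes "c \<in> A" "x \<in> chart_image c"
  shows "dir_deriv (fl c c) (0, x) (0, u) = u"
proof -
  have "((snd c \<circ> act 0 \<circ> chart_inv c) has_derivative (\<lambda>u. u)) (at x)"
    by (rule has_derivative_transform_within_open[OF has_derivative_ident open_image[OF assms(1)] assms(2)])
      (use assms in simp)
  from has_derivative_unique[OF fl_space_derivative[OF assms(1,1) zero_in_dom[OF assms]] this]
  show ?thesis by (simp add: fun_eq_iff)
qed

lemma field_in_vel_derivative:
  assumes c: "c \<in> A" and x: "x \<in> chart_image c"
  shows "dir_deriv (field_in c (vel a)) x u = dir_deriv (\<lambda>z. dir_deriv (fl c c) z (a, 0)) (0, x) (0, u)"
proof -
  have "((\<lambda>x. (0, x)) has_derivative (\<lambda>u. (0, u))) (at x)" by (auto intro!: derivative_eq_intros)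
  moreover have "((\<lambda>z. dir_deriv (fl c c) z (a, 0)) has_derivative dir_deriv (\<lambda>z. dir_deriv (fl c c) z (a, 0)) (0, x)) (at (0, x))"
    by (rule smooth_on_has_derivative[OF smooth_on_dir_deriv[OF fl_smooth] open_dom zero_in_dom]) (rule c x)+
  ultimately have "((\<lambda>x. dir_deriv (fl c c) (0, x) (a, 0)) has_derivative
    (\<lambda>u. dir_deriv (\<lambda>z. dir_deriv (fl c c) z (a, 0)) (0, x) (0, u))) (at x)"
    by (rule has_derivative_compose)
  then have "(field_in c (vel a) has_derivative
    (\<lambda>u. dir_deriv (\<lambda>z. dir_deriv (fl c c) z (a, 0)) (0, x) (0, u))) (at x)"
    by (rule has_derivative_transform_within_open[OF _ open_image[OF c] x]) (simp add: field_in_vel[OF c])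
  from fun_cong[OF frechet_derivative_at[OF this], of u] show ?thesis by simp
qed

text \<open>Differentiating the field of \<open>a\<close> along the orbit of \<open>b\<close> gives
  the second time derivative of the action in the directions \<open>a\<close> and \<open>b\<close>,
  which is symmetric.\<close>

lemma vel_commuting: "commuting_fields (vel a) (vel b)"
  unfolding commuting_fields_def
proof (intro ballI)
  have gen: "dir_deriv (field_in c (vel a)) x (field_in c (vel b) x) = dir_deriv (\<lambda>z. dir_deriv (fl c c) z (b, 0)) (0, x) (a, 0)"
    if c: "c \<in> A" and x: "x \<in> chart_image c" for c x a b
  proof -
    obtain U where U: "open U" "0 \<in> U" "\<And>t. t \<in> U \<Longrightarrow> act t (chart_inv c x) \<in> fst c"
      using eventually_act_in[OF c chart_inv_in[OF c x]] by (auto simp: eventually_nhds)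
    have "(field_in c (vel a) has_derivative dir_deriv (field_in c (vel a)) x) (at x)"
      by (rule smooth_on_has_derivative[OF _ open_image x]) (use vel_smooth c in \<open>auto simp: smooth_vector_field_def\<close>)
    then have "(field_in c (vel a) has_derivative dir_deriv (field_in c (vel a)) x) (at (snd c (act 0 (chart_inv c x))))"
      using c x by simp
    from has_derivative_compose[OF orbit_map_derivative[OF c chart_inv_in[OF c x]] this]
    have "((\<lambda>t. field_in c (vel a) (snd c (act t (chart_inv c x)))) has_derivative
      (\<lambda>b. dir_deriv (field_in c (vel a)) x (vel b (chart_inv c x) c))) (at 0)" .
    then have "((\<lambda>t. dir_deriv (fl c c) (t, x) (a, 0)) has_derivative
      (\<lambda>b. dir_deriv (field_in c (vel a)) x (vel b (chart_inv c x) c))) (at 0)"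
      by (rule has_derivative_transform_within_open[OF _ U(1,2)])
        (use vel_along_orbit[OF c _ c] U(3) x in \<open>simp add: dom_def fl_def\<close>)
    from has_derivative_unique[OF this fl_mixed_derivative[OF c x]]
    show ?thesis by (simp add: fun_eq_iff field_in_def)
  qed
  fix c x assume cx: "c \<in> A" "x \<in> chart_image c"
  show "dir_deriv (field_in c (vel a)) x (field_in c (vel b) x) = dir_deriv (field_in c (vel b)) x (field_in c (vel a) x)"
    unfolding gen[OF cx]
    using smooth_on_dir_deriv_symmetric[OF fl_smooth[OF cx(1,1)] open_dom[OF cx(1,1)] zero_in_dom[OF cx], of "(b,0)" "(a,0)"] by simp
qed

lemma metric_preserved:
  assumes c: "c \<in> A" and x: "(t, x) \<in> dom c c"
  shows "metric_in A g c (fl c c (t, x)) (dir_deriv (fl c c) (t, x) (0, u)) (dir_deriv (fl c c) (t, x) (0, v)) = metric_in A g c x u v"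
proof -
  let ?q = "chart_inv c x"
  have q: "?q \<in> fst c" "act t ?q \<in> fst c" "snd c ?q = x"
    using x c chart_inv_in by (auto simp: dom_def)
  have "preserves_metric A g (act t)" using action by (simp add: isometric_torus_action_def act_def)
  then have "metric_in A g c (snd c (act t ?q)) (frechet_derivative (snd c \<circ> act t \<circ> chart_inv c) (at (snd c ?q)) u)
      (frechet_derivative (snd c \<circ> act t \<circ> chart_inv c) (at (snd c ?q)) v) = metric_in A g c (snd c ?q) u v"
    using c q(1,2) unfolding preserves_metric_def Let_def by blast
  moreover have "frechet_derivative (snd c \<circ> act t \<circ> chart_inv c) (at x) = (\<lambda>u. dir_deriv (fl c c) (t, x) (0, u))"
    using frechet_derivative_at[OF fl_space_derivative[OF c c x]] by simp
  moreover have "fl c c (t, x) = snd c (act t ?q)" by (simp add: fl_def)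
  ultimately show ?thesis using q(3) by simp
qed

text \<open>The derivative of \<open>metric_preserved\<close> at time 0.\<close>

lemma vel_killing: "killing_field A g (vel a)"
  unfolding killing_field_def
proof (intro conjI vel_smooth allI ballI impI)
  fix p V W c assume c: "c \<in> A" and p: "p \<in> fst c"
  define x where "x = snd c p"
  have x: "x \<in> chart_image c" "chart_inv c x = p" using c p by (auto simp: x_def chart_in_image)
  interpret local_metric "chart_image c" "metric_in A g c" by (rule chart_local_metric[OF c])
  have "lie_deriv_local (metric_in A g c) (field_in c (vel a)) x u v = 0" for u v
  proof -
    obtain U where U: "open U" "0 \<in> U" "\<And>t. t \<in> U \<Longrightarrow> act t p \<in> fst c"
      using eventually_act_in[OF c p] by (auto simp: eventually_nhds)
    have Udom: "(t, x) \<in> dom c c" if "t \<in> U" for t using U(3)[OF that] x by (simp add: dom_def)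
    have fl_im: "fl c c (t, x) \<in> chart_image c" if "t \<in> U" for t
      using U(3)[OF that] x by (simp add: fl_def chart_in_image)
    have fl0: "fl c c (0, x) = x" using c x p by (simp add: fl_def x_def)
    have fld: "((\<lambda>t. fl c c (t, x)) has_derivative (\<lambda>a. field_in c (vel a) x)) (at 0)"
      using orbit_map_derivative[OF c p] x by (simp add: fl_def field_in_def)
    have Gd: "((\<lambda>t. metric_in A g c (fl c c (t, x)) u v) has_derivative (\<lambda>a. dG x (field_in c (vel a) x) u v)) (at 0)" for u v
      using has_derivative_compose[OF fld, of "\<lambda>y. metric_in A g c y u v" "\<lambda>h. dG x h u v"] G_der[OF x(1)] fl0 by simp
    let ?u = "\<lambda>w t. dir_deriv (fl c c) (t, x) (0, w)"
    let ?u' = "\<lambda>w a. dir_deriv (\<lambda>z. dir_deriv (fl c c) z (a, 0)) (0, x) (0, w)"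
    \<comment> \<open>The parameter of the bilinear form is now the time: base point and both
      vectors move with \<open>t\<close>.\<close>
    have D: "((\<lambda>t. metric_in A g c (fl c c (t, x)) (?u u t) (?u v t)) has_derivative
      (\<lambda>h. dir_deriv (\<lambda>t. metric_in A g c (fl c c (t, x)) (?u u 0) (?u v 0)) 0 h
         + metric_in A g c (fl c c (0, x)) (?u' u h) (?u v 0) + metric_in A g c (fl c c (0, x)) (?u u 0) (?u' v h))) (at 0)"
      by (rule bilinear_field_has_derivative[where B="\<lambda>t. metric_in A g c (fl c c (t, x))", OF U(1,2) bilin[OF fl_im] _
            fl_mixed_derivative[OF c x(1)] fl_mixed_derivative[OF c x(1)]])
        (use Gd in \<open>auto simp: differentiable_def\<close>)
    have "((\<lambda>t. metric_in A g c (fl c c (t, x)) (?u u t) (?u v t)) has_derivative (\<lambda>h. 0)) (at 0)"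
      by (rule has_derivative_transform_within_open[OF has_derivative_const U(1,2)])
        (simp add: metric_preserved[OF c Udom])
    from fun_cong[OF has_derivative_unique[OF D this], of a]
    have "dir_deriv (\<lambda>t. metric_in A g c (fl c c (t, x)) u v) 0 a
      + metric_in A g c x (?u' u a) v + metric_in A g c x u (?u' v a) = 0"
      by (simp add: fl0 fl_zero_space_derivative[OF c x(1)])
    moreover have "dir_deriv (\<lambda>t. metric_in A g c (fl c c (t, x)) u v) 0 a = dG x (field_in c (vel a) x) u v"
      using fun_cong[OF frechet_derivative_at[OF Gd[of u v]], of a] by simp
    ultimately show ?thesis
      by (simp add: lie_deriv_local_def dG_def field_in_vel_derivative[OF c x(1)])
  qed
  then show "lie_deriv A g (vel a) c p V W = 0" by (simp add: lie_deriv_def x_def)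
qed

end

section \<open>Tori and their subtori\<close>

text \<open>In base \<open>N\<close>, multiplication by \<open>N ^ i\<close> shifts the digits of
  \<open>t\<close>, so its fractional part begins with the digit of index \<open>i\<close>. Matching
  that digit to \<open>s i\<close> costs at most \<open>1 / N\<close>, for all \<open>i\<close> at
  once.\<close>

lemma simultaneous_digit_approximation:
  fixes N :: nat and s :: "nat \<Rightarrow> real"
  assumes "N > 0"
  shows "\<exists>t. 0 \<le> t \<and> t < 1 \<and> (\<forall>i<k. \<exists>m::int. \<bar>real N ^ i * t - s i - of_int m\<bar> \<le> 1 / real N)"
proof (induction k arbitrary: s)
  case 0
  show ?case by (rule exI[of _ 0]) simp
next
  case (Suc k)
  obtain t where t: "0 \<le> t" "t < 1" "\<And>i. i < k \<Longrightarrow> \<exists>m::int. \<bar>real N ^ i * t - s (Suc i) - of_int m\<bar> \<le> 1 / real N"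
    using Suc.IH[of "\<lambda>i. s (Suc i)"] by blast
  define d where "d = \<lfloor>real N * frac (s 0)\<rfloor>"
  \<comment> \<open>Puts the leading digit \<open>d\<close> of the fractional part of
    \<open>s 0\<close> in front of the expansion that serves the shifted sequence.\<close>
  define t' where "t' = (of_int d + t) / real N"
  have N: "real N > 0" using assms by simp
  have d0: "d \<ge> 0" by (simp add: d_def)
  have "real N * frac (s 0) < real N" using N frac_lt_1[of "s 0"] by simp
  then have "d < int N" unfolding d_def by (simp add: floor_less_iff)
  then have d1: "of_int d + 1 \<le> real N" by linarith
  have dl: "of_int d \<le> real N * frac (s 0)" "real N * frac (s 0) < of_int d + 1"
    unfolding d_def by linarith+
  have "\<exists>m::int. \<bar>real N ^ i * t' - s i - of_int m\<bar> \<le> 1 / real N" if i: "i < Suc k" for i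
  proof (cases i)
    case 0
    have "real N * \<bar>t' - frac (s 0)\<bar> = \<bar>real N * t' - real N * frac (s 0)\<bar>"
      using N by (simp add: abs_mult flip: right_diff_distrib)
    also have "\<dots> = \<bar>of_int d + t - real N * frac (s 0)\<bar>" using N by (simp add: t'_def)
    also have "\<dots> \<le> 1" using dl t by linarith
    finally have "\<bar>t' - frac (s 0)\<bar> \<le> 1 / real N" using N by (simp add: field_simps)
    then show ?thesis unfolding 0 by (intro exI[of _ "- \<lfloor>s 0\<rfloor>"]) (simp add: frac_def)
  next
    case (Suc j)
    then obtain m :: int where m: "\<bar>real N ^ j * t - s (Suc j) - of_int m\<bar> \<le> 1 / real N"
      using t(3)[of j] i by auto
    have "real N ^ Suc j * t' = real N ^ j * of_int d + real N ^ j * t"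
      using N by (simp add: t'_def field_simps)
    then have "real N ^ i * t' - s i - of_int (m + int N ^ j * d) = real N ^ j * t - s (Suc j) - of_int m"
      unfolding Suc by simp
    then show ?thesis using m by metis
  qed
  moreover have "0 \<le> t'" "t' < 1" using d0 d1 t N by (auto simp: t'_def field_simps)
  ultimately show ?case by blast
qed

text \<open>Distinct elements differ by at least \<open>d\<close>. With \<open>n\<close> least such
  that a positive element lies below \<open>n * d\<close>, two positive elements below that bound
  are less than \<open>d\<close> apart and hence equal; this element is the generator.\<close>

lemma discrete_subgroup_real:
  fixes T :: "real set"
  assumes add: "\<And>x y. x \<in> T \<Longrightarrow> y \<in> T \<Longrightarrow> x + y \<in> T" and minus: "\<And>x. x \<in> T \<Longrightarrow> - x \<in> T"
    and d: "d > 0" "\<And>x. x \<in> T \<Longrightarrow> 0 < \<bar>x\<bar> \<Longrightarrow> d \<le> \<bar>x\<bar>" and x: "x \<in> T" "x \<noteq> 0"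
  shows "\<exists>\<tau>\<in>T. \<tau> > 0 \<and> (\<forall>y\<in>T. \<exists>n::int. y = of_int n * \<tau>)"
proof -
  define P where "P n \<longleftrightarrow> (\<exists>y\<in>T. 0 < y \<and> y < real n * d)" for n
  have "\<bar>x\<bar> \<in> T" using x minus by (auto simp: abs_if)
  moreover obtain n where "\<bar>x\<bar> < real n * d" using d(1) reals_Archimedean3 by blast
  ultimately have "\<exists>n. P n" using x unfolding P_def by (metis zero_less_abs_iff)
  then have LP: "P (LEAST n. P n)" by (rule LeastI_ex)
  define n0 where "n0 = (LEAST n. P n)"
  obtain \<tau> where \<tau>: "\<tau> \<in> T" "0 < \<tau>" "\<tau> < real n0 * d" using LP unfolding P_def n0_def by blast
  then have "n0 \<noteq> 0" by (intro notI) simp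
  then obtain n1 where n1: "n0 = Suc n1" by (cases n0) auto
  have least: "\<tau> \<le> y" if y: "y \<in> T" "0 < y" for y
  proof (rule ccontr)
    assume "\<not> \<tau> \<le> y"
    have "\<not> P n1" using not_less_Least[of n1 P] n1 unfolding n0_def by simp
    then have "real n1 * d \<le> y" using y unfolding P_def by (meson not_le)
    then have "\<bar>\<tau> - y\<bar> < d" "0 < \<bar>\<tau> - y\<bar>" using \<tau>(3) n1 \<open>\<not> \<tau> \<le> y\<close> by (auto simp: algebra_simps)
    moreover have "\<tau> - y \<in> T" using add[OF \<tau>(1) minus[OF y(1)]] by simp
    ultimately show False using d(2)[of "\<tau> - y"] by linarith
  qed
  have mult: "of_nat n * \<tau> \<in> T" for n
  proof (induction n)
    case 0
    show ?case using add[OF \<tau>(1) minus[OF \<tau>(1)]] by simp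
  next
    case (Suc n)
    then show ?case using add[OF \<tau>(1) Suc] by (simp add: algebra_simps)
  qed
  have imult: "of_int n * \<tau> \<in> T" for n :: int
  proof (cases "n \<ge> 0")
    case True
    then show ?thesis using mult[of "nat n"] by simp
  next
    case False
    then show ?thesis using minus[OF mult[of "nat (- n)"]] by simp
  qed
  have "\<exists>n::int. y = of_int n * \<tau>" if y: "y \<in> T" for y
  proof -
    define n where "n = \<lfloor>y / \<tau>\<rfloor>"
    have b: "of_int n * \<tau> \<le> y" "y < (of_int n + 1) * \<tau>"
      using \<tau>(2) unfolding n_def by (simp_all add: floor_divide_lower floor_divide_upper)
    have "y - of_int n * \<tau> \<in> T" using add[OF y minus[OF imult[of n]]] by simp
    moreover have "y - of_int n * \<tau> < \<tau>" "0 \<le> y - of_int n * \<tau>" using b by (auto simp: algebra_simps)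
    ultimately have "y - of_int n * \<tau> = 0" using least[of "y - of_int n * \<tau>"] by linarith
    then show ?thesis by auto
  qed
  then show ?thesis using \<tau> by blast
qed

text \<open>The elementary automorphism \<open>z\<^sub>i \<mapsto> z\<^sub>i z\<^sub>j\<^sup>\<plusminus>\<^sup>1\<close> transforms the exponent vector \<open>m\<close> of a character
  by a step of Euclid's algorithm.\<close>

lemma codim_one_subtorus_in_character_kernel:
  fixes m :: "'k::finite \<Rightarrow> int"
  shows "\<exists>H :: (complex ^ 'k) set. codim_one_subtorus H \<and>
    (\<forall>z\<in>H. \<exists>b. torus_exp b = z \<and> (\<Sum>i\<in>UNIV. of_int (m i) * b $ i) \<in> \<int>)"
proof -
  have "\<exists>(I :: 'k set) (h :: complex ^ 'k \<Rightarrow> complex ^ 'k). card I + 1 = CARD('k) \<and> h \<in> hom (torus I) (torus UNIV) \<and>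
      continuous_on (carrier (torus I)) h \<and> inj_on h (carrier (torus I)) \<and>
      (\<forall>w\<in>carrier (torus I). \<exists>b. torus_exp b = h w \<and> (\<Sum>i\<in>UNIV. of_int (m i) * b $ i) \<in> \<int>)"
  proof (induction "nat (\<Sum>i\<in>UNIV. \<bar>m i\<bar>)" arbitrary: m rule: less_induct)
    case less
    show ?case
    proof (cases "\<exists>i0. \<forall>i. i \<noteq> i0 \<longrightarrow> m i = 0")
      case True
      then obtain i0 where i0: "\<And>i. i \<noteq> i0 \<Longrightarrow> m i = 0" by blast
      \<comment> \<open>The character depends on the coordinate \<open>i0\<close> alone, hence is
        trivial where that coordinate is 1.\<close>
      let ?I = "UNIV - {i0}"
      have "card ?I + 1 = CARD('k)" by (simp add: card_Diff_singleton)
      moreover have sub: "w \<in> carrier (torus UNIV) \<and> w $ i0 = 1" if "w \<in> carrier (torus ?I)" for w :: "complex ^ 'k"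
      proof -
        have "if i \<in> ?I then cmod (w $ i) = 1 else w $ i = 1" for i using that by (simp add: torus_def)
        then have "cmod (w $ i) = 1" "w $ i0 = 1" for i by (cases "i = i0"; force)+
        then show ?thesis by (simp add: torus_def)
      qed
      have hom: "(\<lambda>w. w) \<in> hom (torus ?I) (torus UNIV)"
        unfolding hom_def using sub by (auto simp: torus_def)
      moreover have "\<exists>b. torus_exp b = w \<and> (\<Sum>i\<in>UNIV. of_int (m i) * b $ i) \<in> \<int>"
        if w: "w \<in> carrier (torus ?I)" for w
      proof -
        obtain b where b: "torus_exp b = w" using torus_exp_surj sub[OF w] by blast
        then have "cis (2 * pi * b $ i0) = 1" using sub[OF w] by (auto simp: torus_exp_def)
        then have "torus_exp (\<chi> i. b $ i0) = (1 :: complex ^ 'k)" by (simp add: torus_exp_def vec_eq_iff one_vec_def)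
        then have "b $ i0 \<in> \<int>" by (simp add: torus_exp_eq_1_iff)
        moreover have "(\<Sum>i\<in>UNIV. of_int (m i) * b $ i) = of_int (m i0) * b $ i0"
          using i0 by (subst sum.remove[of _ i0]) (auto intro!: sum.neutral)
        ultimately have "(\<Sum>i\<in>UNIV. of_int (m i) * b $ i) \<in> \<int>" by simp
        then show ?thesis using b by blast
      qed
      ultimately show ?thesis
        by (intro exI[of _ ?I] exI[of _ "\<lambda>w. w"]) (auto intro: continuous_on_id)
    next
      case False
      then have "\<exists>i j. i \<noteq> j \<and> m i \<noteq> 0 \<and> m j \<noteq> 0 \<and> \<bar>m i\<bar> \<le> \<bar>m j\<bar>" by (metis linear)
      then obtain i j where ij: "i \<noteq> j" "m i \<noteq> 0" "m j \<noteq> 0" "\<bar>m i\<bar> \<le> \<bar>m j\<bar>" by blast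
      \<comment> \<open>The sign for which \<open>m j + e * m i\<close> is smaller than
        \<open>m j\<close> in absolute value.\<close>
      define e :: int where "e = (if (m i > 0) = (m j > 0) then -1 else 1)"
      define m' where "m' = m(j := m j + e * m i)"
      have lt: "\<bar>m' j\<bar> < \<bar>m j\<bar>" using ij by (auto simp: m'_def e_def)
      have "(\<Sum>l\<in>UNIV. \<bar>m' l\<bar>) = \<bar>m' j\<bar> + (\<Sum>l\<in>UNIV - {j}. \<bar>m' l\<bar>)" by (rule sum.remove) auto
      also have "(\<Sum>l\<in>UNIV - {j}. \<bar>m' l\<bar>) = (\<Sum>l\<in>UNIV - {j}. \<bar>m l\<bar>)"
        by (rule sum.cong) (auto simp: m'_def)
      also have "\<bar>m' j\<bar> + \<dots> < \<bar>m j\<bar> + (\<Sum>l\<in>UNIV - {j}. \<bar>m l\<bar>)" using lt by simp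
      also have "\<dots> = (\<Sum>l\<in>UNIV. \<bar>m l\<bar>)" by (rule sum.remove[symmetric]) auto
      finally have sum_lt: "(\<Sum>l\<in>UNIV. \<bar>m' l\<bar>) < (\<Sum>l\<in>UNIV. \<bar>m l\<bar>)" .
      moreover have "0 \<le> (\<Sum>l\<in>UNIV. \<bar>m' l\<bar>)" by (rule sum_nonneg) simp
      ultimately have "nat (\<Sum>l\<in>UNIV. \<bar>m' l\<bar>) < nat (\<Sum>l\<in>UNIV. \<bar>m l\<bar>)" by linarith
      from less.hyps[OF this] obtain I and h :: "complex ^ 'k \<Rightarrow> complex ^ 'k" where
        I: "card I + 1 = CARD('k)" and h: "h \<in> hom (torus I) (torus UNIV)"
        "continuous_on (carrier (torus I)) h" "inj_on h (carrier (torus I))"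
        and hb: "\<And>w. w \<in> carrier (torus I) \<Longrightarrow> \<exists>b. torus_exp b = h w \<and> (\<Sum>i\<in>UNIV. of_int (m' i) * b $ i) \<in> \<int>"
        by blast
      \<comment> \<open>On the unit circle conjugation is inversion, so this is the power with
        exponent \<open>e\<close>, in a form continuous on the whole plane.\<close>
      define c :: "complex \<Rightarrow> complex" where "c z = (if e = 1 then z else cnj z)" for z
      define E :: "complex ^ 'k \<Rightarrow> complex ^ 'k" where "E z = (\<chi> l. if l = i then z $ i * c (z $ j) else z $ l)" for z
      have c: "c (x * y) = c x * c y" "cmod (c x) = cmod x" for x y by (auto simp: c_def)
      have Ehom: "E (x * y) = E x * E y" for x y by (simp add: E_def vec_eq_iff c)
      have hc: "cmod (h w $ l) = 1" if "w \<in> carrier (torus I)" for w l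
        using hom_in_carrier[OF h(1) that] by (simp add: torus_def)
      have Ecar: "cmod (E (h w) $ l) = 1" if "w \<in> carrier (torus I)" for w l
        using hc[OF that] by (simp add: E_def norm_mult c)
      have "E \<circ> h \<in> hom (torus I) (torus UNIV)"
        using h(1) Ecar unfolding hom_def by (auto simp: torus_def Ehom)
      moreover have "continuous_on (carrier (torus I)) (E \<circ> h)"
      proof (rule continuous_on_compose[OF h(2)])
        have "continuous_on S c" for S unfolding c_def by (cases "e = 1") (auto intro!: continuous_intros)
        then have c': "continuous_on S (\<lambda>z. c (z $ j))" for S :: "(complex ^ 'k) set"
          by (intro continuous_on_compose2[of UNIV c S "\<lambda>z. z $ j"]) (auto intro!: continuous_intros)
        show "continuous_on (h ` carrier (torus I)) E"
          unfolding E_def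
        proof (intro continuous_on_vec_lambda)
          show "continuous_on (h ` carrier (torus I)) (\<lambda>x. if l = i then x $ i * c (x $ j) else x $ l)" for l
            by (cases "l = i") (auto intro!: continuous_intros c')
        qed
      qed
      moreover have "inj_on (E \<circ> h) (carrier (torus I))"
      proof (rule comp_inj_on[OF h(3)], rule inj_onI)
        fix x y assume xy: "x \<in> h ` carrier (torus I)" "y \<in> h ` carrier (torus I)" "E x = E y"
        have l: "E x $ l = E y $ l" for l using xy(3) by simp
        have xl: "x $ l = y $ l" if "l \<noteq> i" for l using l[of l] that by (simp add: E_def)
        have "cmod (y $ j) = 1" using xy(2) hc by auto
        then have "c (y $ j) \<noteq> 0" using c(2)[of "y $ j"] by (metis norm_zero zero_neq_one)
        moreover have "x $ i * c (y $ j) = y $ i * c (y $ j)"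
          using l[of i] xl[of j] ij(1) by (simp add: E_def)
        ultimately have "x $ i = y $ i" by simp
        then show "x = y" using xl by (metis vec_eq_iff)
      qed
      moreover have "\<exists>b. torus_exp b = (E \<circ> h) w \<and> (\<Sum>l\<in>UNIV. of_int (m l) * b $ l) \<in> \<int>"
        if w: "w \<in> carrier (torus I)" for w
      proof -
        obtain b where b: "torus_exp b = h w" "(\<Sum>l\<in>UNIV. of_int (m' l) * b $ l) \<in> \<int>" using hb[OF w] by blast
        define b' where "b' = (\<chi> l. if l = i then b $ i + of_int e * b $ j else b $ l)"
        have ccis: "c (cis x) = cis (of_int e * x)" for x by (auto simp: c_def e_def cis_cnj)
        have "torus_exp b' = E (torus_exp b)"
          unfolding vec_eq_iff
        proof
          fix l
          show "torus_exp b' $ l = E (torus_exp b) $ l"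
            by (cases "l = i") (simp_all add: torus_exp_def b'_def E_def ccis cis_mult algebra_simps)
        qed
        moreover have "(\<Sum>l\<in>UNIV. of_int (m l) * b' $ l) = (\<Sum>l\<in>UNIV. of_int (m' l) * b $ l)"
        proof -
          have "(\<Sum>l\<in>UNIV. of_int (m l) * b' $ l) = (\<Sum>l\<in>UNIV. of_int (m l) * b $ l + (if l = i then of_int (m i) * (of_int e * b $ j) else 0))"
            by (rule sum.cong) (auto simp: b'_def algebra_simps)
          also have "\<dots> = (\<Sum>l\<in>UNIV. of_int (m l) * b $ l) + of_int (m i) * (of_int e * b $ j)"
            by (simp add: sum.distrib)
          also have "\<dots> = (\<Sum>l\<in>UNIV. of_int (m l) * b $ l + (if l = j then of_int (m i) * (of_int e * b $ j) else 0))"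
            by (simp add: sum.distrib)
          also have "\<dots> = (\<Sum>l\<in>UNIV. of_int (m' l) * b $ l)"
            by (rule sum.cong) (auto simp: m'_def algebra_simps)
          finally show ?thesis .
        qed
        ultimately show ?thesis using b by (intro exI[of _ b']) simp
      qed
      ultimately show ?thesis using I by (intro exI[of _ I] exI[of _ "E \<circ> h"]) blast
    qed
  qed
  then obtain I :: "'k set" and h :: "complex ^ 'k \<Rightarrow> complex ^ 'k" where I: "card I + 1 = CARD('k)"
    and h: "h \<in> hom (torus I) (torus UNIV)" "continuous_on (carrier (torus I)) h" "inj_on h (carrier (torus I))"
    and b: "\<forall>w\<in>carrier (torus I). \<exists>b. torus_exp b = h w \<and> (\<Sum>i\<in>UNIV. of_int (m i) * b $ i) \<in> \<int>"
    by blast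
  have grp: "Group.group (torus J)" for J :: "'k set"
  proof (rule groupI)
    fix x assume x: "x \<in> carrier (torus J)"
    define y where "y = (\<chi> i. cnj (x $ i))"
    have "y $ i * x $ i = 1" for i
    proof -
      have "cmod (x $ i) = 1" using x by (auto simp: torus_def split: if_splits dest: spec[of _ i])
      then show ?thesis by (simp add: y_def mult.commute[of "cnj _"] complex_norm_square[symmetric])
    qed
    then have "y * x = 1" by (simp add: vec_eq_iff one_vec_def)
    moreover have "y \<in> carrier (torus J)" using x by (auto simp: torus_def y_def)
    ultimately show "\<exists>y\<in>carrier (torus J). y \<otimes>\<^bsub>torus J\<^esub> x = \<one>\<^bsub>torus J\<^esub>"
      by (intro bexI[of _ y]) (simp_all add: torus_def)
  qed (auto simp: torus_def norm_mult mult.assoc)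
  interpret group_hom "torus I" "torus UNIV" h
    using grp h(1) by (simp add: group_hom_def group_hom_axioms_def)
  have "subgroup (h ` carrier (torus I)) (torus UNIV)" by (rule img_is_subgroup)
  then have "codim_one_subtorus (h ` carrier (torus I))"
    unfolding codim_one_subtorus_def using I h by blast
  then show ?thesis using b by blast
qed

section \<open>Stabilizers\<close>

context torus_action
begin

lemma vel_linear: "d \<in> A \<Longrightarrow> p \<in> fst d \<Longrightarrow> linear (\<lambda>a. vel a p d)"
  using has_derivative_linear[OF orbit_map_derivative] .

lemma vel_zero_iff:
  assumes "d \<in> A" "p \<in> fst d"
  shows "vel a p = (\<lambda>_. 0) \<longleftrightarrow> vel a p d = 0"
  using tangent_eqI[OF assms vel_in_tangent_space zero_in_tangent_space] by auto

lemma vel_eq_scaleR_iff: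
  assumes "d \<in> A" "p \<in> fst d"
  shows "vel b p = (\<lambda>e. r *\<^sub>R vel a p e) \<longleftrightarrow> vel b p d = r *\<^sub>R vel a p d"
  using tangent_eqI[OF assms vel_in_tangent_space scaleR_in_tangent_space[OF vel_in_tangent_space]] by auto

lemma vel_diff_zero_iff:
  "vel (b - r *\<^sub>R a) p = (\<lambda>_. 0) \<longleftrightarrow> vel b p = (\<lambda>e. r *\<^sub>R vel a p e)"
proof -
  obtain d where d: "d \<in> A" "p \<in> fst d" by (rule ex_chart)
  show ?thesis
    using linear_diff[OF vel_linear[OF d]] linear_cmul[OF vel_linear[OF d]]
    by (simp add: vel_zero_iff[OF d] vel_eq_scaleR_iff[OF d])
qed

lemma curve_derivative:
  assumes "d \<in> A" "p \<in> fst d"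
  shows "((\<lambda>\<tau>. snd d (act (\<tau> *\<^sub>R a) p)) has_vector_derivative vel a p d) (at 0)"
proof -
  have "((\<lambda>\<tau>. \<tau> *\<^sub>R a) has_derivative (\<lambda>h. h *\<^sub>R a)) (at 0)" by (auto intro!: derivative_eq_intros)
  moreover have "((\<lambda>t. snd d (act t p)) has_derivative (\<lambda>a. vel a p d)) (at (0 *\<^sub>R a))"
    using orbit_map_derivative[OF assms] by simp
  ultimately have "((\<lambda>\<tau>. snd d (act (\<tau> *\<^sub>R a) p)) has_derivative (\<lambda>h. vel (h *\<^sub>R a) p d)) (at 0)"
    by (rule has_derivative_compose)
  then show ?thesis
    unfolding has_vector_derivative_def using linear_cmul[OF vel_linear[OF assms]] by simp
qed

lemma act_multiple:
  assumes "act s p = p"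
  shows "act (real n *\<^sub>R s) p = p"
proof (induction n)
  case (Suc n)
  have "act (real (Suc n) *\<^sub>R s) p = act s (act (real n *\<^sub>R s) p)"
    by (simp add: scaleR_add_left flip: act_add)
  then show ?case using Suc assms by simp
qed simp

text \<open>By the group law the velocity at time \<tau> is the image of that at time 0 under a
  differential, hence zero, so the curve is constant for short times. Multiples of short times reach
  all others.\<close>

lemma fixed_if_vel_zero:
  assumes "vel a p = (\<lambda>_. 0)"
  shows "act (\<tau> *\<^sub>R a) p = p"
proof -
  obtain d where d: "d \<in> A" "p \<in> fst d" by (rule ex_chart)
  define x where "x = snd d p"
  have x: "x \<in> chart_image d" "chart_inv d x = p" using d by (auto simp: x_def chart_in_image)
  have "continuous_on UNIV (\<lambda>\<tau>. act (\<tau> *\<^sub>R a) p)" by (intro continuous_act_compose continuous_intros)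
  then have "open ((\<lambda>\<tau>. act (\<tau> *\<^sub>R a) p) -` fst d)"
    using open_domain[OF d(1)] by (simp add: continuous_on_open_vimage)
  then obtain e where e: "e > 0" "\<And>\<tau>. \<bar>\<tau>\<bar> < e \<Longrightarrow> act (\<tau> *\<^sub>R a) p \<in> fst d"
    using d(2) unfolding open_contains_ball by (auto simp: subset_iff dist_norm dest: bspec[of _ _ 0])
  let ?h = "\<lambda>\<tau>. snd d (act (\<tau> *\<^sub>R a) p)"
  have der: "(?h has_vector_derivative 0) (at \<tau>)" if "\<bar>\<tau>\<bar> < e" for \<tau>
  proof -
    have dm: "(\<tau> *\<^sub>R a, x) \<in> dom d d" using e(2)[OF that] x by (simp add: dom_def)
    have z: "vel a p d = 0" using assms by simp
    have "((\<lambda>s. snd d (act (s *\<^sub>R a) p)) has_derivative (\<lambda>h. 0)) (at 0)"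
      using curve_derivative[OF d, of a] unfolding z has_vector_derivative_def by simp
    moreover have "((snd d \<circ> act (\<tau> *\<^sub>R a) \<circ> chart_inv d) has_derivative (\<lambda>u. dir_deriv (fl d d) (\<tau> *\<^sub>R a, x) (0, u))) (at (snd d (act (0 *\<^sub>R a) p)))"
      using fl_space_derivative[OF d(1,1) dm] by (simp add: x_def)
    ultimately have "((\<lambda>s. (snd d \<circ> act (\<tau> *\<^sub>R a) \<circ> chart_inv d) (snd d (act (s *\<^sub>R a) p))) has_derivative
      (\<lambda>h. dir_deriv (fl d d) (\<tau> *\<^sub>R a, x) (0, 0))) (at 0)" by (rule has_derivative_compose)
    moreover have "dir_deriv (fl d d) (\<tau> *\<^sub>R a, x) (0, 0) = 0"
      using linear_0[OF has_derivative_linear[OF fl_has_derivative[OF d(1,1) dm]]] by (simp add: zero_prod_def)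
    ultimately have D0: "((\<lambda>s. (snd d \<circ> act (\<tau> *\<^sub>R a) \<circ> chart_inv d) (snd d (act (s *\<^sub>R a) p))) has_derivative (\<lambda>h. 0)) (at 0)"
      by simp
    have "((\<lambda>s. snd d (act (\<tau> *\<^sub>R a) (act (s *\<^sub>R a) p))) has_derivative (\<lambda>h. 0)) (at 0)"
      by (rule has_derivative_transform_within_open[OF D0, of "{-e<..<e}"]) (use e d in auto)
    then have "((\<lambda>s. ?h (s + \<tau>)) has_derivative (\<lambda>h. 0)) (at (\<tau> - \<tau>))"
      by (simp add: scaleR_add_left add.commute[of _ "\<tau> *\<^sub>R a"] flip: act_add)
    then have "((\<lambda>s. ?h (s + \<tau>)) \<circ> (\<lambda>s. s - \<tau>) has_derivative (\<lambda>h. 0) \<circ> (\<lambda>h. h)) (at \<tau>)"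
      by (intro diff_chain_at) (auto intro!: derivative_eq_intros)
    then show ?thesis by (simp add: has_vector_derivative_def comp_def)
  qed
  have loc: "act (\<tau> *\<^sub>R a) p = p" if t: "\<bar>\<tau>\<bar> < e" for \<tau>
  proof -
    have "(?h has_vector_derivative 0) (at x within {-e<..<e})" if "x \<in> {-e<..<e}" for x
      by (rule has_vector_derivative_at_within[OF der]) (use that in auto)
    then obtain c where "\<And>x. x \<in> {-e<..<e} \<Longrightarrow> ?h x = c"
      using has_vector_derivative_zero_constant[of "{-e<..<e}" ?h] by blast
    then have c: "?h x = c" if "\<bar>x\<bar> < e" for x using that by (simp add: abs_less_iff)
    have "?h \<tau> = ?h 0" using c[of 0] c[OF t] e by simp
    then have "chart_inv d (?h \<tau>) = chart_inv d (?h 0)" by simp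
    then show ?thesis using d e(2)[OF t] by simp
  qed
  obtain n :: nat where n: "\<bar>\<tau>\<bar> / e < real n" using reals_Archimedean2 by blast
  moreover have "0 \<le> \<bar>\<tau>\<bar> / e" using e(1) by simp
  ultimately have n0: "real n > 0" by linarith
  have "\<bar>\<tau> / real n\<bar> < e" using n n0 e(1) by (simp add: field_simps)
  from act_multiple[OF loc[OF this], of n] n0 show ?thesis by simp
qed

lemma vel_zero_if_fixed:
  assumes "\<And>\<tau>. act (\<tau> *\<^sub>R a) p = p"
  shows "vel a p = (\<lambda>_. 0)"
proof -
  obtain d where d: "d \<in> A" "p \<in> fst d" by (rule ex_chart)
  have "((\<lambda>\<tau>. snd d p) has_vector_derivative vel a p d) (at 0)"
    using curve_derivative[OF d, of a] by (simp only: assms)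
  then have "vel a p d = 0" using vector_derivative_unique_at[OF _ has_vector_derivative_const] by blast
  then show ?thesis using vel_zero_iff[OF d] by blast
qed

text \<open>At a return time the error quotient of the first-order expansion equals the norm of the
  velocity, although it tends to 0.\<close>

lemma stabilizer_discrete:
  assumes "vel a p \<noteq> (\<lambda>_. 0)"
  shows "\<exists>e>0. \<forall>\<tau>. 0 < \<bar>\<tau>\<bar> \<and> \<bar>\<tau>\<bar> < e \<longrightarrow> act (\<tau> *\<^sub>R a) p \<noteq> p"
proof -
  obtain d where d: "d \<in> A" "p \<in> fst d" by (rule ex_chart)
  have v: "vel a p d \<noteq> 0" using assms vel_zero_iff[OF d] by blast
  have "((\<lambda>\<tau>. norm (snd d (act ((0 + \<tau>) *\<^sub>R a) p) - snd d (act (0 *\<^sub>R a) p) - \<tau> *\<^sub>R vel a p d) / norm \<tau>) \<longlongrightarrow> 0) (at 0)"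
    using curve_derivative[OF d, of a] unfolding has_vector_derivative_def has_derivative_at by blast
  then have "\<forall>\<^sub>F \<tau> in at 0. norm (snd d (act ((0 + \<tau>) *\<^sub>R a) p) - snd d (act (0 *\<^sub>R a) p) - \<tau> *\<^sub>R vel a p d) / norm \<tau> < norm (vel a p d)"
    by (rule order_tendstoD) (use v in simp)
  then obtain e where e: "e > 0" "\<And>\<tau>. \<tau> \<noteq> 0 \<Longrightarrow> \<bar>\<tau>\<bar> < e \<Longrightarrow>
      norm (snd d (act ((0 + \<tau>) *\<^sub>R a) p) - snd d (act (0 *\<^sub>R a) p) - \<tau> *\<^sub>R vel a p d) / norm \<tau> < norm (vel a p d)"
    by (auto simp: eventually_at dist_norm)
  have "act (\<tau> *\<^sub>R a) p \<noteq> p" if "0 < \<bar>\<tau>\<bar>" "\<bar>\<tau>\<bar> < e" for \<tau>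
  proof
    assume "act (\<tau> *\<^sub>R a) p = p"
    then show False using e(2)[of \<tau>] that by simp
  qed
  then show ?thesis using e(1) by blast
qed

lemma act_tendsto:
  assumes "(s \<longlongrightarrow> s0) F" "(q \<longlongrightarrow> q0) F"
  shows "((\<lambda>n. act (s n) (q n)) \<longlongrightarrow> act s0 q0) F"
proof -
  have "((\<lambda>n. (\<lambda>(t, p). act t p) (s n, q n)) \<longlongrightarrow> (\<lambda>(t, p). act t p) (s0, q0)) F"
    by (rule continuous_on_tendsto_compose[OF continuous_act[of UNIV] tendsto_Pair[OF assms]]) auto
  then show ?thesis by simp
qed

lemma act_diff_integral:
  assumes "\<And>i. m $ i \<in> \<int>"
  shows "act (t - m) p = act t p" "act (t + m) p = act t p"
proof -
  have "act (- m) p = p" by (rule act_integral) (use assms in auto)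
  then show "act (t - m) p = act t p" using act_add[of t "- m" p] by simp
  show "act (t + m) p = act t p" using act_add[of t m p] act_integral[OF assms] by simp
qed

text \<open>The one-parameter subgroups generated by \<open>(1, N, N\<^sup>2, \<dots>)\<close> become dense as \<open>N\<close> grows.\<close>

lemma limit_of_dependent_points:
  assumes C: "compact C" and a: "\<And>i. a $ i \<in> \<int>"
    and dep: "\<And>b. (\<And>i. b $ i \<in> \<int>) \<Longrightarrow> \<exists>p\<in>C. \<exists>r. vel b p = (\<lambda>d. r *\<^sub>R vel a p d)"
  shows "\<exists>p\<in>C. \<forall>s. \<exists>\<tau>. act (s - \<tau> *\<^sub>R a) p = p"
proof -
  obtain \<sigma> :: "'k \<Rightarrow> nat" where \<sigma>: "bij_betw \<sigma> UNIV {..<CARD('k)}"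
    using finite_same_card_bij[of "UNIV :: 'k set" "{..<CARD('k)}"] by auto
  define b where "b n = (\<chi> i. real (Suc n) ^ \<sigma> i)" for n
  have "\<exists>p\<in>C. \<exists>r. vel (b n) p = (\<lambda>d. r *\<^sub>R vel a p d)" for n
    by (rule dep) (simp add: b_def)
  then obtain P r where P: "\<And>n. P n \<in> C" "\<And>n. vel (b n) (P n) = (\<lambda>d. r n *\<^sub>R vel a (P n) d)" by metis
  have fx: "act (t *\<^sub>R (b n - r n *\<^sub>R a)) (P n) = P n" for n t
    using P(2)[of n] vel_diff_zero_iff[of "b n" "r n" a "P n"] by (intro fixed_if_vel_zero) blast
  have "seq_compact C" using C by (rule compact_imp_seq_compact)
  then obtain p \<phi> where p: "p \<in> C" "strict_mono \<phi>" "(P \<circ> \<phi>) \<longlonglongrightarrow> p"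
    using P(1) by (metis seq_compactE)
  have "\<exists>\<tau>. act (s - \<tau> *\<^sub>R a) p = p" for s
  proof -
    have "\<exists>e \<tau>. (\<forall>i. \<bar>e $ i\<bar> \<le> 1 / real (Suc n)) \<and> 0 \<le> \<tau> \<and> \<tau> \<le> 1 \<and> act (s + e - \<tau> *\<^sub>R a) (P n) = P n" for n
    proof -
      define s' where "s' j = s $ (inv_into UNIV \<sigma> j)" for j
      have s': "s' (\<sigma> i) = s $ i" for i using \<sigma> by (simp add: s'_def bij_betw_def)
      obtain t where t: "\<And>i. i < CARD('k) \<Longrightarrow> \<exists>m::int. \<bar>real (Suc n) ^ i * t - s' i - of_int m\<bar> \<le> 1 / real (Suc n)"
        using simultaneous_digit_approximation[of "Suc n" "CARD('k)" s'] by blast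
      have "\<exists>m::int. \<bar>t * b n $ i - s $ i - of_int m\<bar> \<le> 1 / real (Suc n)" for i
      proof -
        have "\<sigma> i < CARD('k)" using \<sigma> by (auto simp: bij_betw_def)
        from t[OF this] show ?thesis by (simp add: b_def s' mult.commute)
      qed
      then obtain m where m: "\<And>i. \<bar>t * b n $ i - s $ i - of_int (m i)\<bar> \<le> 1 / real (Suc n)" by metis
      \<comment> \<open>The error of approximating \<open>s\<close> by the time \<open>t\<close>
        along \<open>b n\<close>, modulo the lattice that acts trivially. As \<open>a\<close> has
        integer coordinates, \<open>t * r n\<close> may likewise be replaced by its fractional part,
        which confines these times to a compact interval.\<close>
      define e where "e = t *\<^sub>R b n - s - (\<chi> i. of_int (m i))"
      define \<tau> where "\<tau> = frac (t * r n)"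
      have "s + e - \<tau> *\<^sub>R a = t *\<^sub>R (b n - r n *\<^sub>R a) - ((\<chi> i. of_int (m i)) - of_int \<lfloor>t * r n\<rfloor> *\<^sub>R a)"
        by (simp add: e_def \<tau>_def frac_def algebra_simps)
      moreover have "((\<chi> i. of_int (m i)) - of_int \<lfloor>t * r n\<rfloor> *\<^sub>R a) $ i \<in> \<int>" for i
        using a by simp
      ultimately have "act (s + e - \<tau> *\<^sub>R a) (P n) = P n" using act_diff_integral(1) fx by simp
      moreover have "\<forall>i. \<bar>e $ i\<bar> \<le> 1 / real (Suc n)" using m by (simp add: e_def)
      moreover have "0 \<le> \<tau>" "\<tau> \<le> 1" using frac_ge_0 frac_lt_1[of "t * r n"] by (auto simp: \<tau>_def)
      ultimately show ?thesis by blast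
    qed
    then obtain e \<tau> where e: "\<And>n i. \<bar>e n $ i\<bar> \<le> 1 / real (Suc n)" "\<And>n. \<tau> n \<in> {0..1}"
      "\<And>n. act (s + e n - \<tau> n *\<^sub>R a) (P n) = P n" by (metis atLeastAtMost_iff)
    have e0: "e \<longlonglongrightarrow> 0"
    proof (rule vec_tendstoI)
      fix i
      have "(\<lambda>n. e n $ i) \<longlonglongrightarrow> 0"
        by (rule Lim_null_comparison[OF _ LIMSEQ_inverse_real_of_nat]) (use e(1) in \<open>simp add: divide_inverse\<close>)
      then show "(\<lambda>n. e n $ i) \<longlonglongrightarrow> 0 $ i" by simp
    qed
    have "compact {0..1::real}" by simp
    then obtain \<tau>0 \<psi> where \<psi>: "strict_mono \<psi>" "((\<tau> \<circ> \<phi>) \<circ> \<psi>) \<longlonglongrightarrow> \<tau>0"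
      using e(2) unfolding compact_eq_seq_compact_metric seq_compact_def by (metis comp_apply)
    let ?f = "\<phi> \<circ> \<psi>"
    have f: "strict_mono ?f" using p(2) \<psi>(1) by (rule strict_mono_o)
    have "(\<lambda>n. act (s + e (?f n) - \<tau> (?f n) *\<^sub>R a) (P (?f n))) \<longlonglongrightarrow> act (s + 0 - \<tau>0 *\<^sub>R a) p"
    proof (intro act_tendsto tendsto_intros)
      show "(\<lambda>n. e (?f n)) \<longlonglongrightarrow> 0" using LIMSEQ_subseq_LIMSEQ[OF e0 f] by (simp add: comp_def)
      show "(\<lambda>n. \<tau> (?f n)) \<longlonglongrightarrow> \<tau>0" using \<psi>(2) by (simp add: comp_def)
      show "(\<lambda>n. P (?f n)) \<longlonglongrightarrow> p" using LIMSEQ_subseq_LIMSEQ[OF p(3) \<psi>(1)] by (simp add: comp_def)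
    qed
    then have "(\<lambda>n. P (?f n)) \<longlonglongrightarrow> act (s - \<tau>0 *\<^sub>R a) p" by (simp add: e(3))
    moreover have "(\<lambda>n. P (?f n)) \<longlonglongrightarrow> p" using LIMSEQ_subseq_LIMSEQ[OF p(3) \<psi>(1)] by (simp add: comp_def)
    ultimately have "act (s - \<tau>0 *\<^sub>R a) p = p" by (rule LIMSEQ_unique)
    then show ?thesis by blast
  qed
  then show ?thesis using p(1) by blast
qed

text \<open>Small elements fixing \<open>p\<close> leave only the velocity term in the first-order
  expansion of the orbit map, so the velocities of the normalized elements tend to 0. Limit
  directions thus lie in the Lie algebra of the stabilizer.\<close>

lemma vel_of_stabilizer_direction:
  assumes "\<And>n. act (s n) p = p" "s \<longlonglongrightarrow> 0" "\<And>n. s n \<noteq> 0"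
  shows "\<exists>u \<psi>. norm u = 1 \<and> vel u p = (\<lambda>_. 0) \<and> strict_mono (\<psi> :: nat \<Rightarrow> nat) \<and> (\<lambda>n. (s (\<psi> n)) /\<^sub>R norm (s (\<psi> n))) \<longlonglongrightarrow> u"
proof -
  obtain d where d: "d \<in> A" "p \<in> fst d" by (rule ex_chart)
  define w where "w n = s n /\<^sub>R norm (s n)" for n
  have "w n \<in> sphere 0 1" for n using assms(3) by (simp add: w_def)
  then obtain u \<psi> where u: "u \<in> sphere 0 1" "strict_mono \<psi>" "(w \<circ> \<psi>) \<longlonglongrightarrow> u"
    using compact_sphere[of 0 1] unfolding compact_eq_seq_compact_metric seq_compact_def by metis
  have D: "((\<lambda>h. norm (snd d (act (0 + h) p) - snd d (act 0 p) - vel h p d) / norm h) \<longlongrightarrow> 0) (at 0)"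
    using orbit_map_derivative[OF d] unfolding has_derivative_at by blast
  have "filterlim s (at 0) sequentially" using assms(2,3) by (simp add: filterlim_at)
  from filterlim_compose[OF D this]
  have "(\<lambda>n. norm (vel (s n) p d) / norm (s n)) \<longlonglongrightarrow> 0" by (simp add: assms(1))
  moreover have "norm (vel (s n) p d) / norm (s n) = norm (vel (w n) p d)" for n
    using linear_cmul[OF vel_linear[OF d]] by (simp add: w_def divide_inverse_commute)
  ultimately have "(\<lambda>n. norm (vel (w n) p d)) \<longlonglongrightarrow> 0" by simp
  then have "(\<lambda>n. vel (w n) p d) \<longlonglongrightarrow> 0" by (simp add: tendsto_norm_zero_iff)
  from LIMSEQ_subseq_LIMSEQ[OF this u(2)] have "(\<lambda>n. vel ((w \<circ> \<psi>) n) p d) \<longlonglongrightarrow> 0" by (simp add: comp_def)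
  moreover have "(\<lambda>n. vel ((w \<circ> \<psi>) n) p d) \<longlonglongrightarrow> vel u p d"
    using isCont_tendsto_compose[OF _ u(3)] linear_continuous_at[of "\<lambda>a. vel a p d" u] vel_linear[OF d]
      linear_conv_bounded_linear by blast
  ultimately have "vel u p d = 0" using LIMSEQ_unique by blast
  then have "vel u p = (\<lambda>_. 0)" using vel_zero_iff[OF d] by blast
  then show ?thesis using u by (intro exI[of _ u] exI[of _ \<psi>]) (simp add: w_def comp_def)
qed

text \<open>Multiples of \<open>a\<close> bring the elements \<open>b / n\<close> into the
  stabilizer. A limit direction \<open>u\<close> of the resulting small elements lies in the span of
  \<open>a\<close> and \<open>b\<close> and has zero velocity. It is not a multiple of
  \<open>a\<close>, whose velocity is nonzero, so it yields the relation.\<close>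

lemma vel_parallel:
  assumes va: "vel a p \<noteq> (\<lambda>_. 0)" and a: "\<And>i. a $ i \<in> \<int>" and st: "\<And>s. \<exists>\<tau>. act (s - \<tau> *\<^sub>R a) p = p"
  shows "\<exists>r. vel b p = (\<lambda>d. r *\<^sub>R vel a p d)"
proof (cases "b \<in> span {a}")
  case True
  then obtain r where "b = r *\<^sub>R a" by (auto simp: span_singleton)
  moreover have "vel 0 p = (\<lambda>_. 0)" by (rule vel_zero_if_fixed) simp
  ultimately show ?thesis using vel_diff_zero_iff[of b r a p] by auto
next
  case False
  have "\<exists>\<tau>. \<tau> \<in> {0..1} \<and> act ((1 / real (Suc n)) *\<^sub>R b - \<tau> *\<^sub>R a) p = p" for n
  proof -
    obtain \<tau> where \<tau>: "act ((1 / real (Suc n)) *\<^sub>R b - \<tau> *\<^sub>R a) p = p" using st by blast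
    have "(1 / real (Suc n)) *\<^sub>R b - frac \<tau> *\<^sub>R a = ((1 / real (Suc n)) *\<^sub>R b - \<tau> *\<^sub>R a) + of_int \<lfloor>\<tau>\<rfloor> *\<^sub>R a"
      by (simp add: frac_def algebra_simps)
    then have "act ((1 / real (Suc n)) *\<^sub>R b - frac \<tau> *\<^sub>R a) p
      = act (((1 / real (Suc n)) *\<^sub>R b - \<tau> *\<^sub>R a) + of_int \<lfloor>\<tau>\<rfloor> *\<^sub>R a) p" by (simp only:)
    also have "\<dots> = act ((1 / real (Suc n)) *\<^sub>R b - \<tau> *\<^sub>R a) p"
      by (rule act_diff_integral(2)) (simp add: a)
    finally have "act ((1 / real (Suc n)) *\<^sub>R b - frac \<tau> *\<^sub>R a) p = p" using \<tau> by simp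
    then show ?thesis using frac_ge_0 frac_lt_1 by (metis atLeastAtMost_iff less_imp_le)
  qed
  then obtain \<tau> where \<tau>: "\<And>n. \<tau> n \<in> {0..1}" "\<And>n. act ((1 / real (Suc n)) *\<^sub>R b - \<tau> n *\<^sub>R a) p = p" by metis
  have "compact {0..1::real}" by simp
  then obtain \<tau>0 \<phi> where \<phi>: "strict_mono \<phi>" "(\<tau> \<circ> \<phi>) \<longlonglongrightarrow> \<tau>0"
    using \<tau>(1) unfolding compact_eq_seq_compact_metric seq_compact_def by metis
  have n0: "(\<lambda>n. 1 / real (Suc n)) \<longlonglongrightarrow> 0" by (rule LIMSEQ_Suc[OF lim_1_over_n])
  note n0' = LIMSEQ_subseq_LIMSEQ[OF n0 \<phi>(1), unfolded comp_def]
  have "(\<lambda>n. act ((1 / real (Suc (\<phi> n))) *\<^sub>R b - \<tau> (\<phi> n) *\<^sub>R a) p) \<longlonglongrightarrow> act (0 *\<^sub>R b - \<tau>0 *\<^sub>R a) p"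
    using \<phi>(2) by (intro act_tendsto tendsto_intros n0') (simp add: comp_def)
  then have "(\<lambda>n::nat. p) \<longlonglongrightarrow> act (0 *\<^sub>R b - \<tau>0 *\<^sub>R a) p" by (simp only: \<tau>(2))
  from LIMSEQ_unique[OF this tendsto_const] have "act (- (\<tau>0 *\<^sub>R a)) p = p" by simp
  then have \<tau>0: "act (\<tau>0 *\<^sub>R a) p = p" using act_minus[of "- (\<tau>0 *\<^sub>R a)" p] by simp
  \<comment> \<open>The times \<tau> need not tend to 0. Their limit \<open>\<tau>0\<close> is
    itself a return time, and subtracting it gives stabilizing elements that do tend to 0.\<close>
  define s where "s n = (1 / real (Suc (\<phi> n))) *\<^sub>R b - (\<tau> (\<phi> n) - \<tau>0) *\<^sub>R a" for n
  have "s n = ((1 / real (Suc (\<phi> n))) *\<^sub>R b - \<tau> (\<phi> n) *\<^sub>R a) + \<tau>0 *\<^sub>R a" for n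
    by (simp add: s_def algebra_simps)
  then have s1: "act (s n) p = p" for n using act_add \<tau>0 \<tau>(2) by simp
  have "s \<longlonglongrightarrow> 0 *\<^sub>R b - (\<tau>0 - \<tau>0) *\<^sub>R a"
    unfolding s_def[abs_def] using \<phi>(2) by (intro tendsto_intros n0') (simp add: comp_def)
  then have s2: "s \<longlonglongrightarrow> 0" by simp
  have s3: "s n \<noteq> 0" for n
  proof
    assume "s n = 0"
    then have "(1 / real (Suc (\<phi> n))) *\<^sub>R b = (\<tau> (\<phi> n) - \<tau>0) *\<^sub>R a" by (simp add: s_def)
    then have "real (Suc (\<phi> n)) *\<^sub>R ((1 / real (Suc (\<phi> n))) *\<^sub>R b) = real (Suc (\<phi> n)) *\<^sub>R ((\<tau> (\<phi> n) - \<tau>0) *\<^sub>R a)" by simp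
    then have "b = (real (Suc (\<phi> n)) * (\<tau> (\<phi> n) - \<tau>0)) *\<^sub>R a" by simp
    then show False using False by (metis span_base span_scale singletonI)
  qed
  obtain u \<psi> where u: "norm u = 1" "vel u p = (\<lambda>_. 0)" "(\<lambda>n. s (\<psi> n) /\<^sub>R norm (s (\<psi> n))) \<longlonglongrightarrow> u"
    using vel_of_stabilizer_direction[OF s1 s2 s3] by blast
  have "s n \<in> span {b, a}" for n unfolding s_def by (intro span_diff span_scale span_base) auto
  then have "u \<in> span {b, a}"
    by (intro closed_sequentially[OF closed_span _ u(3)] span_scale) auto
  then obtain y x where "u - y *\<^sub>R b = x *\<^sub>R a" by (auto simp: span_insert span_singleton)
  then have uyx: "u = y *\<^sub>R b + x *\<^sub>R a" by (simp add: algebra_simps)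
  obtain d where d: "d \<in> A" "p \<in> fst d" by (rule ex_chart)
  have "vel u p d = y *\<^sub>R vel b p d + x *\<^sub>R vel a p d"
    unfolding uyx using linear_add[OF vel_linear[OF d]] linear_cmul[OF vel_linear[OF d]] by simp
  then have e: "y *\<^sub>R vel b p d + x *\<^sub>R vel a p d = 0" using u(2) by simp
  have "y \<noteq> 0"
  proof
    assume "y = 0"
    then have "x *\<^sub>R vel a p d = 0" "x \<noteq> 0" using e uyx u(1) by auto
    then show False using va vel_zero_iff[OF d] by simp
  qed
  have "vel b p d = (1 / y) *\<^sub>R (y *\<^sub>R vel b p d)" using \<open>y \<noteq> 0\<close> by simp
  also have "y *\<^sub>R vel b p d = - x *\<^sub>R vel a p d" using e by (simp add: eq_neg_iff_add_eq_0)
  finally have "vel b p d = (- x / y) *\<^sub>R vel a p d" by simp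
  then show ?thesis using vel_eq_scaleR_iff[OF d] by blast
qed

text \<open>The action on \<open>p\<close> factors through a linear functional \<alpha>, so the
  orbit is swept out by the line through \<open>a\<close>, with a discrete group \<open>T\<close> of
  return times. The lattice is mapped into \<open>T\<close>: this closes the orbit up and makes
  \<alpha> a multiple of an integral character.\<close>

lemma one_dimensional_orbit:
  assumes va: "vel a p \<noteq> (\<lambda>_. 0)" and par: "\<And>b. \<exists>r. vel b p = (\<lambda>d. r *\<^sub>R vel a p d)"
  shows "Group_Action.orbit (torus UNIV) \<rho> p homeomorphic sphere (0::complex) 1"
    and "\<exists>H. codim_one_subtorus H \<and> (\<forall>z\<in>H. \<rho> z p = p)"
proof -
  obtain d where d: "d \<in> A" "p \<in> fst d" by (rule ex_chart)
  have v: "vel a p d \<noteq> 0" using va vel_zero_iff[OF d] by blast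
  \<comment> \<open>The coefficient is written with inner products so that its linearity in
    \<open>b\<close> is visible.\<close>
  define \<alpha> where "\<alpha> b = (vel b p d \<bullet> vel a p d) / (vel a p d \<bullet> vel a p d)" for b
  have \<alpha>: "vel b p d = \<alpha> b *\<^sub>R vel a p d" for b
  proof -
    obtain r where r: "vel b p = (\<lambda>d. r *\<^sub>R vel a p d)" using par by blast
    have "vel b p d = r *\<^sub>R vel a p d" by (simp add: r)
    then show ?thesis using v by (simp add: \<alpha>_def)
  qed
  have lin: "linear \<alpha>"
    using linear_add[OF vel_linear[OF d]] linear_cmul[OF vel_linear[OF d]]
    by (auto simp: \<alpha>_def linear_iff inner_add_left add_divide_distrib)
  have \<alpha>a: "\<alpha> a = 1" using v by (simp add: \<alpha>_def)
  have act\<alpha>: "act b p = act (\<alpha> b *\<^sub>R a) p" for b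
  proof -
    have "vel (b - \<alpha> b *\<^sub>R a) p = (\<lambda>_. 0)"
      using vel_diff_zero_iff[of b "\<alpha> b" a p] vel_eq_scaleR_iff[OF d, of b "\<alpha> b" a] \<alpha> by blast
    from fixed_if_vel_zero[OF this, of 1] have "act (b - \<alpha> b *\<^sub>R a) p = p" by simp
    then show ?thesis using act_add[of "\<alpha> b *\<^sub>R a" "b - \<alpha> b *\<^sub>R a" p] by simp
  qed
  define T where "T = {\<tau>. act (\<tau> *\<^sub>R a) p = p}"
  have Tadd: "x + y \<in> T" if "x \<in> T" "y \<in> T" for x y
    using that by (simp add: T_def scaleR_add_left act_add)
  have Tminus: "- x \<in> T" if "x \<in> T" for x
    using that act_minus[of "x *\<^sub>R a" p] by (simp add: T_def)
  have T\<alpha>: "\<alpha> (axis i 1) \<in> T" for i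
  proof -
    have "act (axis i 1) p = p" by (rule act_integral) (simp add: axis_def)
    then show ?thesis by (simp add: T_def flip: act\<alpha>)
  qed
  have \<alpha>sum: "\<alpha> b = (\<Sum>i\<in>UNIV. b $ i * \<alpha> (axis i 1))" for b
  proof -
    have "\<alpha> b = \<alpha> (\<Sum>i\<in>UNIV. b $ i *\<^sub>R axis i 1)"
      using basis_expansion[of b] by (simp add: scalar_mult_eq_scaleR)
    then show ?thesis by (simp add: linear_sum[OF lin] linear_cmul[OF lin])
  qed
  \<comment> \<open>Because \<open>\<alpha> a = 1\<close>, some lattice vector supplies a nonzero
    return time.\<close>
  have "\<exists>i. \<alpha> (axis i 1) \<noteq> 0"
  proof (rule ccontr)
    assume "\<not> ?thesis"
    then show False using \<alpha>a \<alpha>sum[of a] by simp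
  qed
  then obtain i where i: "\<alpha> (axis i 1) \<noteq> 0" by blast
  obtain e where e: "e > 0" "\<And>\<tau>. 0 < \<bar>\<tau>\<bar> \<Longrightarrow> \<bar>\<tau>\<bar> < e \<Longrightarrow> \<tau> \<notin> T"
    using stabilizer_discrete[OF va] by (auto simp: T_def)
  then have e': "\<And>\<tau>. \<tau> \<in> T \<Longrightarrow> 0 < \<bar>\<tau>\<bar> \<Longrightarrow> e \<le> \<bar>\<tau>\<bar>" by (meson not_le)
  obtain \<tau> where \<tau>: "\<tau> \<in> T" "\<tau> > 0" "\<And>y. y \<in> T \<Longrightarrow> \<exists>n::int. y = of_int n * \<tau>"
    using discrete_subgroup_real[OF Tadd Tminus e(1) e' T\<alpha> i] by blast
  have T\<tau>: "of_int n * \<tau> \<in> T" for n :: int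
  proof -
    have nat: "real k * \<tau> \<in> T" for k
      using act_multiple[of "\<tau> *\<^sub>R a" p k] \<tau>(1) by (simp add: T_def)
    show ?thesis
    proof (cases "n \<ge> 0")
      case True
      then show ?thesis using nat[of "nat n"] by simp
    next
      case False
      then show ?thesis using Tminus[OF nat[of "nat (- n)"]] by simp
    qed
  qed
  have Teq: "act (x *\<^sub>R a) p = act (y *\<^sub>R a) p \<longleftrightarrow> x - y \<in> T" for x y
  proof -
    have "act (x *\<^sub>R a) p = act (y *\<^sub>R a) p \<longleftrightarrow> act (- (y *\<^sub>R a)) (act (x *\<^sub>R a) p) = p"
      by (metis act_minus act_add add.left_neutral add.right_inverse act_0 minus_minus)
    also have "\<dots> \<longleftrightarrow> x - y \<in> T" by (simp add: T_def scaleR_diff_left flip: act_add)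
    finally show ?thesis .
  qed
  \<comment> \<open>Time is measured in units of the least period, so the unit interval runs through
    the orbit exactly once.\<close>
  define \<gamma> where "\<gamma> x = act ((x * \<tau>) *\<^sub>R a) p" for x :: real
  have \<gamma>eq: "\<gamma> x = \<gamma> y \<longleftrightarrow> (\<exists>n::int. x - y = of_int n)" for x y
  proof -
    have "\<gamma> x = \<gamma> y \<longleftrightarrow> x * \<tau> - y * \<tau> \<in> T" by (simp add: \<gamma>_def Teq)
    also have "\<dots> \<longleftrightarrow> (\<exists>n::int. x - y = of_int n)"
    proof
      assume "x * \<tau> - y * \<tau> \<in> T"
      then obtain n :: int where "x * \<tau> - y * \<tau> = of_int n * \<tau>" using \<tau>(3) by blast
      then have "(x - y) * \<tau> = of_int n * \<tau>" by (simp add: left_diff_distrib)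
      then show "\<exists>n::int. x - y = of_int n" using \<tau>(2) by auto
    next
      assume "\<exists>n::int. x - y = of_int n"
      then obtain n :: int where "x - y = of_int n" by blast
      then have "x * \<tau> - y * \<tau> = of_int n * \<tau>" by (simp flip: left_diff_distrib)
      then show "x * \<tau> - y * \<tau> \<in> T" using T\<tau> by simp
    qed
    finally show ?thesis .
  qed
  have path: "path \<gamma>" unfolding path_def \<gamma>_def
    by (intro continuous_act_compose continuous_intros)
  have "simple_path \<gamma>"
    unfolding simple_path_def loop_free_def
  proof (intro conjI path ballI impI)
    fix x y :: real assume xy: "x \<in> {0..1}" "y \<in> {0..1}" "\<gamma> x = \<gamma> y"
    then obtain n :: int where n: "x - y = of_int n" using \<gamma>eq by blast
    then have "- 1 \<le> real_of_int n" "real_of_int n \<le> 1" using xy by auto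
    then have "- 1 \<le> n" "n \<le> 1" by linarith+
    then have "n = -1 \<or> n = 0 \<or> n = 1" by auto
    then show "x = y \<or> x = 0 \<and> y = 1 \<or> x = 1 \<and> y = 0" using n xy(1,2) by auto
  qed
  moreover have "pathfinish \<gamma> = pathstart \<gamma>"
    unfolding pathfinish_def pathstart_def \<gamma>eq by (intro exI[of _ 1]) simp
  ultimately have hom: "path_image \<gamma> homeomorphic sphere (0::complex) 1"
    by (intro homeomorphic_simple_path_image_circle) auto
  have "Group_Action.orbit (torus UNIV) \<rho> p = path_image \<gamma>"
  proof (intro subset_antisym subsetI)
    fix q assume "q \<in> Group_Action.orbit (torus UNIV) \<rho> p"
    then obtain z where z: "z \<in> carrier (torus UNIV)" "q = \<rho> z p" by (auto simp: orbit_def)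
    obtain t where "torus_exp t = z" using torus_exp_surj z(1) by blast
    then have "q = \<gamma> (\<alpha> t / \<tau>)" using z(2) \<tau>(2) act\<alpha>[of t] by (simp add: \<gamma>_def act_def)
    also have "\<dots> = \<gamma> (frac (\<alpha> t / \<tau>))" unfolding \<gamma>eq by (intro exI[of _ "\<lfloor>\<alpha> t / \<tau>\<rfloor>"]) (simp add: frac_def)
    finally show "q \<in> path_image \<gamma>"
      unfolding path_image_def using frac_ge_0 frac_lt_1[of "\<alpha> t / \<tau>"] by (intro image_eqI) auto
  next
    fix q assume "q \<in> path_image \<gamma>"
    then obtain x where "q = \<gamma> x" by (auto simp: path_image_def)
    then have "q = \<rho> (torus_exp ((x * \<tau>) *\<^sub>R a)) p" by (simp add: \<gamma>_def act_def)
    then show "q \<in> Group_Action.orbit (torus UNIV) \<rho> p" by (auto simp: orbit_def)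
  qed
  then show "Group_Action.orbit (torus UNIV) \<rho> p homeomorphic sphere (0::complex) 1" using hom by simp
  \<comment> \<open>\<open>\<alpha> / \<tau>\<close> is integral on the lattice, hence induces a
    character of the torus with exponents \<open>m\<close>, and its kernel fixes
    \<open>p\<close>.\<close>
  obtain m where m: "\<And>i. \<alpha> (axis i 1) = of_int (m i) * \<tau>" using \<tau>(3)[OF T\<alpha>] by metis
  obtain H :: "(complex ^ 'k) set" where H: "codim_one_subtorus H"
    "\<And>z. z \<in> H \<Longrightarrow> \<exists>b. torus_exp b = z \<and> (\<Sum>i\<in>UNIV. of_int (m i) * b $ i) \<in> \<int>"
    using codim_one_subtorus_in_character_kernel[of m] by blast
  have "\<rho> z p = p" if "z \<in> H" for z
  proof -
    obtain b where b: "torus_exp b = z" "(\<Sum>i\<in>UNIV. of_int (m i) * b $ i) \<in> \<int>" using H(2)[OF \<open>z \<in> H\<close>] by blast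
    obtain n :: int where n: "(\<Sum>i\<in>UNIV. of_int (m i) * b $ i) = of_int n" using b(2) by (elim Ints_cases)
    have "\<alpha> b = (\<Sum>i\<in>UNIV. of_int (m i) * b $ i) * \<tau>"
      unfolding \<alpha>sum[of b] m by (simp add: sum_distrib_left mult_ac)
    then have "\<alpha> b \<in> T" using T\<tau>[of n] n by simp
    then have "act b p = p" using act\<alpha>[of b] by (simp add: T_def)
    then show ?thesis using b(1) by (simp add: act_def)
  qed
  then show "\<exists>H. codim_one_subtorus H \<and> (\<forall>z\<in>H. \<rho> z p = p)" using H(1) by blast
qed

end

section \<open>Isotropy representations\<close>

text \<open>Cut the box at height \<open>1 - \<sigma>\<close> in the direction \<open>k\<close>. The
  shift pushes the upper piece out of the box, and translating it back by \<open>k\<close> fills the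
  gap at the bottom.\<close>

lemma integral_periodic_shift_step:
  fixes h :: "'a::euclidean_space \<Rightarrow> 'b::euclidean_space"
  assumes h: "continuous_on UNIV h" and k: "k \<in> Basis" and per: "\<And>t. h (t + k) = h t"
    and \<sigma>: "0 \<le> \<sigma>" "\<sigma> \<le> 1"
  shows "integral (cbox 0 One) (\<lambda>t. h (t + \<sigma> *\<^sub>R k)) = integral (cbox 0 One) h"
proof -
  have lo: "cbox 0 One \<inter> {x. x \<bullet> k \<le> c} = cbox 0 (One - (1 - c) *\<^sub>R k)" if "0 \<le> c" "c \<le> 1" for c
  proof -
    have "(One - (1 - c) *\<^sub>R k) \<bullet> i = (if i = k then c else 1)" if "i \<in> Basis" for i
      using that k by (simp add: inner_diff_left inner_Basis)
    then have *: "x \<in> cbox 0 (One - (1 - c) *\<^sub>R k) \<longleftrightarrow> (\<forall>i\<in>Basis. 0 \<le> x \<bullet> i \<and> x \<bullet> i \<le> (if i = k then c else 1))" for x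
      unfolding mem_box by simp
    show ?thesis
    proof (rule Set.set_eqI)
      fix x
      have "(\<forall>i\<in>Basis. 0 \<le> x \<bullet> i \<and> x \<bullet> i \<le> 1) \<and> x \<bullet> k \<le> c \<longleftrightarrow>
        (\<forall>i\<in>Basis. 0 \<le> x \<bullet> i \<and> x \<bullet> i \<le> (if i = k then c else 1))" (is "?L \<longleftrightarrow> ?R")
      proof
        assume ?R
        then have "x \<bullet> k \<le> c" using k by (auto dest: bspec[of _ _ k])
        moreover have "0 \<le> x \<bullet> i \<and> x \<bullet> i \<le> 1" if "i \<in> Basis" for i
          using \<open>?R\<close>[rule_format, OF that] \<open>0 \<le> c\<close> \<open>c \<le> 1\<close> by (cases "i = k") auto
        ultimately show ?L by blast
      qed auto
      then show "x \<in> cbox 0 One \<inter> {x. x \<bullet> k \<le> c} \<longleftrightarrow> x \<in> cbox 0 (One - (1 - c) *\<^sub>R k)"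
        unfolding * by (simp add: mem_box)
    qed
  qed
  have hi: "cbox 0 One \<inter> {x. x \<bullet> k \<ge> c} = cbox (c *\<^sub>R k) One" if "0 \<le> c" "c \<le> 1" for c
  proof -
    have "(c *\<^sub>R k) \<bullet> i = (if i = k then c else 0)" if "i \<in> Basis" for i
      using that k by (simp add: inner_Basis)
    then have *: "x \<in> cbox (c *\<^sub>R k) One \<longleftrightarrow> (\<forall>i\<in>Basis. (if i = k then c else 0) \<le> x \<bullet> i \<and> x \<bullet> i \<le> 1)" for x
      unfolding mem_box by simp
    show ?thesis
    proof (rule Set.set_eqI)
      fix x
      have "(\<forall>i\<in>Basis. 0 \<le> x \<bullet> i \<and> x \<bullet> i \<le> 1) \<and> x \<bullet> k \<ge> c \<longleftrightarrow>
        (\<forall>i\<in>Basis. (if i = k then c else 0) \<le> x \<bullet> i \<and> x \<bullet> i \<le> 1)" (is "?L \<longleftrightarrow> ?R")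
      proof
        assume ?R
        then have "x \<bullet> k \<ge> c" using k by (auto dest: bspec[of _ _ k])
        moreover have "0 \<le> x \<bullet> i \<and> x \<bullet> i \<le> 1" if "i \<in> Basis" for i
          using \<open>?R\<close>[rule_format, OF that] \<open>0 \<le> c\<close> \<open>c \<le> 1\<close> by (cases "i = k") auto
        ultimately show ?L by blast
      qed auto
      then show "x \<in> cbox 0 One \<inter> {x. x \<bullet> k \<ge> c} \<longleftrightarrow> x \<in> cbox (c *\<^sub>R k) One"
        unfolding * by (simp add: mem_box)
    qed
  qed
  have int: "(\<lambda>t. h (t + c)) integrable_on cbox a b" for a b c
    by (intro integrable_continuous continuous_on_compose2[OF h] continuous_intros) auto
  have sh: "integral (cbox a b) (\<lambda>t. h (t + c)) = integral (cbox (a + c) (b + c)) h" for a b c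
    using integral_shift_cbox_plus[of a b h c] by (simp add: comp_def add.commute[of c])
  have "integral (cbox 0 One) (\<lambda>t. h (t + \<sigma> *\<^sub>R k))
     = integral (cbox 0 (One - \<sigma> *\<^sub>R k)) (\<lambda>t. h (t + \<sigma> *\<^sub>R k)) + integral (cbox ((1 - \<sigma>) *\<^sub>R k) One) (\<lambda>t. h (t + \<sigma> *\<^sub>R k))"
    using integral_split[where c="1 - \<sigma>" and k=k, OF int[of "\<sigma> *\<^sub>R k" 0 One] k] lo[of "1 - \<sigma>"] hi[of "1 - \<sigma>"] \<sigma> by simp
  also have "integral (cbox 0 (One - \<sigma> *\<^sub>R k)) (\<lambda>t. h (t + \<sigma> *\<^sub>R k)) = integral (cbox (\<sigma> *\<^sub>R k) One) h"
    by (simp add: sh)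
  also have "integral (cbox ((1 - \<sigma>) *\<^sub>R k) One) (\<lambda>t. h (t + \<sigma> *\<^sub>R k))
     = integral (cbox ((1 - \<sigma>) *\<^sub>R k) One) (\<lambda>t. h (t + (\<sigma> - 1) *\<^sub>R k))"
  proof -
    have "h (t + \<sigma> *\<^sub>R k) = h (t + (\<sigma> - 1) *\<^sub>R k)" for t
      using per[of "t + (\<sigma> - 1) *\<^sub>R k"] by (simp add: algebra_simps)
    then show ?thesis by simp
  qed
  also have "\<dots> = integral (cbox 0 (One - (1 - \<sigma>) *\<^sub>R k)) h"
    unfolding sh by (simp add: algebra_simps)
  also have "integral (cbox (\<sigma> *\<^sub>R k) One) h + \<dots> = integral (cbox 0 One) h"
    using integral_split[where c=\<sigma> and k=k, OF int[of 0 0 One] k] lo[of \<sigma>] hi[of \<sigma>] \<sigma> by simp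
  finally show ?thesis .
qed

text \<open>Translation invariance of the integral over the torus, which the averaging below rests
  on. The shift is made one coordinate at a time, each reduced modulo 1.\<close>

lemma integral_periodic_shift:
  fixes h :: "'a::euclidean_space \<Rightarrow> 'b::euclidean_space"
  assumes h: "continuous_on UNIV h" and per: "\<And>t k. k \<in> Basis \<Longrightarrow> h (t + k) = h t"
  shows "integral (cbox 0 One) (\<lambda>t. h (t + s)) = integral (cbox 0 One) h"
proof -
  have perz: "h (t + of_int n *\<^sub>R k) = h t" if k: "k \<in> Basis" for t n k
  proof -
    have nat: "h (t + real m *\<^sub>R k) = h t" for t m
    proof (induction m)
      case (Suc m)
      then show ?case using per[OF k, of "t + real m *\<^sub>R k"] by (simp add: algebra_simps)
    qed simp
    show ?thesis
    proof (cases "n \<ge> 0")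
      case True
      then show ?thesis using nat[of t "nat n"] by simp
    next
      case False
      then show ?thesis using nat[of "t + of_int n *\<^sub>R k" "nat (- n)"] by (simp add: algebra_simps)
    qed
  qed
  have step: "integral (cbox 0 One) (\<lambda>t. h (t + c + r *\<^sub>R k)) = integral (cbox 0 One) (\<lambda>t. h (t + c))"
    if k: "k \<in> Basis" for c r k
  proof -
    let ?h = "\<lambda>t. h (t + c)"
    have "h (t + c + r *\<^sub>R k) = ?h (t + frac r *\<^sub>R k)" for t
      using perz[OF k, of "t + c + frac r *\<^sub>R k" "\<lfloor>r\<rfloor>"] by (simp add: frac_def algebra_simps)
    moreover have "integral (cbox 0 One) (\<lambda>t. ?h (t + frac r *\<^sub>R k)) = integral (cbox 0 One) ?h"
    proof (rule integral_periodic_shift_step[OF _ k])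
      show "continuous_on UNIV ?h" by (intro continuous_on_compose2[OF h] continuous_intros) auto
      show "?h (t + k) = ?h t" for t using per[OF k, of "t + c"] by (simp add: add_ac)
    qed (use frac_ge_0 frac_lt_1[of r] in auto)
    ultimately show ?thesis by simp
  qed
  have "integral (cbox 0 One) (\<lambda>t. h (t + (\<Sum>k\<in>I. (s \<bullet> k) *\<^sub>R k))) = integral (cbox 0 One) h"
    if "finite I" "I \<subseteq> Basis" for I
    using that
  proof (induction I)
    case (insert k I)
    then show ?case using step[of k "\<Sum>k\<in>I. (s \<bullet> k) *\<^sub>R k" "s \<bullet> k"] by (simp add: add_ac)
  qed simp
  from this[of Basis] show ?thesis by (simp add: euclidean_representation)
qed

section \<open>Commuting skew operators\<close>

text \<open>A maximum of the Rayleigh quotient is an eigenvector: otherwise moving \<open>v\<close>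
  towards \<open>S v - \<mu> v\<close> would increase the quotient to first order. The sphere of the
  ambient norm provides compactness, and the quotient is invariant under scaling.\<close>

lemma symmetric_eigenvector:
  fixes W :: "'a::euclidean_space set" and B :: "'a \<Rightarrow> 'a \<Rightarrow> real"
  assumes B: "bilinear B" "\<And>u v. B u v = B v u" "\<And>v. v \<noteq> 0 \<Longrightarrow> B v v > 0"
    and W: "subspace W" "W \<noteq> {0}" and S: "linear S" "\<And>w. w \<in> W \<Longrightarrow> S w \<in> W"
    and sym: "\<And>u v. B (S u) v = B u (S v)"
  shows "\<exists>v\<in>W. v \<noteq> 0 \<and> (\<exists>\<mu>. S v = \<mu> *\<^sub>R v)"
proof -
  note lin = bilinear_ladd[OF B(1)] bilinear_radd[OF B(1)] bilinear_lmul[OF B(1)] bilinear_rmul[OF B(1)]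
    bilinear_lsub[OF B(1)] bilinear_rsub[OF B(1)] linear_add[OF S(1)] linear_cmul[OF S(1)]
  have bB: "bounded_bilinear B" using B(1) by (simp add: bilinear_conv_bounded_bilinear)
  have cont: "continuous_on T (\<lambda>v. B (S v) v / B v v)" if "0 \<notin> T" for T
  proof -
    have "B v v \<noteq> 0" if "v \<in> T" for v using B(3)[of v] that \<open>0 \<notin> T\<close> by force
    then show ?thesis
      by (intro continuous_on_divide bounded_bilinear.continuous_on[OF bB] linear_continuous_on
          S(1)[unfolded linear_conv_bounded_linear] continuous_on_id) auto
  qed
  define K where "K = W \<inter> sphere 0 1"
  have "compact K" unfolding K_def using closed_subspace[OF W(1)] compact_sphere
    by (metis closed_Int_compact)
  moreover obtain w where w: "w \<in> W" "w \<noteq> 0" using W subspace_0 by blast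
  then have "w /\<^sub>R norm w \<in> K" using W(1) by (simp add: K_def subspace_scale)
  moreover have "0 \<notin> K" by (simp add: K_def)
  ultimately obtain v where v: "v \<in> K" "\<And>u. u \<in> K \<Longrightarrow> B (S u) u / B u u \<le> B (S v) v / B v v"
    using continuous_attains_sup[of K "\<lambda>v. B (S v) v / B v v"] cont by blast
  define \<mu> where "\<mu> = B (S v) v / B v v"
  have v0: "v \<noteq> 0" "v \<in> W" using v(1) by (auto simp: K_def)
  have le: "B (S u) u \<le> \<mu> * B u u" if "u \<in> W" for u
  proof (cases "u = 0")
    case True
    then show ?thesis using linear_0[OF S(1)] by (simp add: bilinear_lzero[OF B(1)])
  next
    case False
    define r where "r = inverse (norm u)"
    have "r *\<^sub>R u \<in> K" using that False W(1) by (simp add: K_def subspace_scale r_def)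
    from v(2)[OF this] have "B (S (r *\<^sub>R u)) (r *\<^sub>R u) / B (r *\<^sub>R u) (r *\<^sub>R u) \<le> \<mu>" by (simp add: \<mu>_def)
    then have "B (S u) u / B u u \<le> \<mu>" using False by (simp add: lin r_def)
    then show ?thesis using B(3)[OF False] by (simp add: field_simps)
  qed
  define z where "z = S v - \<mu> *\<^sub>R v"
  have zW: "z \<in> W" using S(2) v0 W(1) by (simp add: z_def subspace_diff subspace_scale)
  have muv: "B (S v) v = \<mu> * B v v" using B(3)[OF v0(1)] by (simp add: \<mu>_def)
  define a where "a = B z z"
  define c where "c = B (S z) z - \<mu> * B z z"
  have q: "2 * t * a + t\<^sup>2 * c \<le> 0" for t
  proof -
    have e1: "B (S z) v = B z (S v)" "B v z = B z v" using sym B(2) by auto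
    have e2: "B (S v) z = B z (S v)" using B(2) by simp
    have "B (S (v + t *\<^sub>R z)) (v + t *\<^sub>R z) \<le> \<mu> * B (v + t *\<^sub>R z) (v + t *\<^sub>R z)"
      using v0 zW W(1) by (intro le subspace_add subspace_scale)
    then have "2 * t * (B z (S v) - \<mu> * B z v) + t\<^sup>2 * c \<le> 0"
      using muv by (simp add: lin e1 e2 c_def power2_eq_square algebra_simps)
    moreover have "a = B z (S v) - \<mu> * B z v" unfolding a_def by (subst (2) z_def) (simp add: lin)
    ultimately show ?thesis by simp
  qed
  have "a = 0"
  proof (rule ccontr)
    assume "a \<noteq> 0"
    then have "z \<noteq> 0" by (auto simp: a_def bilinear_lzero[OF B(1)])
    then have a: "a > 0" using B(3) by (simp add: a_def)
    \<comment> \<open>Small enough for the linear term \<open>2 * t * a\<close> to dominate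
      \<open>t\<^sup>2 * c\<close>; the summand 1 covers \<open>c = 0\<close>.\<close>
    define t where "t = a / (\<bar>c\<bar> + 1)"
    have t: "t > 0" "t * \<bar>c\<bar> < a" using a by (auto simp: t_def field_simps)
    have "0 < t * (2 * a - t * \<bar>c\<bar>)" using t a by (intro mult_pos_pos) linarith+
    also have "\<dots> \<le> 2 * t * a + t\<^sup>2 * c"
    proof -
      have "t\<^sup>2 * (- \<bar>c\<bar>) \<le> t\<^sup>2 * c" by (intro mult_left_mono) auto
      then show ?thesis by (simp add: algebra_simps power2_eq_square)
    qed
    finally show False using q[of t] by simp
  qed
  then have "z = 0" using B(3)[of z] by (auto simp: a_def)
  then show ?thesis using v0 by (auto simp: z_def intro!: bexI[of _ v])
qed

text \<open>On an invariant subspace of least dimension among those on which the family is nontrivial,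
  symmetric operators commuting with the family are scalar; in particular all products \<open>A\<^sub>a A\<^sub>b\<close> are.\<close>

lemma commuting_skew_family_plane:
  fixes Af :: "'b \<Rightarrow> 'a::euclidean_space \<Rightarrow> 'a" and B :: "'a \<Rightarrow> 'a \<Rightarrow> real"
  assumes B: "bilinear B" "\<And>u v. B u v = B v u" "\<And>v. v \<noteq> 0 \<Longrightarrow> B v v > 0"
    and lin: "\<And>b. linear (Af b)" and skew: "\<And>b u v. B (Af b u) v = - B u (Af b v)"
    and comm: "\<And>a b v. Af a (Af b v) = Af b (Af a v)" and nontriv: "Af a0 v0 \<noteq> 0"
  shows "\<exists>v a. Af a v \<noteq> 0 \<and> (\<forall>b. \<exists>r. Af b v = r *\<^sub>R Af a v)"
proof -
  define good where "good W \<longleftrightarrow> subspace W \<and> (\<forall>b. \<forall>w\<in>W. Af b w \<in> W) \<and> (\<exists>b. \<exists>w\<in>W. Af b w \<noteq> 0)" for W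
  have "good UNIV" using nontriv by (auto simp: good_def)
  define W where "W = arg_min dim good"
  have W: "good W" "\<And>V. good V \<Longrightarrow> dim W \<le> dim V"
    unfolding W_def using arg_min_natI[of good UNIV dim] arg_min_nat_le[of good _ dim] \<open>good UNIV\<close> by auto
  have sub: "subspace W" and inv: "\<And>b w. w \<in> W \<Longrightarrow> Af b w \<in> W" using W(1) by (auto simp: good_def)
  obtain a w0 where aw: "w0 \<in> W" "Af a w0 \<noteq> 0" using W(1) by (auto simp: good_def)
  have triv: "Af b v = 0" if "subspace V" "\<And>b w. w \<in> V \<Longrightarrow> Af b w \<in> V" "V \<subseteq> W" "V \<noteq> W" "v \<in> V" for V b v
  proof (rule ccontr)
    assume "Af b v \<noteq> 0"
    then have "good V" using that by (auto simp: good_def)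
    then have "dim W \<le> dim V" by (rule W(2))
    then show False using subspace_dim_equal[OF that(1) sub that(3)] that(4) by simp
  qed
  have B0: "v = 0" if "B v v = 0" for v using B(3)[of v] that by force
  have schur: "\<exists>\<mu>. \<forall>w\<in>W. S w = \<mu> *\<^sub>R w"
    if S: "linear S" "\<And>w. w \<in> W \<Longrightarrow> S w \<in> W" "\<And>u v. B (S u) v = B u (S v)" "\<And>b v. S (Af b v) = Af b (S v)" for S
  proof -
    have "W \<noteq> {0}" using aw linear_0[OF lin] by auto
    then obtain e \<mu> where e: "e \<in> W" "e \<noteq> 0" "S e = \<mu> *\<^sub>R e"
      using symmetric_eigenvector[OF B sub _ S(1-3)] by blast
    \<comment> \<open>Kernel and image of \<open>S - \<mu>\<close> on \<open>W\<close> are invariant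
      under the family. \<open>F\<close> misses \<open>e\<close>, which is orthogonal to it, so the
      family is trivial on \<open>F\<close> by minimality; were \<open>E\<close> proper, it would be
      trivial there too.\<close>
    define E where "E = {w \<in> W. S w = \<mu> *\<^sub>R w}"
    define F where "F = (\<lambda>w. S w - \<mu> *\<^sub>R w) ` W"
    have linF: "linear (\<lambda>w. S w - \<mu> *\<^sub>R w)"
      using linear_add[OF S(1)] linear_cmul[OF S(1)] by (auto simp: linear_iff algebra_simps)
    have E: "subspace E" using sub linear_add[OF S(1)] linear_cmul[OF S(1)] linear_0[OF S(1)]
      unfolding E_def subspace_def by (auto simp: scaleR_add_right)
    have Einv: "Af b w \<in> E" if "w \<in> E" for b w
      using that inv S(4) linear_cmul[OF lin] by (auto simp: E_def)
    have F: "subspace F" unfolding F_def by (rule linear_subspace_image[OF linF sub])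
    have Finv: "Af b w \<in> F" if "w \<in> F" for b w
    proof -
      obtain u where u: "u \<in> W" "w = S u - \<mu> *\<^sub>R u" using \<open>w \<in> F\<close> by (auto simp: F_def)
      have "Af b w = S (Af b u) - \<mu> *\<^sub>R Af b u" using u S(4) linear_diff[OF lin] linear_cmul[OF lin] by simp
      then show ?thesis using inv u by (auto simp: F_def)
    qed
    have FW: "F \<subseteq> W" using S(2) sub by (auto simp: F_def subspace_diff subspace_scale)
    have "e \<notin> F"
    proof
      assume "e \<in> F"
      then obtain u where u: "e = S u - \<mu> *\<^sub>R u" by (auto simp: F_def)
      have "B e e = B (S u) e - \<mu> * B u e"
        by (subst (1) u) (simp add: bilinear_lsub[OF B(1)] bilinear_lmul[OF B(1)])
      also have "\<dots> = 0" by (simp add: S(3) e(3) bilinear_rmul[OF B(1)])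
      finally show False using B0 e(2) by blast
    qed
    then have FnW: "F \<noteq> W" using e(1) by blast
    have "E = W"
    proof (rule ccontr)
      assume "E \<noteq> W"
      then have tE: "Af c w = 0" if "w \<in> E" for c w using triv[OF E Einv] that by (auto simp: E_def)
      \<comment> \<open>\<open>S - \<mu>\<close> maps \<open>w0\<close> into \<open>F\<close>, where
        \<open>Af a\<close> vanishes, so \<open>Af a w0\<close> lies in \<open>E\<close> and is
        killed by \<open>Af a\<close>. Skewness then makes its length zero.\<close>
      have "Af a w0 = 0"
      proof (rule B0)
        have "S w0 - \<mu> *\<^sub>R w0 \<in> F" using aw by (auto simp: F_def)
        from triv[OF F Finv FW FnW this, of a] have "S (Af a w0) = \<mu> *\<^sub>R Af a w0"
          using S(4) linear_diff[OF lin] linear_cmul[OF lin] by simp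
        then have "Af a w0 \<in> E" using inv aw by (simp add: E_def)
        then have "Af a (Af a w0) = 0" by (rule tE)
        moreover have "B (Af a (Af a w0)) w0 = - B (Af a w0) (Af a w0)" by (rule skew)
        ultimately show "B (Af a w0) (Af a w0) = 0" by (simp add: bilinear_lzero[OF B(1)])
      qed
      then show False using aw by blast
    qed
    then show ?thesis by (auto simp: E_def)
  qed
  have prod: "\<exists>\<nu>. \<forall>w\<in>W. Af a (Af b w) = \<nu> *\<^sub>R w" for b
  proof (rule schur)
    show "linear (\<lambda>w. Af a (Af b w))" using linear_compose[OF lin[of b] lin[of a]] by (simp add: comp_def)
    show "B (Af a (Af b u)) v = B u (Af a (Af b v))" for u v
      by (simp add: skew comm[of a b])
    show "Af a (Af b (Af c v)) = Af c (Af a (Af b v))" for c v by (simp only: comm[of _ c])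
  qed (use inv in auto)
  \<comment> \<open>The square of \<open>Af a\<close> is a nonzero scalar on \<open>W\<close>, so
    \<open>Af a\<close> can be cancelled there; since \<open>Af a\<close> times \<open>Af b\<close>
    is scalar as well, the two operators are proportional.\<close>
  obtain \<mu> where \<mu>: "\<And>w. w \<in> W \<Longrightarrow> Af a (Af a w) = \<mu> *\<^sub>R w" using prod[of a] by blast
  have \<mu>0: "\<mu> \<noteq> 0"
  proof
    assume "\<mu> = 0"
    then have "B (Af a (Af a w0)) w0 = 0" using \<mu>[OF aw(1)] by (simp add: bilinear_lzero[OF B(1)])
    then have "B (Af a w0) (Af a w0) = 0" using skew[of a "Af a w0" w0] by simp
    then show False using B0 aw(2) by blast
  qed
  have "\<exists>r. Af b w0 = r *\<^sub>R Af a w0" for b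
  proof -
    obtain \<nu> where \<nu>: "\<And>w. w \<in> W \<Longrightarrow> Af a (Af b w) = \<nu> *\<^sub>R w" using prod[of b] by blast
    let ?u = "Af b w0 - (\<nu> / \<mu>) *\<^sub>R Af a w0"
    have uW: "?u \<in> W" using inv aw(1) sub by (simp add: subspace_diff subspace_scale)
    have "Af a ?u = 0"
      using \<nu>[OF aw(1)] \<mu>[OF aw(1)] \<mu>0 linear_diff[OF lin[of a]] linear_cmul[OF lin[of a]] by simp
    then have "\<mu> *\<^sub>R ?u = 0" using \<mu>[OF uW] linear_0[OF lin[of a]] by simp
    then have "?u = 0" using \<mu>0 by simp
    then show ?thesis by (intro exI[of _ "\<nu> / \<mu>"]) simp
  qed
  then show ?thesis using aw by blast
qed

section \<open>Linearization of the action at a fixed point\<close>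

locale torus_fixed_point = torus_action A g \<rho>
  for A :: "('m::{t2_space,second_countable_topology}, 'n::finite) chart set" and g
    and \<rho> :: "complex ^ 'k::finite \<Rightarrow> 'm \<Rightarrow> 'm" +
  fixes p d
  assumes fixed: "act t p = p" and d: "d \<in> A" and p: "p \<in> fst d"
begin

definition "x0 = snd d p"
text \<open>The isotropy representation at \<open>p\<close>, in the coordinates of \<open>d\<close>
  and lifted to the universal cover.\<close>

definition "L t u = dir_deriv (fl d d) (t, x0) (0, u)"
text \<open>The infinitesimal isotropy representation: the linear part of the velocity field at its
  zero.\<close>

definition "isot b u = dir_deriv (field_in d (vel b)) x0 u"

lemma x0: "x0 \<in> chart_image d" "chart_inv d x0 = p"
  using d p by (simp_all add: x0_def chart_in_image)

lemma x0_dom: "(t, x0) \<in> dom d d"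
  using x0 p fixed by (simp add: dom_def)

lemma fl_x0: "fl d d (t, x0) = x0"
  using x0 fixed by (simp add: fl_def x0_def)

lemma fl_in_image: "(t, x) \<in> dom d d \<Longrightarrow> fl d d (t, x) \<in> chart_image d"
  by (auto simp: dom_def fl_def chart_in_image)

lemma fl_inv: "(t, x) \<in> dom d d \<Longrightarrow> chart_inv d (fl d d (t, x)) = act t (chart_inv d x)"
  using d by (auto simp: dom_def fl_def)

lemma fl_compose:
  assumes "(s, x) \<in> dom d d"
  shows "(t, fl d d (s, x)) \<in> dom d d \<longleftrightarrow> (t + s, x) \<in> dom d d"
    and "fl d d (t, fl d d (s, x)) = fl d d (t + s, x)"
  using fl_in_image[OF assms] fl_inv[OF assms] assms by (auto simp: dom_def fl_def act_add)

lemma L_derivative: "((\<lambda>x. fl d d (t, x)) has_derivative L t) (at x0)"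
  using fl_space_derivative[OF d d x0_dom, of t] unfolding L_def by (simp add: fl_def comp_def)

lemma L_linear: "linear (L t)"
  using has_derivative_linear[OF L_derivative] .

lemma L_add: "L (s + t) u = L s (L t u)"
proof -
  have op: "open {x. (t, x) \<in> dom d d}"
  proof -
    have "open (Pair t -` dom d d)"
      by (rule open_vimage[OF open_dom[OF d d]]) (intro continuous_intros)
    then show ?thesis by (simp add: vimage_def)
  qed
  have "((\<lambda>x. fl d d (s, x)) has_derivative L s) (at (fl d d (t, x0)))"
    unfolding fl_x0 by (rule L_derivative)
  from has_derivative_compose[OF L_derivative this]
  have "((\<lambda>x. fl d d (s, fl d d (t, x))) has_derivative (\<lambda>u. L s (L t u))) (at x0)" .
  then have "((\<lambda>x. fl d d (s + t, x)) has_derivative (\<lambda>u. L s (L t u))) (at x0)"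
    by (rule has_derivative_transform_within_open[OF _ op]) (simp_all add: x0_dom fl_compose)
  from fun_cong[OF has_derivative_unique[OF this L_derivative], of u] show ?thesis by simp
qed

lemma L_zero [simp]: "L 0 u = u"
  using fl_zero_space_derivative[OF d x0(1)] by (simp add: L_def)

lemma fl_periodic: "(\<And>i. m $ i \<in> \<int>) \<Longrightarrow> fl d d (t + m, x) = fl d d (t, x)"
  by (simp add: fl_def act_diff_integral)

lemma L_periodic:
  assumes "\<And>i. m $ i \<in> \<int>"
  shows "L (t + m) = L t"
proof -
  have "((\<lambda>x. fl d d (t, x)) has_derivative L (t + m)) (at x0)"
    using L_derivative[of "t + m"] by (simp only: fl_periodic[OF assms])
  then show ?thesis by (rule has_derivative_unique[OF _ L_derivative])
qed

lemma continuous_L: "continuous_on S (\<lambda>t. L t u)"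
proof -
  have "continuous_on (dom d d) (\<lambda>z. dir_deriv (fl d d) z (0, u))"
    by (rule smooth_on_continuous[OF smooth_on_dir_deriv[OF fl_smooth[OF d d]]])
  then have "continuous_on S (\<lambda>t. dir_deriv (fl d d) (t, x0) (0, u))"
    by (rule continuous_on_compose2) (auto intro!: continuous_intros x0_dom)
  then show ?thesis by (simp add: L_def)
qed

lemma continuous_L_compose:
  assumes "continuous_on S f" "continuous_on S h"
  shows "continuous_on S (\<lambda>z. L (f z) (h z))"
proof -
  have c: "continuous_on S (\<lambda>z. L (f z) i)" for i
    using continuous_on_compose[OF assms(1) continuous_L] by (simp add: comp_def)
  have "L t w = (\<Sum>i\<in>Basis. (w \<bullet> i) *\<^sub>R L t i)" for t w
  proof -
    have "L t w = L t (\<Sum>i\<in>Basis. (w \<bullet> i) *\<^sub>R i)" by (simp only: euclidean_representation)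
    then show ?thesis by (simp only: linear_sum[OF L_linear] linear_cmul[OF L_linear])
  qed
  then have eq: "(\<lambda>z. L (f z) (h z)) = (\<lambda>z. \<Sum>i\<in>Basis. (h z \<bullet> i) *\<^sub>R L (f z) i)" by blast
  show ?thesis unfolding eq
    by (intro continuous_on_sum continuous_on_scaleR continuous_on_inner continuous_on_const assms(2) c)
qed

lemma isot_linear: "linear (isot b)"
proof -
  have "smooth_on (chart_image d) (field_in d (vel b))"
    using vel_smooth d by (simp add: smooth_vector_field_def)
  from has_derivative_linear[OF smooth_on_has_derivative[OF this open_image[OF d] x0(1)]]
  show ?thesis by (simp add: isot_def[abs_def])
qed

lemma L_time_derivative: "((\<lambda>t. L t u) has_derivative (\<lambda>b. isot b u)) (at 0)"
  using fl_mixed_derivative[OF d x0(1), of "(0, u)"] field_in_vel_derivative[OF d x0(1)]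
  by (simp add: L_def isot_def)

lemma isot_linear_left: "linear (\<lambda>b. isot b u)"
  using has_derivative_linear[OF L_time_derivative] .

lemma L_curve_derivative: "((\<lambda>\<tau>. L (\<tau> *\<^sub>R b) u) has_vector_derivative L (\<sigma> *\<^sub>R b) (isot b u)) (at \<sigma>)"
proof -
  have "((\<lambda>\<tau>. (\<tau> - \<sigma>) *\<^sub>R b) has_derivative (\<lambda>h. h *\<^sub>R b)) (at \<sigma>)" by (auto intro!: derivative_eq_intros)
  moreover have "((\<lambda>t. L t u) has_derivative (\<lambda>b. isot b u)) (at ((\<sigma> - \<sigma>) *\<^sub>R b))"
    using L_time_derivative by simp
  ultimately have "((\<lambda>\<tau>. L ((\<tau> - \<sigma>) *\<^sub>R b) u) has_derivative (\<lambda>h. isot (h *\<^sub>R b) u)) (at \<sigma>)"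
    by (rule has_derivative_compose)
  from bounded_linear.has_derivative[OF L_linear[unfolded linear_conv_bounded_linear] this, of "\<sigma> *\<^sub>R b"]
  have "((\<lambda>\<tau>. L (\<sigma> *\<^sub>R b) (L ((\<tau> - \<sigma>) *\<^sub>R b) u)) has_derivative (\<lambda>h. L (\<sigma> *\<^sub>R b) (isot (h *\<^sub>R b) u))) (at \<sigma>)" .
  then show ?thesis
    unfolding has_vector_derivative_def
    by (simp add: linear_cmul[OF isot_linear_left] linear_cmul[OF L_linear] scaleR_diff_left flip: L_add)
qed

lemma L_fixes_iff: "(\<forall>\<tau>. L (\<tau> *\<^sub>R b) u = u) \<longleftrightarrow> isot b u = 0"
proof
  assume *: "\<forall>\<tau>. L (\<tau> *\<^sub>R b) u = u"
  have "((\<lambda>\<tau>. u) has_vector_derivative isot b u) (at 0)"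
    using L_curve_derivative[of b u 0] * by simp
  then show "isot b u = 0" using vector_derivative_unique_at[OF _ has_vector_derivative_const] by blast
next
  assume *: "isot b u = 0"
  have D: "((\<lambda>\<tau>. L (\<tau> *\<^sub>R b) u) has_vector_derivative 0) (at \<sigma>)" for \<sigma>
    using L_curve_derivative[of b u \<sigma>] by (simp add: * linear_0[OF L_linear])
  obtain c where c: "\<And>\<tau>. \<tau> \<in> UNIV \<Longrightarrow> L (\<tau> *\<^sub>R b) u = c"
    using has_vector_derivative_zero_constant[of UNIV "\<lambda>\<tau>. L (\<tau> *\<^sub>R b) u"] D convex_UNIV by blast
  show "\<forall>\<tau>. L (\<tau> *\<^sub>R b) u = u" using c[of 0] c by simp
qed

lemma isot_L: "isot b (L t u) = L t (isot b u)"
proof -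
  have "L (\<tau> *\<^sub>R b) (L t u) = L t (L (\<tau> *\<^sub>R b) u)" for \<tau> by (simp add: add.commute flip: L_add)
  then have "((\<lambda>\<tau>. L t (L (\<tau> *\<^sub>R b) u)) has_vector_derivative isot b (L t u)) (at 0)"
    using L_curve_derivative[of b "L t u" 0] by simp
  moreover have "((\<lambda>\<tau>. L t (L (\<tau> *\<^sub>R b) u)) has_vector_derivative L t (isot b u)) (at 0)"
    using bounded_linear.has_vector_derivative[OF L_linear[unfolded linear_conv_bounded_linear] L_curve_derivative[of b u 0]]
    by simp
  ultimately show ?thesis by (rule vector_derivative_unique_at)
qed

lemma isot_commute: "isot a (isot b u) = isot b (isot a u)"
proof -
  have "((\<lambda>\<tau>. isot b (L (\<tau> *\<^sub>R a) u)) has_vector_derivative isot b (isot a u)) (at 0)"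
    using bounded_linear.has_vector_derivative[OF isot_linear[unfolded linear_conv_bounded_linear] L_curve_derivative[of a u 0]]
    by simp
  moreover have "((\<lambda>\<tau>. isot b (L (\<tau> *\<^sub>R a) u)) has_vector_derivative isot a (isot b u)) (at 0)"
    using L_curve_derivative[of a "isot b u" 0] by (simp add: isot_L)
  ultimately show ?thesis by (rule vector_derivative_unique_at[symmetric])
qed

text \<open>The field vanishes at \<open>x0\<close>, so the Christoffel term drops out and its
  covariant derivative there is \<open>isot b\<close>.\<close>

lemma isot_skew: "metric_in A g d x0 (isot b u) v = - metric_in A g d x0 u (isot b v)"
proof -
  interpret lm: local_metric "chart_image d" "metric_in A g d" by (rule chart_local_metric[OF d])
  have "field_in d (vel b) x0 = 0"
    using vel_zero_if_fixed[of b p] fixed d p by (simp add: x0_def)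
  then have "lm.cov (field_in d (vel b)) x0 = isot b"
    by (simp add: lm.cov_def isot_def fun_eq_iff lm.\<Gamma>_simps[OF x0(1)])
  then show ?thesis
    using lm.killing_skew[OF killing_field_local[OF vel_killing d] x0(1), of b u v] by simp
qed

text \<open>For an action that is linear about \<open>x0\<close> this would be \<open>x - x0\<close>
  for every \<open>t\<close>. Undoing the linear part after the move is what makes the average
  equivariant.\<close>

definition "lin t x = L (- t) (fl d d (t, x) - x0)"

text \<open>A tube lemma over the unit box, which is compact and represents the whole torus.\<close>

lemma uniform_radius:
  fixes W :: "((real ^ 'k) \<times> (real ^ 'n)) set"
  assumes "open W" "\<And>t. (t, x0) \<in> W"
  shows "\<exists>\<delta>>0. \<forall>t\<in>cbox 0 One. \<forall>x\<in>ball x0 \<delta>. (t, x) \<in> W"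
proof -
  have K: "compact (cbox 0 One \<times> {x0} :: ((real ^ 'k) \<times> (real ^ 'n)) set)" by (intro compact_Times) auto
  have KW: "cbox 0 One \<times> {x0} \<subseteq> W" using assms(2) by auto
  obtain e where e: "e > 0" "(\<Union>z\<in>cbox 0 One \<times> {x0}. ball z e) \<subseteq> W"
    by (rule compact_subset_open_imp_ball_epsilon_subset[OF K assms(1) KW])
  have "(t, x) \<in> W" if "t \<in> cbox 0 One" "x \<in> ball x0 e" for t x
  proof -
    have "(t, x) \<in> ball (t, x0) e" using that(2) by (simp add: dist_Pair_Pair)
    then show ?thesis using e(2) that(1) by blast
  qed
  then show ?thesis using e(1) by blast
qed

lemma reduce_to_box: "\<exists>t'\<in>cbox 0 One. \<exists>m. t = t' + m \<and> (\<forall>i. m $ i \<in> \<int>)" for t :: "real ^ 'k"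
proof -
  define t' where "t' = (\<chi> i. frac (t $ i))"
  define m :: "real ^ 'k" where "m = (\<chi> i. of_int \<lfloor>t $ i\<rfloor>)"
  have "t = t' + m" by (simp add: t'_def m_def vec_eq_iff frac_def)
  moreover have "t' \<in> cbox 0 One"
    using frac_lt_1[of "t $ _"] by (auto simp: mem_box Basis_vec_def inner_axis t'_def less_imp_le inner_Basis inner_sum_left)
  moreover have "\<forall>i. m $ i \<in> \<int>" by (simp add: m_def)
  ultimately show ?thesis by blast
qed

lemma dom_periodic: "(\<And>i. m $ i \<in> \<int>) \<Longrightarrow> (t + m, x) \<in> dom d d \<longleftrightarrow> (t, x) \<in> dom d d"
  by (simp add: dom_def act_diff_integral)

text \<open>The derivative of \<open>lin t\<close> at \<open>x0\<close> is the identity. By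
  compactness it stays within 1/2 of the identity on one ball for all \<open>t\<close> in the box,
  and the mean value inequality gives the estimate.\<close>

lemma contraction_radius:
  "\<exists>\<delta>>0. (\<forall>t. \<forall>x\<in>ball x0 \<delta>. (t, x) \<in> dom d d) \<and>
    (\<forall>t\<in>cbox 0 One. \<forall>x\<in>ball x0 \<delta>. \<forall>y\<in>ball x0 \<delta>. norm (lin t x - lin t y - (x - y)) \<le> norm (x - y) / 2)"
proof -
  let ?n = "real DIM(real ^ 'n)"
  \<comment> \<open>The deviation from the identity on one basis vector. A bound of
    \<open>1 / (2 * n)\<close> on each of the \<open>n\<close> basis vectors keeps the operator norm
    of the deviation at most 1/2.\<close>
  define f where "f i z = norm (L (- fst z) (dir_deriv (fl d d) z (0, i)) - i)" for i z
  define W where "W = (\<Inter>i\<in>Basis. {z \<in> dom d d. f i z \<in> {..< 1 / (2 * ?n)}})"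
  have cf: "continuous_on (dom d d) (f i)" for i
    unfolding f_def
    by (intro continuous_intros continuous_L_compose smooth_on_continuous[OF smooth_on_dir_deriv[OF fl_smooth[OF d d]]])
  have "open W" unfolding W_def
  proof (rule open_INT[OF finite_Basis], rule ballI)
    fix i :: "real ^ 'n"
    show "open {z \<in> dom d d. f i z \<in> {..< 1 / (2 * ?n)}}"
      using continuous_open_preimage[OF cf open_dom[OF d d] open_lessThan, of i "1 / (2 * ?n)"]
      by (simp add: vimage_def Int_def)
  qed
  moreover have "(t, x0) \<in> W" for t
  proof -
    have "f i (t, x0) = 0" for i
      by (simp add: f_def flip: L_def L_add)
    then show ?thesis by (simp add: W_def x0_dom)
  qed
  ultimately obtain \<delta> where \<delta>: "\<delta> > 0" "\<And>t x. t \<in> cbox 0 One \<Longrightarrow> x \<in> ball x0 \<delta> \<Longrightarrow> (t, x) \<in> W"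
    using uniform_radius[of W] by blast
  have W: "(t, x) \<in> dom d d" "i \<in> Basis \<Longrightarrow> f i (t, x) < 1 / (2 * ?n)" if "(t, x) \<in> W" for t x i
  proof -
    have "\<forall>i\<in>Basis. (t, x) \<in> dom d d \<and> f i (t, x) < 1 / (2 * ?n)" using that by (simp add: W_def)
    then show "(t, x) \<in> dom d d" "i \<in> Basis \<Longrightarrow> f i (t, x) < 1 / (2 * ?n)" using SOME_Basis by blast+
  qed
  have dm: "(t, x) \<in> dom d d" if x: "x \<in> ball x0 \<delta>" for t x
  proof -
    obtain t' m where t': "t' \<in> cbox 0 One" "t = t' + m" "\<forall>i. m $ i \<in> \<int>" using reduce_to_box by blast
    show ?thesis using W(1)[OF \<delta>(2)[OF t'(1) x]] dom_periodic[of m t' x] t' by simp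
  qed
  have "norm (lin t x - lin t y - (x - y)) \<le> norm (x - y) / 2"
    if t: "t \<in> cbox 0 One" and xy: "x \<in> ball x0 \<delta>" "y \<in> ball x0 \<delta>" for t x y
  proof -
    let ?D = "\<lambda>x u. L (- t) (dir_deriv (fl d d) (t, x) (0, u)) - u"
    have D: "((\<lambda>x. lin t x - x) has_derivative ?D x) (at x)" if x: "x \<in> ball x0 \<delta>" for x
    proof -
      have "((\<lambda>x. fl d d (t, x) - x0) has_derivative (\<lambda>u. dir_deriv (fl d d) (t, x) (0, u) - 0)) (at x)"
        using fl_space_derivative[OF d d dm[OF x], of t]
        by (intro has_derivative_diff has_derivative_const) (simp add: fl_def comp_def)
      from has_derivative_diff[OF bounded_linear.has_derivative[OF L_linear[unfolded linear_conv_bounded_linear] this] has_derivative_ident, of "-t"]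
      show ?thesis by (simp add: lin_def)
    qed
    have on: "onorm (?D x) \<le> 1 / 2" if x: "x \<in> ball x0 \<delta>" for x
    proof (rule onorm_le)
      fix u
      define D' where "D' = ?D x"
      have D': "linear D'" unfolding D'_def using has_derivative_linear[OF D[OF x]] .
      have "D' u = D' (\<Sum>i\<in>Basis. (u \<bullet> i) *\<^sub>R i)" by (simp only: euclidean_representation)
      also have "\<dots> = (\<Sum>i\<in>Basis. (u \<bullet> i) *\<^sub>R D' i)"
        by (simp only: linear_sum[OF D'] linear_cmul[OF D'])
      finally have "norm (?D x u) = norm (\<Sum>i\<in>Basis. (u \<bullet> i) *\<^sub>R ?D x i)"
        by (simp only: D'_def)
      also have "\<dots> \<le> (\<Sum>i\<in>(Basis :: (real ^ 'n) set). norm u * (1 / (2 * ?n)))"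
      proof (rule order_trans[OF norm_sum sum_mono])
        fix i :: "real ^ 'n" assume i: "i \<in> Basis"
        have "norm ((u \<bullet> i) *\<^sub>R ?D x i) = \<bar>u \<bullet> i\<bar> * f i (t, x)" by (simp add: f_def)
        also have "\<dots> \<le> norm u * (1 / (2 * ?n))"
          using Basis_le_norm[OF i, of u] W(2)[OF \<delta>(2)[OF t x] i]
          by (intro mult_mono) (auto simp: f_def)
        finally show "norm ((u \<bullet> i) *\<^sub>R ?D x i) \<le> norm u * (1 / (2 * ?n))" .
      qed
      also have "\<dots> = 1 / 2 * norm u" by simp
      finally show "norm (?D x u) \<le> 1 / 2 * norm u" .
    qed
    have "norm ((lin t x - x) - (lin t y - y)) \<le> 1 / 2 * norm (x - y)"
      by (rule differentiable_bound[of "ball x0 \<delta>" _ ?D])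
        (use xy D on in \<open>auto intro: has_derivative_at_withinI\<close>)
    moreover have "(lin t x - x) - (lin t y - y) = lin t x - lin t y - (x - y)" by simp
    ultimately show ?thesis by simp
  qed
  then show ?thesis using \<delta>(1) dm by blast
qed

text \<open>Averaging a chart over the torus yields local coordinates in which the action is linear.\<close>

definition "avg x = integral (cbox 0 One) (\<lambda>t. lin t x)"

text \<open>The box has measure 1, so the estimate for \<open>lin\<close> survives averaging:
  \<open>avg\<close> differs from a translation by a map of Lipschitz constant 1/2, hence is
  injective and continuous. The second radius keeps entire orbits inside the first ball, where
  \<open>avg\<close> is injective.\<close>

lemma linearization:
  "\<exists>\<delta>>0. \<exists>\<delta>'>0. \<delta>' \<le> \<delta> \<and> (\<forall>t. \<forall>x\<in>ball x0 \<delta>. (t, x) \<in> dom d d) \<and> inj_on avg (ball x0 \<delta>) \<and>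
     continuous_on (ball x0 \<delta>) avg \<and> avg x0 = 0 \<and>
     (\<forall>s. \<forall>x\<in>ball x0 \<delta>'. fl d d (s, x) \<in> ball x0 \<delta> \<and> avg (fl d d (s, x)) = L s (avg x))"
proof -
  obtain \<delta> where \<delta>: "\<delta> > 0" and dm: "\<And>t x. x \<in> ball x0 \<delta> \<Longrightarrow> (t, x) \<in> dom d d"
    and contr: "\<And>t x y. t \<in> cbox 0 One \<Longrightarrow> x \<in> ball x0 \<delta> \<Longrightarrow> y \<in> ball x0 \<delta> \<Longrightarrow>
      norm (lin t x - lin t y - (x - y)) \<le> norm (x - y) / 2"
    using contraction_radius by blast
  have clin: "continuous_on S (\<lambda>t. lin t x)" if "x \<in> ball x0 \<delta>" for x S
    unfolding lin_def
    by (intro continuous_L_compose continuous_intros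
        continuous_on_compose2[OF smooth_on_continuous[OF fl_smooth[OF d d]]]) (auto simp: dm[OF that])
  have int: "(\<lambda>t. lin t x) integrable_on cbox 0 One" if "x \<in> ball x0 \<delta>" for x
    by (rule integrable_continuous[OF clin[OF that]])
  have est: "norm (avg x - avg y - (x - y)) \<le> norm (x - y) / 2" if xy: "x \<in> ball x0 \<delta>" "y \<in> ball x0 \<delta>" for x y
  proof -
    have "((\<lambda>t. x - y) has_integral (x - y)) (cbox 0 One :: (real ^ 'k) set)"
      using has_integral_const[of "x - y" 0 "One :: real ^ 'k"] by simp
    moreover have "((\<lambda>t. lin t x - lin t y) has_integral (avg x - avg y)) (cbox 0 One)"
      unfolding avg_def by (intro has_integral_diff integrable_integral int xy)
    ultimately have "((\<lambda>t. lin t x - lin t y - (x - y)) has_integral (avg x - avg y - (x - y))) (cbox 0 One)"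
      by (rule has_integral_diff[rotated])
    then have "norm (avg x - avg y - (x - y)) \<le> norm (x - y) / 2 * measure lborel (cbox 0 One :: (real ^ 'k) set)"
      by (rule has_integral_bound[rotated]) (use contr[OF _ xy] in auto)
    then show ?thesis by simp
  qed
  have inj: "inj_on avg (ball x0 \<delta>)"
  proof (rule inj_onI)
    fix x y assume xy: "x \<in> ball x0 \<delta>" "y \<in> ball x0 \<delta>" "avg x = avg y"
    then have "norm (x - y) \<le> norm (x - y) / 2" using est[OF xy(1,2)] by (simp add: norm_minus_commute)
    then show "x = y" by simp
  qed
  have cont: "continuous_on (ball x0 \<delta>) avg"
  proof (rule continuous_on_iff[THEN iffD2], intro ballI allI impI)
    fix x and e :: real assume x: "x \<in> ball x0 \<delta>" and e: "e > 0"
    have "dist (avg y) (avg x) < e" if y: "y \<in> ball x0 \<delta>" "dist y x < e / 2" for y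
    proof -
      have "norm (avg y - avg x) \<le> norm (avg y - avg x - (y - x)) + norm (y - x)"
        by (metis diff_add_cancel norm_triangle_ineq)
      also have "\<dots> \<le> norm (y - x) / 2 + norm (y - x)" using est[OF y(1) x] by simp
      also have "\<dots> < e" using y(2) e by (simp add: dist_norm)
      finally show ?thesis by (simp add: dist_norm)
    qed
    then show "\<exists>r>0. \<forall>y\<in>ball x0 \<delta>. dist y x < r \<longrightarrow> dist (avg y) (avg x) < e"
      using e by (intro exI[of _ "e / 2"]) auto
  qed
  have avg0: "avg x0 = 0" by (simp add: avg_def lin_def fl_x0 linear_0[OF L_linear])
  define W where "W = {z \<in> dom d d. fl d d z \<in> ball x0 \<delta>}"
  have "open W" unfolding W_def
    using continuous_open_preimage[OF smooth_on_continuous[OF fl_smooth[OF d d]] open_dom[OF d d] open_ball, of x0 \<delta>]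
    by (simp add: vimage_def Int_def)
  moreover have "(t, x0) \<in> W" for t using \<delta> by (simp add: W_def x0_dom fl_x0)
  ultimately obtain \<delta>1 where \<delta>1: "\<delta>1 > 0" "\<And>t x. t \<in> cbox 0 One \<Longrightarrow> x \<in> ball x0 \<delta>1 \<Longrightarrow> (t, x) \<in> W"
    using uniform_radius[of W] by blast
  define \<delta>' where "\<delta>' = min \<delta> \<delta>1"
  have stay: "fl d d (s, x) \<in> ball x0 \<delta>" if x: "x \<in> ball x0 \<delta>'" for s x
  proof -
    obtain t' m where t': "t' \<in> cbox 0 One" "s = t' + m" "\<And>i. m $ i \<in> \<int>" using reduce_to_box[of s] by blast
    have "x \<in> ball x0 \<delta>1" using x by (simp add: \<delta>'_def)
    then have "fl d d (t', x) \<in> ball x0 \<delta>" using \<delta>1(2)[OF t'(1)] by (simp add: W_def)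
    then show ?thesis using fl_periodic[of m t' x] t' by simp
  qed
  have equi: "avg (fl d d (s, x)) = L s (avg x)" if x: "x \<in> ball x0 \<delta>'" for s x
  proof -
    have x\<delta>: "x \<in> ball x0 \<delta>" using x by (simp add: \<delta>'_def)
    \<comment> \<open>As \<open>L (- t)\<close> is \<open>L s\<close> after
      \<open>L (- (t + s))\<close>, moving \<open>x\<close> by \<open>s\<close> amounts to a time
      shift of the integrand, which the periodic integral does not see.\<close>
    have "lin t (fl d d (s, x)) = L s (lin (t + s) x)" for t
      by (simp add: lin_def fl_compose[OF dm[OF x\<delta>]] flip: L_add)
    then have "avg (fl d d (s, x)) = integral (cbox 0 One) (\<lambda>t. L s (lin (t + s) x))" by (simp add: avg_def)
    also have "\<dots> = L s (integral (cbox 0 One) (\<lambda>t. lin (t + s) x))"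
    proof (rule integral_linear[OF _ L_linear[unfolded linear_conv_bounded_linear], unfolded comp_def])
      show "(\<lambda>t. lin (t + s) x) integrable_on cbox 0 One"
        by (intro integrable_continuous continuous_on_compose2[OF clin[OF x\<delta>, of UNIV]] continuous_intros) auto
    qed
    also have "integral (cbox 0 One) (\<lambda>t. lin (t + s) x) = avg x"
      unfolding avg_def
    proof (rule integral_periodic_shift[OF clin[OF x\<delta>]])
      fix t k :: "real ^ 'k" assume "k \<in> Basis"
      then obtain j where "k = axis j 1" by (auto simp: Basis_vec_def)
      then have k: "\<And>i. k $ i \<in> \<int>" "\<And>i. (- k) $ i \<in> \<int>" by (simp_all add: axis_def)
      have "L (- (t + k)) = L (- t)" using L_periodic[of "- k" "- t"] k(2) by simp
      then show "lin (t + k) x = lin t x" using fl_periodic[of k t x] k(1) by (simp add: lin_def)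
    qed
    finally show ?thesis .
  qed
  show ?thesis
    using \<delta> \<delta>1(1) dm inj cont avg0 stay equi
    by (intro exI[of _ \<delta>] conjI exI[of _ \<delta>']) (auto simp: \<delta>'_def)
qed

text \<open>In the coordinates \<open>avg\<close> the action near \<open>p\<close> is its isotropy
  representation. A vector on which all infinitesimal isotropy operators are proportional, scaled
  into the range of \<open>avg\<close>, therefore gives the point sought.\<close>

lemma nearby_one_dimensional_orbit:
  assumes nontriv: "\<And>U. open U \<Longrightarrow> p \<in> U \<Longrightarrow> \<exists>q\<in>U. \<exists>t. act t q \<noteq> q"
  shows "\<exists>q a. vel a q \<noteq> (\<lambda>_. 0) \<and> (\<forall>b. \<exists>r. vel b q = (\<lambda>e. r *\<^sub>R vel a q e))"
proof -
  obtain \<delta> \<delta>' where \<delta>: "\<delta> > 0" "\<delta>' > 0" "\<delta>' \<le> \<delta>"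
    and dm: "\<And>t x. x \<in> ball x0 \<delta> \<Longrightarrow> (t, x) \<in> dom d d"
    and inj: "inj_on avg (ball x0 \<delta>)" and cont: "continuous_on (ball x0 \<delta>) avg" and avg0: "avg x0 = 0"
    and stay: "\<And>s x. x \<in> ball x0 \<delta>' \<Longrightarrow> fl d d (s, x) \<in> ball x0 \<delta>"
    and equi: "\<And>s x. x \<in> ball x0 \<delta>' \<Longrightarrow> avg (fl d d (s, x)) = L s (avg x)"
    using linearization by blast
  have sub: "ball x0 \<delta>' \<subseteq> ball x0 \<delta>" using \<delta>(3) by auto
  have key: "act s (chart_inv d x) = chart_inv d x \<longleftrightarrow> L s (avg x) = avg x" if x: "x \<in> ball x0 \<delta>'" for s x
  proof -
    have xd: "(s, x) \<in> dom d d" "x \<in> chart_image d" using dm[of x s] sub x by (auto simp: dom_def)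
    have "act s (chart_inv d x) = chart_inv d x \<longleftrightarrow> fl d d (s, x) = x"
      using fl_inv[OF xd(1)] xd(2) d by (auto simp: fl_def)
    also have "\<dots> \<longleftrightarrow> avg (fl d d (s, x)) = avg x"
      using inj_on_eq_iff[OF inj stay[OF x]] sub x by blast
    finally show ?thesis by (simp only: equi[OF x])
  qed
  interpret lm: local_metric "chart_image d" "metric_in A g d" by (rule chart_local_metric[OF d])
  \<comment> \<open>A trivial infinitesimal representation would make \<open>L\<close> trivial and
    fix all points near \<open>p\<close>.\<close>
  have "\<exists>b u. isot b u \<noteq> 0"
  proof (rule ccontr)
    assume "\<not> ?thesis"
    then have Lid: "L s u = u" for s u using L_fixes_iff[of s u] by (metis scaleR_one)
    define U where "U = {q \<in> fst d. snd d q \<in> ball x0 \<delta>'}"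
    have "open U" unfolding U_def by (rule open_chart_domain_preimage[OF d open_ball])
    moreover have "p \<in> U" using p \<delta>(2) by (simp add: U_def x0_def)
    ultimately obtain q t where q: "q \<in> U" "act t q \<noteq> q" using nontriv by blast
    then have "snd d q \<in> ball x0 \<delta>'" "chart_inv d (snd d q) = q" using d by (auto simp: U_def)
    then show False using key[of "snd d q" t] Lid q(2) by simp
  qed
  then obtain v a where v: "isot a v \<noteq> 0" "\<And>b. \<exists>r. isot b v = r *\<^sub>R isot a v"
    using commuting_skew_family_plane[OF lm.bilin[OF x0(1)] lm.sym[OF x0(1)] lm.pos[OF x0(1)], of isot]
      isot_linear isot_skew isot_commute by metis
  \<comment> \<open>\<open>avg\<close> is known to be continuous and injective, so invariance of
    domain supplies the openness.\<close>
  have "open (avg ` ball x0 \<delta>')"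
    by (rule invariance_of_domain[OF continuous_on_subset[OF cont sub] open_ball inj_on_subset[OF inj sub]])
  moreover have "0 \<in> avg ` ball x0 \<delta>'" using avg0 \<delta>(2) by (metis centre_in_ball image_eqI)
  ultimately obtain e where e: "e > 0" "ball 0 e \<subseteq> avg ` ball x0 \<delta>'" using open_contains_ball by blast
  have v0: "v \<noteq> 0" using v(1) linear_0[OF isot_linear] by auto
  define c where "c = e / (2 * norm v)"
  have c: "c > 0" "norm (c *\<^sub>R v) < e" using e(1) v0 by (auto simp: c_def)
  have "c *\<^sub>R v \<in> ball 0 e" using c(2) by simp
  then have "c *\<^sub>R v \<in> avg ` ball x0 \<delta>'" using e(2) by blast
  then obtain x where x: "x \<in> ball x0 \<delta>'" "avg x = c *\<^sub>R v" by (elim imageE) simp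
  define q where "q = chart_inv d x"
  \<comment> \<open>Vanishing velocity is rephrased as being fixed by a one-parameter group, a
    condition that \<open>key\<close> carries over from the action to \<open>L\<close>.\<close>
  have velq: "vel b q = (\<lambda>_. 0) \<longleftrightarrow> isot b v = 0" for b
  proof -
    have "vel b q = (\<lambda>_. 0) \<longleftrightarrow> (\<forall>\<tau>. act (\<tau> *\<^sub>R b) q = q)"
      using fixed_if_vel_zero[of b q] vel_zero_if_fixed[of b q] by blast
    also have "\<dots> \<longleftrightarrow> (\<forall>\<tau>. L (\<tau> *\<^sub>R b) (avg x) = avg x)" unfolding q_def key[OF x(1)] ..
    also have "\<dots> \<longleftrightarrow> isot b (avg x) = 0" by (rule L_fixes_iff)
    also have "\<dots> \<longleftrightarrow> isot b v = 0" using c(1) by (simp add: x(2) linear_cmul[OF isot_linear])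
    finally show ?thesis .
  qed
  have "\<exists>r. vel b q = (\<lambda>e. r *\<^sub>R vel a q e)" for b
  proof -
    obtain r where r: "isot b v = r *\<^sub>R isot a v" using v(2) by blast
    then have "isot (b - r *\<^sub>R a) v = 0"
      using linear_diff[OF isot_linear_left, of b "r *\<^sub>R a" v] linear_cmul[OF isot_linear_left, of r a v] by simp
    then show ?thesis using velq vel_diff_zero_iff by blast
  qed
  then show ?thesis using velq[of a] v(1) by blast
qed

end

section \<open>Fixed points and circle orbits\<close>

context riemannian_manifold
begin

lemma killing_zero: "killing_field A g (\<lambda>_ _. 0)"
  unfolding killing_field_def smooth_vector_field_def
proof (intro conjI allI ballI impI zero_in_tangent_space)
  have f: "field_in c (\<lambda>_ _. 0) = (\<lambda>_. 0)" for c :: "('m, 'n) chart" by (simp add: field_in_def fun_eq_iff)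
  show "smooth_on (chart_image c) (field_in c (\<lambda>_ _. 0))" for c :: "('m, 'n) chart"
    unfolding f by (rule smooth_on_const)
  fix p V W c assume c: "c \<in> A" "p \<in> fst c"
  interpret local_metric "chart_image c" "metric_in A g c" by (rule chart_local_metric[OF c(1)])
  have x: "snd c p \<in> chart_image c" by (rule chart_in_image[OF c(2)])
  have "frechet_derivative (\<lambda>_ :: real ^ 'n. 0 :: real ^ 'n) (at (snd c p)) = (\<lambda>_. 0)"
    using frechet_derivative_at[OF has_derivative_const] by metis
  then show "lie_deriv A g (\<lambda>_ _. 0) c p V W = 0"
    unfolding lie_deriv_def f lie_deriv_cov[OF smooth_on_const x]
    by (simp add: cov_def G_simps[OF x] \<Gamma>_simps[OF x])
qed

lemma commuting_zero:
  assumes "smooth_vector_field A Y"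
  shows "commuting_fields Y (\<lambda>_ _. 0)"
  unfolding commuting_fields_def
proof (intro ballI)
  fix c x assume c: "c \<in> A" "x \<in> chart_image c"
  have f: "field_in c (\<lambda>_ _. 0) = (\<lambda>_. 0)" by (simp add: field_in_def fun_eq_iff)
  have "frechet_derivative (\<lambda>_ :: real ^ 'n. 0 :: real ^ 'n) (at x) = (\<lambda>_. 0)"
    using frechet_derivative_at[OF has_derivative_const] by metis
  moreover have "dir_deriv (field_in c Y) x 0 = 0"
    using linear_0[OF linear_frechet_derivative[OF field_differentiable[OF assms c]]] .
  ultimately show "dir_deriv (field_in c Y) x (field_in c (\<lambda>_ _. 0) x) = dir_deriv (field_in c (\<lambda>_ _. 0)) x (field_in c Y x)"
    by (simp add: f)
qed

theorem killing_field_has_zero: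
  assumes "smooth_vector_field A X" "positive_weighted_sec A g X" "compact (UNIV :: 'm set)"
    and "even CARD('n)" "killing_field A g K"
  shows "\<exists>p. is_zero_of K p"
proof -
  have "smooth_vector_field A K" using assms(5) by (simp add: killing_field_def)
  from berger[OF assms(1,2,3) open_UNIV UNIV_not_empty assms(5) killing_zero commuting_zero[OF this]] assms(4)
  show ?thesis by (auto simp: is_zero_of_def)
qed

end

context torus_action
begin

text \<open>The limit argument with \<open>a = 0\<close>. Read contrapositively, it provides the
  nowhere zero field of the odd case: if no point of \<open>C\<close> is fixed, some integral
  direction has no zero on \<open>C\<close>.\<close>

lemma global_fixed_point:
  assumes "compact C" "\<And>b. (\<And>i. b $ i \<in> \<int>) \<Longrightarrow> \<exists>p\<in>C. vel b p = (\<lambda>_. 0)"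
  shows "\<exists>p\<in>C. \<forall>t. act t p = p"
proof -
  have "\<exists>p\<in>C. \<forall>s. \<exists>\<tau>::real. act (s - \<tau> *\<^sub>R 0) p = p"
  proof (rule limit_of_dependent_points[OF assms(1)])
    fix b :: "real ^ 'k" assume "\<And>i. b $ i \<in> \<int>"
    then obtain p where "p \<in> C" "vel b p = (\<lambda>_. 0)" using assms(2) by blast
    then show "\<exists>p\<in>C. \<exists>r. vel b p = (\<lambda>d. r *\<^sub>R vel 0 p d)" by (intro bexI[of _ p] exI[of _ 0]) simp_all
  qed simp
  then show ?thesis by simp
qed

lemma one_dimensional_orbit_odd:
  assumes "smooth_vector_field A X" "positive_weighted_sec A g X" and C: "compact C" "open C" "C \<noteq> {}"
    and "odd CARD('n)" and nofix: "\<And>p. p \<in> C \<Longrightarrow> \<exists>t. act t p \<noteq> p"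
  shows "\<exists>p\<in>C. \<exists>a. vel a p \<noteq> (\<lambda>_. 0) \<and> (\<forall>b. \<exists>r. vel b p = (\<lambda>d. r *\<^sub>R vel a p d))"
proof -
  obtain a where a: "\<And>i. a $ i \<in> \<int>" "\<And>p. p \<in> C \<Longrightarrow> vel a p \<noteq> (\<lambda>_. 0)"
    using global_fixed_point[OF C(1)] nofix by blast
  have "\<exists>p\<in>C. \<exists>r. vel b p = (\<lambda>d. r *\<^sub>R vel a p d)" for b
    by (rule berger[OF assms(1,2) C vel_killing vel_killing vel_commuting])
      (use a(2) assms(6) in \<open>simp add: is_zero_of_def\<close>)
  then obtain p where p: "p \<in> C" "\<And>s. \<exists>\<tau>. act (s - \<tau> *\<^sub>R a) p = p"
    using limit_of_dependent_points[OF C(1) a(1)] by blast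
  have "\<exists>r. vel b p = (\<lambda>d. r *\<^sub>R vel a p d)" for b
    by (rule vel_parallel[OF a(2)[OF p(1)] a(1) p(2)])
  then show ?thesis using p(1) a(2) by blast
qed

lemma closed_fixed_points: "closed {p. \<forall>t. act t p = p}"
proof -
  have "closed {p. act t p = p}" for t
    by (intro closed_Collect_eq continuous_act_compose continuous_on_const continuous_on_id)
  then have "closed (\<Inter>t. {p. act t p = p})" by blast
  moreover have "(\<Inter>t. {p. act t p = p}) = {p. \<forall>t. act t p = p}" by blast
  ultimately show ?thesis by simp
qed

theorem circle_orbit:
  assumes X: "smooth_vector_field A X" "positive_weighted_sec A g X" and compact: "compact (UNIV :: 'm set)"
    and odd: "odd CARD('n)" and nontriv: "nontrivial_action \<rho>"
  shows "has_circle_orbit \<rho>"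
proof -
  define F where "F = {p. \<forall>t. act t p = p}"
  have "\<exists>p a. vel a p \<noteq> (\<lambda>_. 0) \<and> (\<forall>b. \<exists>r. vel b p = (\<lambda>d. r *\<^sub>R vel a p d))"
  proof (cases "open F")
    case True
    \<comment> \<open>Since \<open>F\<close> is open and closed, its complement is a compact open
      set without fixed points, to which the odd case applies.\<close>
    have "compact (- F)"
      using compact_Int_closed[OF compact, of "- F"] True by (simp add: closed_Compl)
    moreover have "open (- F)" using closed_fixed_points by (simp add: F_def open_Compl)
    moreover have "- F \<noteq> {}"
    proof -
      obtain z p where zp: "z \<in> carrier (torus UNIV)" "\<rho> z p \<noteq> p"
        using nontriv unfolding nontrivial_action_def by blast
      obtain t where "torus_exp t = z" using torus_exp_surj zp(1) by blast
      then have "p \<notin> F" using zp(2) by (auto simp: F_def act_def)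
      then show ?thesis by blast
    qed
    ultimately show ?thesis
      using one_dimensional_orbit_odd[OF X, of "- F"] odd by (auto simp: F_def)
  next
    case False
    \<comment> \<open>A fixed point with moved points in each of its neighbourhoods.\<close>
    then obtain p where pF: "p \<in> F" and boundary: "\<And>U. open U \<Longrightarrow> p \<in> U \<Longrightarrow> \<not> U \<subseteq> F"
      by (subst (asm) open_subopen) blast
    obtain d where "d \<in> A" "p \<in> fst d" by (rule ex_chart)
    then interpret torus_fixed_point A g \<rho> p d
      using pF by unfold_locales (auto simp: F_def)
    have "\<exists>q\<in>U. \<exists>t. act t q \<noteq> q" if "open U" "p \<in> U" for U
      using boundary[OF that] unfolding F_def by blast
    then show ?thesis by (rule nearby_one_dimensional_orbit)
  qed
  then show ?thesis unfolding has_circle_orbit_def using one_dimensional_orbit(1) by blast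
qed

theorem codim_one_subtorus_fixed_point:
  assumes X: "smooth_vector_field A X" "positive_weighted_sec A g X" and compact: "compact (UNIV :: 'm set)"
    and odd: "odd CARD('n)"
  shows "\<exists>H. codim_one_subtorus H \<and> has_fixed_point H \<rho>"
proof (cases "\<exists>p. \<forall>t. act t p = p")
  case True
  then obtain p where p: "\<forall>z\<in>carrier (torus UNIV). \<rho> z p = p" using fixed_iff by blast
  \<comment> \<open>With a point fixed by the whole torus any subtorus will do; the zero character
    serves to produce one.\<close>
  obtain H :: "(complex ^ 'k) set" where H: "codim_one_subtorus H"
    using codim_one_subtorus_in_character_kernel[of "\<lambda>_. 0"] by blast
  then have "H \<subseteq> carrier (torus UNIV)" by (simp add: codim_one_subtorus_def subgroup.subset)
  then show ?thesis using H p unfolding has_fixed_point_def by blast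
next
  case False
  then obtain p a where "vel a p \<noteq> (\<lambda>_. 0)" "\<And>b. \<exists>r. vel b p = (\<lambda>d. r *\<^sub>R vel a p d)"
    using one_dimensional_orbit_odd[OF X compact open_UNIV UNIV_not_empty odd] by blast
  from one_dimensional_orbit(2)[OF this] show ?thesis unfolding has_fixed_point_def by blast
qed

end

theorem corollary5p3:
  fixes A :: "('m::{t2_space,second_countable_topology}, 'n::finite) chart set"
    and g :: "('m, 'n) metric"
    and X :: "'m \<Rightarrow> ('m, 'n) tangent"
  assumes "smooth_atlas A"
    and "compact (UNIV :: 'm set)"
    and "riemannian_metric A g"
    and "smooth_vector_field A X"
    and "positive_weighted_sec A g X"
  shows "(even CARD('n) \<longrightarrow>
            (\<forall>K. killing_field A g K \<longrightarrow> (\<exists>p. is_zero_of K p)) \<and>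
            (\<forall>\<rho> :: complex ^ 'k::finite \<Rightarrow> 'm \<Rightarrow> 'm. isometric_torus_action A g \<rho> \<longrightarrow>
               has_fixed_point (carrier (torus UNIV)) \<rho>)) \<and>
         (odd CARD('n) \<longrightarrow>
            (\<forall>\<rho> :: complex ^ 'k \<Rightarrow> 'm \<Rightarrow> 'm. isometric_torus_action A g \<rho> \<longrightarrow>
               (nontrivial_action \<rho> \<longrightarrow> has_circle_orbit \<rho>) \<and>
               (\<exists>H. codim_one_subtorus H \<and> has_fixed_point H \<rho>)))"
proof -
  interpret riemannian_manifold A g using assms by unfold_locales
  have even: "has_fixed_point (carrier (torus UNIV)) \<rho>"
    if n: "even CARD('n)" and \<rho>: "isometric_torus_action A g \<rho>" for \<rho> :: "complex ^ 'k \<Rightarrow> 'm \<Rightarrow> 'm"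
  proof -
    interpret torus_action A g \<rho> using \<rho> by unfold_locales
    have "\<exists>p\<in>UNIV. vel b p = (\<lambda>_. 0)" for b
      using killing_field_has_zero[OF assms(4,5,2) n vel_killing[of b]] by (simp add: is_zero_of_def)
    then obtain p where "\<forall>t. act t p = p" using global_fixed_point[OF assms(2)] by blast
    then show ?thesis using fixed_iff unfolding has_fixed_point_def by blast
  qed
  have odd: "(nontrivial_action \<rho> \<longrightarrow> has_circle_orbit \<rho>) \<and> (\<exists>H. codim_one_subtorus H \<and> has_fixed_point H \<rho>)"
    if n: "odd CARD('n)" and \<rho>: "isometric_torus_action A g \<rho>" for \<rho> :: "complex ^ 'k \<Rightarrow> 'm \<Rightarrow> 'm"
  proof -
    interpret torus_action A g \<rho> using \<rho> by unfold_locales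
    show ?thesis
      using circle_orbit[OF assms(4,5,2) n] codim_one_subtorus_fixed_point[OF assms(4,5,2) n] by blast
  qed
  show ?thesis using killing_field_has_zero[OF assms(4,5,2)] even odd by blast
qed

end
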